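(* Let $p$ be a prime and let $n \ge 5$ be an integer. Let $V = \mathbb{F}_p^n$ and $W = \mathbb{F}_p^{n-3}$. For a given $B \in \mathrm{Alt}(V,W)$, call a proper subspace $H < V$ bad (for $B$) if $\dim W/B(H,H) \ge \dim V/H$. Let $B \in \mathrm{Alt}(V,W)$ be chosen uniformly at random. Then: (1) the expected number of bad subspaces of dimension at least $4$ tends to $0$ as either $n \to \infty$ or $p \to \infty$ (that is, as $\max(n,p) \to \infty$); (2) for fixed $p$, as $n \to \infty$, the number of bad (i.e., totally isotropic) $3$-dimensional subspaces converges in distribution to a Poisson random variable with parameter $$\lambda_p = (1-p^{-1})^{-1}(1-p^{-2})^{-1}(1-p^{-3})^{-1};$$ (3) the probability that there is no bad subspace is positive provided that either $\min(p,n) \ge 12$ or $n \ge 160$, and this probability tends to $\exp(-\lambda_p)$ if $p$ is fixed and $n \to \infty$.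
   Context: For vector spaces $V, W$ over a field, a bilinear map $B: V\times V \to W$ is alternating if $B(x,x)=0$ for all $x\in V$. $\mathrm{Alt}(V,W)$ denotes the (here finite) vector space of all alternating bilinear maps $V \times V \to W$. For a subspace $U \le V$, $B(U,U)$ denotes the linear span in $W$ of $\{B(x,y) : x,y\in U\}$. A subspace $U$ is totally isotropic (for $B$) if $B(U,U)=0$. Note that since $\dim W = n-3$, a $3$-dimensional subspace is bad if and only if it is totally isotropic. *)

theory Defs
  imports
    "HOL-Number_Theory.Residues"
    "HOL-Probability.Probability"
    "Jordan_Normal_Form.Missing_VectorSpace"
begin

text \<open>
  The prime \<open>p\<close> and the dimension \<open>n\<close> both vary inside the limits below, so they are
  natural numbers rather than types, and vector spaces are the carrier-based ones of
  \<^theory>\<open>VectorSpace.VectorSpace\<close>. Its \<^const>\<open>vectorspace.dim\<close> is the least size of a finite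
  generating set; the dimension of a subspace \<open>H\<close> of \<open>V\<close> is that of \<open>V\<lparr>carrier := H\<rparr>\<close>.
\<close>

definition quotient_space ::
    "('b, 'c, 'd) module_scheme \<Rightarrow> 'c set \<Rightarrow> ('b, 'c set) module" where
  "quotient_space V H =
     \<lparr>carrier = a_rcosets\<^bsub>V\<^esub> H, monoid.mult = (\<lambda>X Y. H), one = H, zero = H, add = set_add V,
      module.smult = (\<lambda>a X. \<Union>x\<in>X. H +>\<^bsub>V\<^esub> (a \<odot>\<^bsub>V\<^esub> x))\<rparr>"

text \<open>
  Bilinear maps are required to be extensional (undefined off the carriers), so that distinct
  elements of the set are distinct as maps and the set is finite for finite \<open>V\<close> and \<open>W\<close>.
\<close>

definition bilinear_maps ::
    "('a, 'e) ring_scheme \<Rightarrow> ('a, 'b, 'f) module_scheme \<Rightarrow> ('a, 'c, 'g) module_scheme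
      \<Rightarrow> ('b \<Rightarrow> 'b \<Rightarrow> 'c) set" where
  "bilinear_maps K V W =
     {B \<in> carrier V \<rightarrow>\<^sub>E (carrier V \<rightarrow>\<^sub>E carrier W).
        (\<forall>x\<in>carrier V. (\<lambda>y. B x y) \<in> module_hom K V W) \<and>
        (\<forall>y\<in>carrier V. (\<lambda>x. B x y) \<in> module_hom K V W)}"

definition alternating_maps ::
    "('a, 'e) ring_scheme \<Rightarrow> ('a, 'b, 'f) module_scheme \<Rightarrow> ('a, 'c, 'g) module_scheme
      \<Rightarrow> ('b \<Rightarrow> 'b \<Rightarrow> 'c) set" where
  "alternating_maps K V W =
     {B \<in> bilinear_maps K V W. \<forall>x\<in>carrier V. B x x = \<zero>\<^bsub>W\<^esub>}"

definition image_span ::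
    "('a, 'e) ring_scheme \<Rightarrow> ('a, 'c, 'g) module_scheme \<Rightarrow> ('b \<Rightarrow> 'b \<Rightarrow> 'c) \<Rightarrow> 'b set
      \<Rightarrow> 'c set" where
  "image_span K W B U = LinearCombinations.module.span K W {B x y | x y. x \<in> U \<and> y \<in> U}"

definition totally_isotropic ::
    "('a, 'e) ring_scheme \<Rightarrow> ('a, 'c, 'g) module_scheme \<Rightarrow> ('b \<Rightarrow> 'b \<Rightarrow> 'c) \<Rightarrow> 'b set
      \<Rightarrow> bool" where
  "totally_isotropic K W B U \<longleftrightarrow> image_span K W B U = {\<zero>\<^bsub>W\<^esub>}"

definition bad ::
    "('a, 'e) ring_scheme \<Rightarrow> ('a, 'b, 'f) module_scheme \<Rightarrow> ('a, 'c, 'g) module_scheme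
      \<Rightarrow> ('b \<Rightarrow> 'b \<Rightarrow> 'c) \<Rightarrow> 'b set \<Rightarrow> bool" where
  "bad K V W B H \<longleftrightarrow>
     VectorSpace.subspace K H V \<and> H \<noteq> carrier V \<and>
     vectorspace.dim K (quotient_space W (image_span K W B H))
       \<ge> vectorspace.dim K (quotient_space V H)"

abbreviation prime_field :: "nat \<Rightarrow> int ring" where
  "prime_field p \<equiv> residue_ring (int p)"

definition coord_space :: "nat \<Rightarrow> nat \<Rightarrow> (int, nat \<Rightarrow> int) module" where
  "coord_space p n = ring.func_space (prime_field p) {..<n}"

definition Alt :: "nat \<Rightarrow> nat \<Rightarrow> ((nat \<Rightarrow> int) \<Rightarrow> (nat \<Rightarrow> int) \<Rightarrow> nat \<Rightarrow> int) set" where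
  "Alt p n = alternating_maps (prime_field p) (coord_space p n) (coord_space p (n - 3))"

definition random_Alt ::
    "nat \<Rightarrow> nat \<Rightarrow> ((nat \<Rightarrow> int) \<Rightarrow> (nat \<Rightarrow> int) \<Rightarrow> nat \<Rightarrow> int) pmf" where
  "random_Alt p n = pmf_of_set (Alt p n)"

definition bad_subspaces ::
    "nat \<Rightarrow> nat \<Rightarrow> ((nat \<Rightarrow> int) \<Rightarrow> (nat \<Rightarrow> int) \<Rightarrow> nat \<Rightarrow> int) \<Rightarrow> (nat \<Rightarrow> int) set set" where
  "bad_subspaces p n B = {H. bad (prime_field p) (coord_space p n) (coord_space p (n - 3)) B H}"

definition subspace_dim :: "nat \<Rightarrow> nat \<Rightarrow> (nat \<Rightarrow> int) set \<Rightarrow> nat" where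
  "subspace_dim p n H = vectorspace.dim (prime_field p) ((coord_space p n)\<lparr>carrier := H\<rparr>)"

definition poisson_parameter :: "nat \<Rightarrow> real" where
  "poisson_parameter p =
     inverse (1 - 1 / real p) * inverse (1 - 1 / real p ^ 2) * inverse (1 - 1 / real p ^ 3)"

text \<open>
  The library's dimension and the uniform distribution are only meaningful for vector spaces and
  for nonempty finite sets, respectively; the facts below justify their use above.
\<close>

lemma subspace_abelian_subgroup:
  assumes "VectorSpace.subspace K H V"
  shows "abelian_subgroup H V"
proof -
  interpret V: vectorspace K V using assms by (rule subspace.vs)
  interpret S: LinearCombinations.submodule K H V
    using assms by (rule subspace.submod)
  have neg: "\<ominus>\<^bsub>V\<^esub> h \<in> H" if "h \<in> H" for h
  proof -
    have hV: "h \<in> carrier V" using that S.subset by auto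
    have "(\<ominus>\<^bsub>K\<^esub> \<one>\<^bsub>K\<^esub>) \<odot>\<^bsub>V\<^esub> h \<in> H" using that by (intro S.smult_closed) auto
    then show ?thesis using hV by (simp add: V.smult_l_minus)
  qed
  have "subgroup H (add_monoid V)"
  proof (rule V.M.add.subgroupI)
    show "H \<noteq> {}" using S.zero_closed by blast
  qed (use S.subset S.m_closed neg in \<open>auto simp: a_inv_def[symmetric]\<close>)
  then show ?thesis
    by (intro abelian_subgroupI3 additive_subgroup.intro V.M.abelian_group_axioms)
qed

lemma quotient_space_smult_coset:
  assumes "VectorSpace.subspace K H V" "a \<in> carrier K" "x \<in> carrier V"
  shows "a \<odot>\<^bsub>quotient_space V H\<^esub> (H +>\<^bsub>V\<^esub> x) = H +>\<^bsub>V\<^esub> (a \<odot>\<^bsub>V\<^esub> x)"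
proof -
  interpret V: vectorspace K V using assms(1) by (rule subspace.vs)
  interpret S: LinearCombinations.submodule K H V
    using assms(1) by (rule subspace.submod)
  interpret A: abelian_subgroup H V by (rule subspace_abelian_subgroup[OF assms(1)])
  have eq: "H +>\<^bsub>V\<^esub> (a \<odot>\<^bsub>V\<^esub> (h \<oplus>\<^bsub>V\<^esub> x)) = H +>\<^bsub>V\<^esub> (a \<odot>\<^bsub>V\<^esub> x)" if h: "h \<in> H" for h
  proof -
    have hV: "h \<in> carrier V" using h S.subset by auto
    have "a \<odot>\<^bsub>V\<^esub> (h \<oplus>\<^bsub>V\<^esub> x) = a \<odot>\<^bsub>V\<^esub> h \<oplus>\<^bsub>V\<^esub> a \<odot>\<^bsub>V\<^esub> x"
      using assms hV by (simp add: V.smult_r_distr)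
    moreover have "a \<odot>\<^bsub>V\<^esub> h \<in> H" using assms h by auto
    ultimately have "a \<odot>\<^bsub>V\<^esub> (h \<oplus>\<^bsub>V\<^esub> x) \<in> H +>\<^bsub>V\<^esub> (a \<odot>\<^bsub>V\<^esub> x)"
      by (auto simp: a_r_coset_def')
    then show ?thesis using assms by (metis A.a_repr_independence' V.smult_closed)
  qed
  have "a \<odot>\<^bsub>quotient_space V H\<^esub> (H +>\<^bsub>V\<^esub> x)
      = (\<Union>h\<in>H. H +>\<^bsub>V\<^esub> (a \<odot>\<^bsub>V\<^esub> (h \<oplus>\<^bsub>V\<^esub> x)))"
    by (simp add: quotient_space_def a_r_coset_def'[of V H x])
  also have "\<dots> = H +>\<^bsub>V\<^esub> (a \<odot>\<^bsub>V\<^esub> x)"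
  proof -
    have "H \<noteq> {}" using S.zero_closed by blast
    then show ?thesis using eq by (simp cong: SUP_cong)
  qed
  finally show ?thesis .
qed

lemma quotient_space_vectorspace:
  assumes "VectorSpace.subspace K H V"
  shows "vectorspace K (quotient_space V H)"
proof -
  interpret V: vectorspace K V using assms(1) by (rule subspace.vs)
  interpret A: abelian_subgroup H V by (rule subspace_abelian_subgroup[OF assms])
  let ?Q = "quotient_space V H"
  have carr: "X \<in> carrier ?Q \<longleftrightarrow> (\<exists>x\<in>carrier V. X = H +>\<^bsub>V\<^esub> x)" for X
    by (auto simp: quotient_space_def A_RCOSETS_def')
  have add: "(H +>\<^bsub>V\<^esub> x) \<oplus>\<^bsub>?Q\<^esub> (H +>\<^bsub>V\<^esub> y) = H +>\<^bsub>V\<^esub> (x \<oplus>\<^bsub>V\<^esub> y)"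
    if "x \<in> carrier V" "y \<in> carrier V" for x y
    using that A.a_rcos_sum by (simp add: quotient_space_def)
  have zero: "\<zero>\<^bsub>?Q\<^esub> = H +>\<^bsub>V\<^esub> \<zero>\<^bsub>V\<^esub>"
    using A.a_subset by (simp add: quotient_space_def)
  have ab: "abelian_group ?Q"
  proof (rule abelian_groupI)
    fix X assume "X \<in> carrier ?Q"
    then obtain x where x: "x \<in> carrier V" "X = H +>\<^bsub>V\<^esub> x" by (auto simp: carr)
    have "(H +>\<^bsub>V\<^esub> (\<ominus>\<^bsub>V\<^esub> x)) \<oplus>\<^bsub>?Q\<^esub> X = \<zero>\<^bsub>?Q\<^esub>"
      using x by (simp add: add zero V.M.l_neg)
    then show "\<exists>Y\<in>carrier ?Q. Y \<oplus>\<^bsub>?Q\<^esub> X = \<zero>\<^bsub>?Q\<^esub>"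
      using x(1) carr by blast
  next
    fix X Y assume "X \<in> carrier ?Q" "Y \<in> carrier ?Q"
    then obtain x y where xy: "x \<in> carrier V" "X = H +>\<^bsub>V\<^esub> x" "y \<in> carrier V" "Y = H +>\<^bsub>V\<^esub> y"
      by (auto simp: carr)
    then show "X \<oplus>\<^bsub>?Q\<^esub> Y \<in> carrier ?Q" by (auto simp: add carr)
    show "X \<oplus>\<^bsub>?Q\<^esub> Y = Y \<oplus>\<^bsub>?Q\<^esub> X" using xy V.M.a_comm[of x y] by (simp add: add)
  qed (auto simp: carr add zero V.M.a_assoc)
  note sm = quotient_space_smult_coset[OF assms]
  have "module K ?Q"
    by (rule moduleI[OF V.R.cring_axioms ab])
       (auto simp: carr sm add V.smult_l_distr V.smult_r_distr V.smult_assoc1)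
  then show ?thesis by (intro vectorspace.intro V.field_axioms)
qed

lemma coord_space_vectorspace:
  assumes "prime p"
  shows "vectorspace (prime_field p) (coord_space p n)"
proof -
  interpret residues_prime p "prime_field p"
    using assms by unfold_locales simp_all
  show ?thesis
    unfolding coord_space_def
    by (intro vectorspace.intro func_space_is_module field_axioms)
qed

lemma carrier_coord_space:
  assumes "prime p"
  shows "carrier (coord_space p n) = {..<n} \<rightarrow>\<^sub>E {0..int p - 1}"
proof -
  interpret residues_prime p "prime_field p"
    using assms by unfold_locales simp_all
  show ?thesis
    by (simp add: coord_space_def func_space_def) (simp add: residue_ring_def)
qed

lemma finite_Alt:
  assumes "prime p"
  shows "finite (Alt p n)"
proof (rule finite_subset)
  let ?V = "carrier (coord_space p n)" and ?W = "carrier (coord_space p (n - 3))"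
  show "Alt p n \<subseteq> ?V \<rightarrow>\<^sub>E (?V \<rightarrow>\<^sub>E ?W)"
    by (auto simp: Alt_def alternating_maps_def bilinear_maps_def)
  show "finite (?V \<rightarrow>\<^sub>E (?V \<rightarrow>\<^sub>E ?W))"
    by (simp add: carrier_coord_space[OF assms] finite_PiE)
qed

lemma Alt_nonempty:
  assumes "prime p"
  shows "Alt p n \<noteq> {}"
proof -
  interpret V: vectorspace "prime_field p" "coord_space p n"
    by (rule coord_space_vectorspace[OF assms])
  interpret W: vectorspace "prime_field p" "coord_space p (n - 3)"
    by (rule coord_space_vectorspace[OF assms])
  have "(\<lambda>x\<in>carrier (coord_space p n). \<lambda>y\<in>carrier (coord_space p n).
           \<zero>\<^bsub>coord_space p (n - 3)\<^esub>) \<in> Alt p n"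
    by (auto simp: Alt_def alternating_maps_def bilinear_maps_def module_hom_def)
  then show ?thesis by auto
qed

end

theory Submission
  imports Defs
begin

text \<open>
  Write \<open>q\<close> for the size of the field. In terms of dimensions, a proper subspace \<open>H\<close> is bad iff
  \<open>dim B(H, H) \<le> dim H - 3\<close>. A random \<open>B\<close> takes independent uniform values on the pairs of vectors
  from a basis of \<open>H\<close>, so a union bound over \<open>H\<close> and over the subspaces of dimension \<open>dim H - 3\<close>
  containing \<open>B(H, H)\<close> shows that at most \<open>O(n / q ^ (n - 4))\<close> bad subspaces of dimension at least 4
  are expected.

  The number \<open>X\<close> of isotropic three-dimensional subspaces is handled by its binomial moments. A tuple
  of \<open>r\<close> subspaces in direct sum is isotropic with probability \<open>q ^ (- 3 * r * (n - 3))\<close>, and counting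
  these tuples gives the moments of the Poisson distribution. Any other tuple of distinct subspaces,
  with an \<open>s\<close>-dimensional sum, imposes at least \<open>s + 1\<close> independent conditions, and the number of such
  tuples is too small for them to matter. Bonferroni's inequalities turn the moments into the Poisson
  limit and, applied with three or nine terms, into the positivity of the probability that \<open>X = 0\<close>.
\<close>

section \<open>Linear algebra over a finite field\<close>

text \<open>The exponents explain the split at dimension 3. Up to bounded factors there are
  \<open>q ^ (h * (n - h))\<close> subspaces \<open>H\<close> of dimension \<open>h\<close> and
  \<open>q ^ ((h - 3) * (n - h))\<close> subspaces of \<open>W\<close> of dimension
  \<open>h - 3\<close>, and one of the latter contains \<open>B(H, H)\<close> with probability
  \<open>q ^ (- (n - h) * h * (h - 1) / 2)\<close>. The total exponent is
  \<open>- (n - h) * (h - 2) * (h - 3) / 2\<close>: zero for \<open>h = 3\<close>, so these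
  subspaces survive in the limit, and at most \<open>- (n - 4)\<close> for
  \<open>4 \<le> h < n\<close>. In the moments the danger comes from overlapping tuples:
  \<open>s\<close> conditions alone would leave a contribution of order one. The surplus condition
  has two sources. A subspace that meets the sum of the others in dimension 1 or 2 brings one
  condition more than it brings dimensions; a subspace inside a direct sum, but not among the
  summands, is detected by a form that vanishes on every summand. Dimensions are handled throughout
  as cardinalities \<open>q ^ k\<close>.\<close>

context vectorspace begin

lemma subspaceI:
  assumes "H \<subseteq> carrier V" "\<zero>\<^bsub>V\<^esub> \<in> H"
    and "\<And>x y. x \<in> H \<Longrightarrow> y \<in> H \<Longrightarrow> x \<oplus>\<^bsub>V\<^esub> y \<in> H"
    and "\<And>c x. c \<in> carrier K \<Longrightarrow> x \<in> H \<Longrightarrow> c \<odot>\<^bsub>V\<^esub> x \<in> H"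
  shows "subspace K H V"
  using assms vectorspace_axioms module_axioms
  by (auto simp: subspace_def LinearCombinations.submodule_def)

lemma subspaceD:
  assumes "subspace K H V"
  shows "H \<subseteq> carrier V" "x \<in> H \<Longrightarrow> x \<in> carrier V" "\<zero>\<^bsub>V\<^esub> \<in> H"
    "x \<in> H \<Longrightarrow> y \<in> H \<Longrightarrow> x \<oplus>\<^bsub>V\<^esub> y \<in> H"
    "c \<in> carrier K \<Longrightarrow> x \<in> H \<Longrightarrow> c \<odot>\<^bsub>V\<^esub> x \<in> H"
  using assms by (auto simp: subspace_def LinearCombinations.submodule_def)

lemma subspace_neg:
  assumes "subspace K H V" "x \<in> H"
  shows "\<ominus>\<^bsub>V\<^esub> x \<in> H"
proof -
  have "(\<ominus>\<^bsub>K\<^esub> \<one>\<^bsub>K\<^esub>) \<odot>\<^bsub>V\<^esub> x \<in> H" using assms by (intro subspaceD) auto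
  then show ?thesis using assms subspaceD[OF assms(1)] by (simp add: smult_l_minus)
qed

lemma subspace_carrier: "subspace K (carrier V) V"
  by (rule subspaceI) auto

lemma subspace_zero: "subspace K {\<zero>\<^bsub>V\<^esub>} V"
  by (rule subspaceI) auto

lemma subspace_inter: "subspace K A V \<Longrightarrow> subspace K B V \<Longrightarrow> subspace K (A \<inter> B) V"
  by (rule subspaceI) (auto dest: subspaceD)

lemma subspace_smult_cancel:
  assumes H: "subspace K H V" and "c \<in> carrier K" "c \<noteq> \<zero>\<^bsub>K\<^esub>" "x \<in> carrier V" "c \<odot>\<^bsub>V\<^esub> x \<in> H"
  shows "x \<in> H"
proof -
  have "inv\<^bsub>K\<^esub> c \<odot>\<^bsub>V\<^esub> (c \<odot>\<^bsub>V\<^esub> x) \<in> H"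
    by (rule subspaceD(5)[OF H]) (use assms in \<open>auto simp: field_Units\<close>)
  moreover have "inv\<^bsub>K\<^esub> c \<odot>\<^bsub>V\<^esub> (c \<odot>\<^bsub>V\<^esub> x) = x"
    using assms by (simp add: field_Units smult_assoc1[symmetric])
  ultimately show ?thesis by simp
qed

lemma subspace_add_cancel:
  assumes H: "subspace K H V" and "x \<in> carrier V" "y \<in> H" "x \<oplus>\<^bsub>V\<^esub> y \<in> H"
  shows "x \<in> H"
proof -
  have "(x \<oplus>\<^bsub>V\<^esub> y) \<oplus>\<^bsub>V\<^esub> (\<ominus>\<^bsub>V\<^esub> y) \<in> H"
    by (intro subspaceD(4)[OF H] assms subspace_neg)
  moreover have "(x \<oplus>\<^bsub>V\<^esub> y) \<oplus>\<^bsub>V\<^esub> (\<ominus>\<^bsub>V\<^esub> y) = x"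
    using assms(2,3) subspaceD(2)[OF H] by (simp add: M.a_assoc M.r_neg)
  ultimately show ?thesis by simp
qed

lemma subspace_add_cancel':
  assumes H: "subspace K H V" and "x \<in> carrier V" "y \<in> H" "y \<oplus>\<^bsub>V\<^esub> x \<in> H"
  shows "x \<in> H"
  using assms subspace_add_cancel[of H x y] subspaceD(2)[OF H] by (simp add: M.a_comm)

text \<open>If \<open>c\<close> and \<open>d\<close> differed, \<open>(c - d) x\<close> would lie in
  \<open>H\<close>, and dividing by the nonzero scalar would put \<open>x\<close> there.\<close>

lemma line_coords_unique:
  assumes H: "subspace K H V" and x: "x \<in> carrier V" "x \<notin> H"
    and cd: "c \<in> carrier K" "d \<in> carrier K" and yz: "y \<in> H" "z \<in> H"
    and eq: "c \<odot>\<^bsub>V\<^esub> x \<oplus>\<^bsub>V\<^esub> y = d \<odot>\<^bsub>V\<^esub> x \<oplus>\<^bsub>V\<^esub> z"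
  shows "c = d \<and> y = z"
proof -
  note V = subspaceD(2)[OF H]
  define e where "e = c \<ominus>\<^bsub>K\<^esub> d"
  have e: "e \<in> carrier K" using cd by (simp add: e_def)
  have ce: "c = d \<oplus>\<^bsub>K\<^esub> e"
    unfolding e_def using cd by (metis R.add.inv_closed R.add.m_comm R.add.m_closed R.minus_eq R.r_neg2)
  have mem: "c \<odot>\<^bsub>V\<^esub> x \<in> carrier V" "d \<odot>\<^bsub>V\<^esub> x \<in> carrier V" "e \<odot>\<^bsub>V\<^esub> x \<in> carrier V"
    "y \<in> carrier V" "z \<in> carrier V" using x cd e yz V by auto
  have "d \<odot>\<^bsub>V\<^esub> x \<oplus>\<^bsub>V\<^esub> (e \<odot>\<^bsub>V\<^esub> x \<oplus>\<^bsub>V\<^esub> y) = (d \<oplus>\<^bsub>K\<^esub> e) \<odot>\<^bsub>V\<^esub> x \<oplus>\<^bsub>V\<^esub> y"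
    using mem cd e x(1) by (simp add: smult_l_distr M.a_assoc)
  also have "\<dots> = d \<odot>\<^bsub>V\<^esub> x \<oplus>\<^bsub>V\<^esub> z" using eq ce by simp
  finally have *: "e \<odot>\<^bsub>V\<^esub> x \<oplus>\<^bsub>V\<^esub> y = z" using mem by simp
  have "e \<odot>\<^bsub>V\<^esub> x \<in> H"
    by (rule subspace_add_cancel[OF H, of _ y]) (use mem yz * in auto)
  then have "e = \<zero>\<^bsub>K\<^esub>"
    using subspace_smult_cancel[OF H] x e by blast
  then have "c = d" using cd ce by simp
  moreover have "y = z" using * \<open>e = \<zero>\<^bsub>K\<^esub>\<close> x mem by simp
  ultimately show ?thesis by simp
qed

lemma subspace_sum:
  assumes A: "subspace K A V" and B: "subspace K B V"
  shows "subspace K (A <+>\<^bsub>V\<^esub> B) V"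
proof (rule subspaceI)
  note VA = subspaceD[OF A] and VB = subspaceD[OF B]
  show "A <+>\<^bsub>V\<^esub> B \<subseteq> carrier V" using VA(1) VB(1) by (auto simp: set_add_def')
  show "\<zero>\<^bsub>V\<^esub> \<in> A <+>\<^bsub>V\<^esub> B" using VA(3) VB(3) by (force simp: set_add_def')
  fix x y assume "x \<in> A <+>\<^bsub>V\<^esub> B" "y \<in> A <+>\<^bsub>V\<^esub> B"
  then obtain a b a' b' where ab: "a \<in> A" "b \<in> B" "x = a \<oplus>\<^bsub>V\<^esub> b" "a' \<in> A" "b' \<in> B" "y = a' \<oplus>\<^bsub>V\<^esub> b'"
    by (auto simp: set_add_def')
  then have "x \<oplus>\<^bsub>V\<^esub> y = (a \<oplus>\<^bsub>V\<^esub> a') \<oplus>\<^bsub>V\<^esub> (b \<oplus>\<^bsub>V\<^esub> b')"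
    using VA(2) VB(2) by (simp add: M.a_ac)
  then show "x \<oplus>\<^bsub>V\<^esub> y \<in> A <+>\<^bsub>V\<^esub> B"
    using VA(4)[OF ab(1,4)] VB(4)[OF ab(2,5)] unfolding set_add_def' by blast
next
  note VA = subspaceD[OF A] and VB = subspaceD[OF B]
  fix c x assume c: "c \<in> carrier K" and "x \<in> A <+>\<^bsub>V\<^esub> B"
  then obtain a b where ab: "a \<in> A" "b \<in> B" "x = a \<oplus>\<^bsub>V\<^esub> b"
    by (auto simp: set_add_def')
  then have "c \<odot>\<^bsub>V\<^esub> x = (c \<odot>\<^bsub>V\<^esub> a) \<oplus>\<^bsub>V\<^esub> (c \<odot>\<^bsub>V\<^esub> b)"
    using VA(2) VB(2) c by (simp add: smult_r_distr)
  then show "c \<odot>\<^bsub>V\<^esub> x \<in> A <+>\<^bsub>V\<^esub> B"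
    using VA(5)[OF c ab(1)] VB(5)[OF c ab(2)] unfolding set_add_def' by blast
qed

lemma sum_mem: "a \<in> A \<Longrightarrow> b \<in> B \<Longrightarrow> a \<oplus>\<^bsub>V\<^esub> b \<in> A <+>\<^bsub>V\<^esub> B"
  by (auto simp: set_add_def')

lemma sum_upper:
  assumes A: "subspace K A V" and B: "subspace K B V"
  shows "A \<subseteq> A <+>\<^bsub>V\<^esub> B" "B \<subseteq> A <+>\<^bsub>V\<^esub> B"
proof
  fix x assume "x \<in> A"
  then show "x \<in> A <+>\<^bsub>V\<^esub> B"
    using sum_mem[of x A "\<zero>\<^bsub>V\<^esub>" B] subspaceD[OF A] subspaceD[OF B] by auto
next
  show "B \<subseteq> A <+>\<^bsub>V\<^esub> B"
  proof
    fix x assume "x \<in> B"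
    then show "x \<in> A <+>\<^bsub>V\<^esub> B"
      using sum_mem[of "\<zero>\<^bsub>V\<^esub>" A x B] subspaceD[OF A] subspaceD[OF B] by auto
  qed
qed

lemma sum_least: "subspace K C V \<Longrightarrow> A \<subseteq> C \<Longrightarrow> B \<subseteq> C \<Longrightarrow> A <+>\<^bsub>V\<^esub> B \<subseteq> C"
  unfolding set_add_def' using subspaceD(4) by blast

text \<open>
  Lists, rather than sets, of vectors make both the count of independent families and the
  bookkeeping of pairs of vectors below recursive. A list is independent if no entry lies in the
  span of the later ones.
\<close>

primrec lspan :: "'c list \<Rightarrow> 'c set" where
  "lspan [] = {\<zero>\<^bsub>V\<^esub>}"
| "lspan (x # xs) = (\<lambda>(c, y). c \<odot>\<^bsub>V\<^esub> x \<oplus>\<^bsub>V\<^esub> y) ` (carrier K \<times> lspan xs)"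

primrec indep :: "'c list \<Rightarrow> bool" where
  "indep [] = True"
| "indep (x # xs) = (x \<in> carrier V \<and> x \<notin> lspan xs \<and> indep xs)"

lemma indep_carrier: "indep xs \<Longrightarrow> set xs \<subseteq> carrier V"
  by (induction xs) auto

lemma subspace_line: "x \<in> carrier V \<Longrightarrow> subspace K ((\<lambda>c. c \<odot>\<^bsub>V\<^esub> x) ` carrier K) V"
proof (rule subspaceI)
  assume x: "x \<in> carrier V"
  show "\<zero>\<^bsub>V\<^esub> \<in> (\<lambda>c. c \<odot>\<^bsub>V\<^esub> x) ` carrier K" using x by (force intro!: image_eqI[of _ _ "\<zero>\<^bsub>K\<^esub>"])
  fix a b assume "a \<in> (\<lambda>c. c \<odot>\<^bsub>V\<^esub> x) ` carrier K" "b \<in> (\<lambda>c. c \<odot>\<^bsub>V\<^esub> x) ` carrier K"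
  then show "a \<oplus>\<^bsub>V\<^esub> b \<in> (\<lambda>c. c \<odot>\<^bsub>V\<^esub> x) ` carrier K"
    using x by (auto simp: smult_l_distr[symmetric])
qed (auto simp: smult_assoc1[symmetric])

lemma lspan_Cons_sum: "lspan (x # xs) = (\<lambda>c. c \<odot>\<^bsub>V\<^esub> x) ` carrier K <+>\<^bsub>V\<^esub> lspan xs"
  by (auto simp: set_add_def')

lemma lspan_ConsE:
  assumes "v \<in> lspan (x # xs)"
  obtains c y where "c \<in> carrier K" "y \<in> lspan xs" "v = c \<odot>\<^bsub>V\<^esub> x \<oplus>\<^bsub>V\<^esub> y"
  using assms by (auto simp: image_iff)

lemma lspan_subspace: "set xs \<subseteq> carrier V \<Longrightarrow> subspace K (lspan xs) V"
proof (induction xs)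
  case Nil then show ?case by (simp add: subspace_zero)
next
  case (Cons x xs)
  then show ?case unfolding lspan_Cons_sum by (intro subspace_sum subspace_line) auto
qed

lemma lspan_least: "subspace K H V \<Longrightarrow> set xs \<subseteq> H \<Longrightarrow> lspan xs \<subseteq> H"
  by (induction xs) (auto simp: subspaceD)

lemma lspan_Cons_superset: "x \<in> carrier V \<Longrightarrow> set xs \<subseteq> carrier V \<Longrightarrow> lspan xs \<subseteq> lspan (x # xs)"
  unfolding lspan_Cons_sum by (intro sum_upper subspace_line lspan_subspace)

lemma lspan_superset: "set xs \<subseteq> carrier V \<Longrightarrow> set xs \<subseteq> lspan xs"
proof (induction xs)
  case (Cons x xs)
  have "x \<in> lspan (x # xs)"
    using Cons.prems subspaceD(3)[OF lspan_subspace[of xs]]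
    by (force intro!: image_eqI[of _ _ "(\<one>\<^bsub>K\<^esub>, \<zero>\<^bsub>V\<^esub>)"])
  then show ?case using Cons lspan_Cons_superset[of x xs] by auto
qed simp

lemma lspan_append:
  assumes "set xs \<subseteq> carrier V" "set ys \<subseteq> carrier V"
  shows "lspan (xs @ ys) = lspan xs <+>\<^bsub>V\<^esub> lspan ys"
proof
  have S: "subspace K (lspan xs) V" "subspace K (lspan ys) V" "subspace K (lspan (xs @ ys)) V"
    using assms by (auto intro!: lspan_subspace)
  show "lspan (xs @ ys) \<subseteq> lspan xs <+>\<^bsub>V\<^esub> lspan ys"
    using lspan_superset[of xs] lspan_superset[of ys] assms sum_upper[OF S(1,2)]
    by (intro lspan_least subspace_sum S) auto
  show "lspan xs <+>\<^bsub>V\<^esub> lspan ys \<subseteq> lspan (xs @ ys)"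
    using lspan_superset[of "xs @ ys"] assms by (intro sum_least S lspan_least) auto
qed

text \<open>The bridge to the library's \<open>span\<close>, through which \<open>dim\<close> is
  reached.\<close>

lemma span_eq_lspan:
  assumes "set xs \<subseteq> carrier V"
  shows "span (set xs) = lspan xs"
proof
  show "span (set xs) \<subseteq> lspan xs"
    using lspan_subspace[OF assms] lspan_superset[OF assms]
    by (intro span_is_subset) (auto simp: subspace_def)
  show "lspan xs \<subseteq> span (set xs)"
    using assms in_own_span[OF assms] span_is_subspace[OF assms] by (intro lspan_least)
qed

text \<open>\<open>indep\<close> reads a list from one end. This symmetric form allows lists to be
  cut and glued, which is how complements and tails of independent lists are obtained later.\<close>

lemma indep_append:
  assumes "set xs \<subseteq> carrier V" "set ys \<subseteq> carrier V"
  shows "indep (xs @ ys) \<longleftrightarrow> indep xs \<and> indep ys \<and> lspan xs \<inter> lspan ys = {\<zero>\<^bsub>V\<^esub>}"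
  using assms(1)
proof (induction xs)
  case Nil
  then show ?case using subspaceD(3)[OF lspan_subspace[OF assms(2)]] by auto
next
  case (Cons x xs)
  have x: "x \<in> carrier V" and xs: "set xs \<subseteq> carrier V" using Cons.prems by auto
  note Sx = lspan_subspace[OF xs] and Sy = lspan_subspace[OF assms(2)]
  have Sc: "subspace K (lspan (x # xs)) V" using Cons.prems by (intro lspan_subspace)
  have z: "\<zero>\<^bsub>V\<^esub> \<in> lspan (x # xs) \<inter> lspan ys" using subspaceD(3)[OF Sc] subspaceD(3)[OF Sy] by blast
  have up: "lspan xs \<subseteq> lspan (x # xs)" by (rule lspan_Cons_superset[OF x xs])
  \<comment> \<open>A vector \<open>c x + a\<close> of \<open>lspan (x # xs)\<close> that lies in
    \<open>lspan ys\<close> must have \<open>c = 0\<close>, or else \<open>x\<close> would lie in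
    \<open>lspan (xs @ ys)\<close>; then \<open>d\<close> forces \<open>a\<close> to vanish as
    well.\<close>
  have key: "x \<notin> lspan (xs @ ys) \<longleftrightarrow> x \<notin> lspan xs \<and> lspan (x # xs) \<inter> lspan ys = {\<zero>\<^bsub>V\<^esub>}"
    if d: "lspan xs \<inter> lspan ys = {\<zero>\<^bsub>V\<^esub>}"
  proof
    assume xn: "x \<notin> lspan (xs @ ys)"
    then have xs': "x \<notin> lspan xs"
      using sum_upper(1)[OF Sx Sy] lspan_append[OF xs assms(2)] by auto
    have "v = \<zero>\<^bsub>V\<^esub>" if v: "v \<in> lspan (x # xs)" "v \<in> lspan ys" for v
    proof -
      obtain c a where ca: "c \<in> carrier K" "a \<in> lspan xs" "v = c \<odot>\<^bsub>V\<^esub> x \<oplus>\<^bsub>V\<^esub> a"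
        using lspan_ConsE[OF v(1)] by blast
      have a: "a \<in> carrier V" using subspaceD(2)[OF Sx] ca by auto
      have "c = \<zero>\<^bsub>K\<^esub>"
      proof (rule ccontr)
        assume c0: "c \<noteq> \<zero>\<^bsub>K\<^esub>"
        have S: "subspace K (lspan (xs @ ys)) V" using xs assms(2) by (intro lspan_subspace) auto
        have "a \<in> lspan (xs @ ys)" "v \<in> lspan (xs @ ys)"
          using ca that sum_upper[OF Sx Sy] lspan_append[OF xs assms(2)] by auto
        then have "c \<odot>\<^bsub>V\<^esub> x \<in> lspan (xs @ ys)"
          using subspace_add_cancel[OF S] ca x by auto
        then show False using subspace_smult_cancel[OF S ca(1) c0 x] xn by auto
      qed
      then have "v = a" using ca x a by simp
      then show ?thesis using d that ca by auto
    qed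
    then show "x \<notin> lspan xs \<and> lspan (x # xs) \<inter> lspan ys = {\<zero>\<^bsub>V\<^esub>}" using xs' z by blast
  next
    assume h: "x \<notin> lspan xs \<and> lspan (x # xs) \<inter> lspan ys = {\<zero>\<^bsub>V\<^esub>}"
    show "x \<notin> lspan (xs @ ys)"
    proof
      assume "x \<in> lspan (xs @ ys)"
      then obtain a b where ab: "a \<in> lspan xs" "b \<in> lspan ys" "x = a \<oplus>\<^bsub>V\<^esub> b"
        unfolding lspan_append[OF xs assms(2)] by (auto simp: set_add_def')
      have "x \<in> lspan (x # xs)" "a \<in> lspan (x # xs)"
        using lspan_superset[of "x # xs"] Cons.prems up ab by auto
      then have "b \<in> lspan (x # xs)"
        using ab subspace_add_cancel'[OF Sc, of b a] subspaceD(2)[OF Sy] by auto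
      then have "b = \<zero>\<^bsub>V\<^esub>" using h ab by blast
      then show False using ab h subspaceD(2)[OF Sx] by auto
    qed
  qed
  have d': "lspan xs \<inter> lspan ys = {\<zero>\<^bsub>V\<^esub>}" if "lspan (x # xs) \<inter> lspan ys = {\<zero>\<^bsub>V\<^esub>}"
    using that up subspaceD(3)[OF Sx] subspaceD(3)[OF Sy] by auto
  show ?case unfolding append_Cons indep.simps Cons.IH[OF xs] using key d' x by blast
qed

definition functional :: "('c \<Rightarrow> 'a) \<Rightarrow> bool" where
  "functional f \<longleftrightarrow> (\<forall>x\<in>carrier V. f x \<in> carrier K) \<and>
     (\<forall>x\<in>carrier V. \<forall>y\<in>carrier V. f (x \<oplus>\<^bsub>V\<^esub> y) = f x \<oplus>\<^bsub>K\<^esub> f y) \<and>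
     (\<forall>c\<in>carrier K. \<forall>x\<in>carrier V. f (c \<odot>\<^bsub>V\<^esub> x) = c \<otimes>\<^bsub>K\<^esub> f x)"

lemma functionalD:
  assumes "functional f"
  shows "x \<in> carrier V \<Longrightarrow> f x \<in> carrier K"
    "x \<in> carrier V \<Longrightarrow> y \<in> carrier V \<Longrightarrow> f (x \<oplus>\<^bsub>V\<^esub> y) = f x \<oplus>\<^bsub>K\<^esub> f y"
    "c \<in> carrier K \<Longrightarrow> x \<in> carrier V \<Longrightarrow> f (c \<odot>\<^bsub>V\<^esub> x) = c \<otimes>\<^bsub>K\<^esub> f x"
  using assms by (auto simp: functional_def)

end

section \<open>Cardinalities, dimension, separating forms and counts of subspaces\<close>

locale finite_vectorspace = vectorspace +
  assumes finite_K: "finite (carrier K)" and finite_V: "finite (carrier V)"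
begin

abbreviation "q \<equiv> card (carrier K)"

lemma q_ge_2: "q \<ge> 2"
proof -
  have "card {\<zero>\<^bsub>K\<^esub>, \<one>\<^bsub>K\<^esub>} \<le> q" using finite_K by (intro card_mono) auto
  then show ?thesis by simp
qed

lemma finite_subspace: "subspace K H V \<Longrightarrow> finite H"
  using finite_V subspaceD(1) finite_subset by blast

lemma finite_subspaces: "finite {H. subspace K H V}"
  by (rule finite_subset[of _ "Pow (carrier V)"]) (use finite_V in \<open>auto dest: subspaceD\<close>)

lemma card_line_sum:
  assumes H: "subspace K H V" and x: "x \<in> carrier V" "x \<notin> H"
  shows "card ((\<lambda>(c, y). c \<odot>\<^bsub>V\<^esub> x \<oplus>\<^bsub>V\<^esub> y) ` (carrier K \<times> H)) = q * card H"
proof -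
  have "inj_on (\<lambda>(c, y). c \<odot>\<^bsub>V\<^esub> x \<oplus>\<^bsub>V\<^esub> y) (carrier K \<times> H)"
    by (rule inj_onI) (use line_coords_unique[OF H x] in auto)
  then show ?thesis by (simp add: card_image card_cartesian_product)
qed

lemma card_lspan: "indep xs \<Longrightarrow> card (lspan xs) = q ^ length xs"
  by (induction xs) (simp_all add: card_line_sum lspan_subspace indep_carrier)

lemma card_lspan_le: "set xs \<subseteq> carrier V \<Longrightarrow> card (lspan xs) \<le> q ^ length xs"
proof (induction xs)
  case (Cons x xs)
  have "card (lspan (x # xs)) \<le> card (carrier K \<times> lspan xs)"
    unfolding lspan.simps using finite_K finite_subspace[OF lspan_subspace[of xs]] Cons.prems
    by (intro card_image_le) auto
  then show ?case using Cons by (simp add: card_cartesian_product order_trans)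
qed simp

text \<open>New vectors go in front of \<open>ys\<close>, the side on which \<open>indep\<close>
  grows without rechecking old entries. The induction shrinks the part of \<open>H\<close> that is
  not yet spanned.\<close>

lemma indep_extend:
  assumes H: "subspace K H V"
  shows "indep ys \<Longrightarrow> set ys \<subseteq> H \<Longrightarrow> \<exists>xs. set xs \<subseteq> H \<and> indep (xs @ ys) \<and> lspan (xs @ ys) = H"
proof (induction "card (H - lspan ys)" arbitrary: ys rule: less_induct)
  case less
  have sub: "lspan ys \<subseteq> H" by (intro lspan_least H less.prems)
  show ?case
  proof (cases "lspan ys = H")
    case True
    then show ?thesis using less.prems by (intro exI[of _ "[]"]) auto
  next
    case False
    then obtain x where x: "x \<in> H" "x \<notin> lspan ys" using sub by auto
    have xV: "x \<in> carrier V" using subspaceD[OF H] x by auto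
    have "x \<in> lspan (x # ys)" "lspan ys \<subseteq> lspan (x # ys)"
      using lspan_superset[of "x # ys"] lspan_Cons_superset[of x ys] indep_carrier[OF less.prems(1)] xV
      by auto
    then have "H - lspan (x # ys) \<subset> H - lspan ys" using x by blast
    then have "card (H - lspan (x # ys)) < card (H - lspan ys)"
      using finite_subspace[OF H] by (intro psubset_card_mono) auto
    moreover have "indep (x # ys)" "set (x # ys) \<subseteq> H" using x xV less.prems by auto
    ultimately obtain xs where "set xs \<subseteq> H" "indep (xs @ x # ys)" "lspan (xs @ x # ys) = H"
      using less.hyps[of "x # ys"] by blast
    then show ?thesis using x by (intro exI[of _ "xs @ [x]"]) auto
  qed
qed

lemma subspace_basis:
  assumes H: "subspace K H V"
  obtains xs where "indep xs" "lspan xs = H" "set xs \<subseteq> H" "card H = q ^ length xs"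
  using indep_extend[OF H, of "[]"] card_lspan by auto

text \<open>A generating set of \<open>m\<close> vectors spans at most \<open>q ^ m\<close> vectors,
  so no generating set is smaller than a basis. This is what allows cardinalities to stand in for
  \<open>dim\<close>.\<close>

lemma dim_eq_iff: "dim = k \<longleftrightarrow> card (carrier V) = q ^ k"
proof -
  obtain xs where xs: "indep xs" "lspan xs = carrier V" "set xs \<subseteq> carrier V" "card (carrier V) = q ^ length xs"
    using subspace_basis[OF subspace_carrier] by metis
  have inj: "q ^ a = q ^ b \<longleftrightarrow> a = b" for a b :: nat using q_ge_2 by (intro power_inject_exp) auto
  have ge: "length xs \<le> card A" if "finite A" "A \<subseteq> carrier V" "gen_set A" for A
  proof -
    obtain ys where ys: "set ys = A" "length ys = card A"
      using \<open>finite A\<close> by (metis finite_distinct_list distinct_card)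
    have "q ^ length xs \<le> q ^ card A"
      using card_lspan_le[of ys] span_eq_lspan[of ys] ys that xs by auto
    then show ?thesis using q_ge_2 power_le_imp_le_exp[of q "length xs" "card A"] by linarith
  qed
  have gen: "gen_set (set xs)" using span_eq_lspan[OF xs(3)] xs by auto
  \<comment> \<open>A repetition in \<open>xs\<close> would give a generating set with fewer than
    \<open>length xs\<close> elements.\<close>
  have "card (set xs) = length xs" using ge[OF _ xs(3) gen] card_length[of xs] by auto
  then have "dim = length xs"
    unfolding dim_def
  proof (intro Least_equality)
    show "\<exists>A. finite A \<and> card A = length xs \<and> A \<subseteq> carrier V \<and> gen_set A"
      using \<open>card (set xs) = length xs\<close> gen xs(3) by blast
  qed (use ge in blast)
  then show ?thesis using xs inj by auto
qed

lemma card_carrier: "card (carrier V) = q ^ dim"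
  using dim_eq_iff by blast

lemma separation:
  assumes H: "subspace K H V" and x: "x \<in> carrier V" "x \<notin> H"
  obtains f where "functional f" "f x = \<one>\<^bsub>K\<^esub>" "\<forall>h\<in>H. f h = \<zero>\<^bsub>K\<^esub>"
proof -
  txt \<open>A subspace maximal among those containing \<open>H\<close> but not \<open>x\<close> is a hyperplane complementary to \<open>x\<close>.\<close>
  define Z where "Z = {M. subspace K M V \<and> H \<subseteq> M \<and> x \<notin> M}"
  have "finite Z" unfolding Z_def by (rule finite_subset[OF _ finite_subspaces]) auto
  moreover have "H \<in> Z" using H x by (auto simp: Z_def)
  ultimately obtain M where M: "M \<in> Z" and max: "\<And>M'. M' \<in> Z \<Longrightarrow> M \<subseteq> M' \<Longrightarrow> M = M'"
    using finite_has_maximal[of Z] by auto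
  have S: "subspace K M V" and HM: "H \<subseteq> M" and xM: "x \<notin> M" using M by (auto simp: Z_def)
  note VM = subspaceD[OF S]
  have ex: "\<exists>c\<in>carrier K. \<exists>m\<in>M. v = c \<odot>\<^bsub>V\<^esub> x \<oplus>\<^bsub>V\<^esub> m" if v: "v \<in> carrier V" for v
  proof (cases "v \<in> M")
    case True
    then show ?thesis using v x by (intro bexI[of _ "\<zero>\<^bsub>K\<^esub>"] bexI[of _ v]) auto
  next
    case False
    \<comment> \<open>By maximality the line of \<open>v\<close> together with \<open>M\<close>
      reaches \<open>x\<close>, so \<open>x = d v + m\<close>. Here \<open>d\<close> is nonzero
      because \<open>x\<close> is not in \<open>M\<close>, and the equation is solved for
      \<open>v\<close>.\<close>
    let ?L = "(\<lambda>c. c \<odot>\<^bsub>V\<^esub> v) ` carrier K <+>\<^bsub>V\<^esub> M"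
    have SL: "subspace K ?L V" by (intro subspace_sum subspace_line S v)
    have "v \<in> (\<lambda>c. c \<odot>\<^bsub>V\<^esub> v) ` carrier K" using v by (intro image_eqI[of _ _ "\<one>\<^bsub>K\<^esub>"]) auto
    then have "v \<in> ?L" "M \<subseteq> ?L" using sum_upper[OF subspace_line[OF v] S] by auto
    then have "?L \<notin> Z" using max False by blast
    then have "x \<in> ?L" using SL HM \<open>M \<subseteq> ?L\<close> by (auto simp: Z_def)
    then obtain d m where dm: "d \<in> carrier K" "m \<in> M" "x = d \<odot>\<^bsub>V\<^esub> v \<oplus>\<^bsub>V\<^esub> m"
      by (auto simp: set_add_def')
    have mV: "m \<in> carrier V" using dm VM by auto
    have d0: "d \<noteq> \<zero>\<^bsub>K\<^esub>" using dm xM v mV by auto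
    have dU: "d \<in> Units K" using d0 dm by (simp add: field_Units)
    have "inv\<^bsub>K\<^esub> d \<odot>\<^bsub>V\<^esub> x = v \<oplus>\<^bsub>V\<^esub> inv\<^bsub>K\<^esub> d \<odot>\<^bsub>V\<^esub> m"
      unfolding dm(3) using dU dm v mV by (simp add: smult_r_distr smult_assoc1[symmetric])
    then have "v = inv\<^bsub>K\<^esub> d \<odot>\<^bsub>V\<^esub> x \<oplus>\<^bsub>V\<^esub> (\<ominus>\<^bsub>V\<^esub> (inv\<^bsub>K\<^esub> d \<odot>\<^bsub>V\<^esub> m))"
      using dU v mV by (simp add: M.a_assoc M.r_neg)
    moreover have "\<ominus>\<^bsub>V\<^esub> (inv\<^bsub>K\<^esub> d \<odot>\<^bsub>V\<^esub> m) \<in> M" using dU dm by (intro subspace_neg S VM) auto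
    ultimately show ?thesis using dU by blast
  qed
  define f where "f v = (THE c. c \<in> carrier K \<and> (\<exists>m\<in>M. v = c \<odot>\<^bsub>V\<^esub> x \<oplus>\<^bsub>V\<^esub> m))" for v
  have f: "f (c \<odot>\<^bsub>V\<^esub> x \<oplus>\<^bsub>V\<^esub> m) = c" if "c \<in> carrier K" "m \<in> M" for c m
    unfolding f_def using that line_coords_unique[OF S x(1) xM] by (intro the_equality) blast+
  have "functional f"
    unfolding functional_def
  proof (intro conjI ballI)
    fix v assume "v \<in> carrier V"
    then show "f v \<in> carrier K" using ex[of v] f by auto
  next
    fix v w assume "v \<in> carrier V" "w \<in> carrier V"
    then obtain c m d n where *: "c \<in> carrier K" "m \<in> M" "v = c \<odot>\<^bsub>V\<^esub> x \<oplus>\<^bsub>V\<^esub> m"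
      "d \<in> carrier K" "n \<in> M" "w = d \<odot>\<^bsub>V\<^esub> x \<oplus>\<^bsub>V\<^esub> n" using ex by meson
    have "v \<oplus>\<^bsub>V\<^esub> w = (c \<oplus>\<^bsub>K\<^esub> d) \<odot>\<^bsub>V\<^esub> x \<oplus>\<^bsub>V\<^esub> (m \<oplus>\<^bsub>V\<^esub> n)"
      using * x VM(2) by (simp add: smult_l_distr M.a_ac)
    then show "f (v \<oplus>\<^bsub>V\<^esub> w) = f v \<oplus>\<^bsub>K\<^esub> f w" using * f VM(4) by simp
  next
    fix a v assume a: "a \<in> carrier K" and "v \<in> carrier V"
    then obtain c m where *: "c \<in> carrier K" "m \<in> M" "v = c \<odot>\<^bsub>V\<^esub> x \<oplus>\<^bsub>V\<^esub> m" using ex by meson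
    have "a \<odot>\<^bsub>V\<^esub> v = (a \<otimes>\<^bsub>K\<^esub> c) \<odot>\<^bsub>V\<^esub> x \<oplus>\<^bsub>V\<^esub> (a \<odot>\<^bsub>V\<^esub> m)"
      using * x a VM(2) by (simp add: smult_r_distr smult_assoc1)
    then show "f (a \<odot>\<^bsub>V\<^esub> v) = a \<otimes>\<^bsub>K\<^esub> f v" using * a f VM(5) by simp
  qed
  moreover have "f x = \<one>\<^bsub>K\<^esub>" using f[of "\<one>\<^bsub>K\<^esub>" "\<zero>\<^bsub>V\<^esub>"] VM x by auto
  moreover have "f h = \<zero>\<^bsub>K\<^esub>" if "h \<in> H" for h using f[of "\<zero>\<^bsub>K\<^esub>" h] that HM VM x by auto
  ultimately show ?thesis using that by blast
qed

text \<open>Each new front vector has to avoid a span of known size. Truncated subtraction is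
  harmless: once the span fills \<open>H\<close>, the factor is 0 and the product stays 0.\<close>

lemma card_indep_lists:
  assumes H: "subspace K H V" and xs: "indep xs" "set xs \<subseteq> H"
  shows "card {zs. length zs = k \<and> set zs \<subseteq> H \<and> indep (zs @ xs)} = (\<Prod>i<k. card H - q ^ (length xs + i))"
proof (induction k)
  case 0
  have "{zs. length zs = 0 \<and> set zs \<subseteq> H \<and> indep (zs @ xs)} = {[]}" using xs by auto
  then show ?case by simp
next
  case (Suc k)
  let ?A = "\<lambda>k. {zs. length zs = k \<and> set zs \<subseteq> H \<and> indep (zs @ xs)}"
  have eq: "?A (Suc k) = (\<lambda>(zs, z). z # zs) ` (SIGMA zs:?A k. H - lspan (zs @ xs))"
  proof (intro equalityI subsetI)
    fix w assume "w \<in> ?A (Suc k)"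
    then obtain z zs where "w = z # zs" "length zs = k" "z \<in> H" "set zs \<subseteq> H" "indep (z # zs @ xs)"
      by (cases w) auto
    then show "w \<in> (\<lambda>(zs, z). z # zs) ` (SIGMA zs:?A k. H - lspan (zs @ xs))"
      by (intro image_eqI[of _ _ "(zs, z)"]) auto
  qed (use subspaceD[OF H] in auto)
  have fin: "finite (?A k)"
    by (rule finite_subset[OF _ finite_lists_length_eq[OF finite_subspace[OF H], of k]]) auto
  have c: "card (H - lspan (zs @ xs)) = card H - q ^ (length xs + k)" if "zs \<in> ?A k" for zs
  proof -
    have "lspan (zs @ xs) \<subseteq> H" using that xs by (intro lspan_least H) auto
    then show ?thesis
      using that card_lspan[of "zs @ xs"] finite_subspace[OF H]
      by (subst card_Diff_subset) (auto intro: finite_subset simp: add.commute)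
  qed
  have "card (?A (Suc k)) = card (SIGMA zs:?A k. H - lspan (zs @ xs))"
    unfolding eq by (intro card_image inj_onI) auto
  also have "\<dots> = (\<Sum>zs\<in>?A k. card (H - lspan (zs @ xs)))"
    using fin finite_subspace[OF H] by (intro card_SigmaI) auto
  also have "\<dots> = card (?A k) * (card H - q ^ (length xs + k))" using c by simp
  finally show ?case using Suc by simp
qed

text \<open>Double counting: the lists of \<open>k\<close> vectors that are independent over
  \<open>xs\<close> are sorted by their span \<open>U\<close>, and every \<open>U\<close> has the
  same number of ordered bases. For empty \<open>xs\<close> this computes Gaussian binomial
  coefficients.\<close>

lemma card_complementary_subspaces:
  assumes H: "subspace K H V" and xs: "indep xs" "set xs \<subseteq> H"
  shows "card {U. subspace K U V \<and> U \<subseteq> H \<and> card U = q ^ k \<and> U \<inter> lspan xs = {\<zero>\<^bsub>V\<^esub>}} * (\<Prod>i<k. q ^ k - q ^ i)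
    = (\<Prod>i<k. card H - q ^ (length xs + i))"
proof -
  let ?U = "{U. subspace K U V \<and> U \<subseteq> H \<and> card U = q ^ k \<and> U \<inter> lspan xs = {\<zero>\<^bsub>V\<^esub>}}"
  let ?A = "{zs. length zs = k \<and> set zs \<subseteq> H \<and> indep (zs @ xs)}"
  let ?B = "\<lambda>U. {zs. length zs = k \<and> set zs \<subseteq> U \<and> indep (zs @ [])}"
  have HV: "H \<subseteq> carrier V" and xV: "set xs \<subseteq> carrier V" using subspaceD[OF H] indep_carrier xs by auto
  have full: "lspan zs = U" if "zs \<in> ?B U" "U \<in> ?U" for U zs
  proof (rule card_subset_eq)
    show "finite U" using that finite_subspace by auto
    show "lspan zs \<subseteq> U" using that by (intro lspan_least) auto
    show "card (lspan zs) = card U" using that card_lspan by auto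
  qed
  have eq: "?A = (\<Union>U\<in>?U. ?B U)"
  proof (intro equalityI subsetI)
    fix zs assume zs: "zs \<in> ?A"
    have zV: "set zs \<subseteq> carrier V" using zs HV by auto
    have i: "indep zs \<and> lspan zs \<inter> lspan xs = {\<zero>\<^bsub>V\<^esub>}" using zs indep_append[OF zV xV] by auto
    have "lspan zs \<in> ?U" using i zs lspan_subspace[OF zV] lspan_least[OF H, of zs] card_lspan by auto
    moreover have "zs \<in> ?B (lspan zs)" using i zs lspan_superset[OF zV] by auto
    ultimately show "zs \<in> (\<Union>U\<in>?U. ?B U)" by blast
  next
    fix zs assume "zs \<in> (\<Union>U\<in>?U. ?B U)"
    then obtain U where U: "U \<in> ?U" "zs \<in> ?B U" by blast
    have zV: "set zs \<subseteq> carrier V" using U HV by auto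
    show "zs \<in> ?A" using U full[OF U(2,1)] indep_append[OF zV xV] xs by auto
  qed
  have cB: "card (?B U) = (\<Prod>i<k. q ^ k - q ^ i)" if "U \<in> ?U" for U
    using card_indep_lists[of U "[]" k] that by auto
  have "card ?A = (\<Sum>U\<in>?U. card (?B U))"
    unfolding eq
  proof (rule card_UN_disjoint)
    show "finite ?U" by (rule finite_subset[OF _ finite_subspaces]) auto
    show "\<forall>U\<in>?U. finite (?B U)"
    proof
      fix U assume "U \<in> ?U"
      then have "finite U" using finite_subspace by auto
      then show "finite (?B U)" 
        by (rule finite_subset[OF _ finite_lists_length_eq[of U k], rotated]) auto
    qed
    show "\<forall>U\<in>?U. \<forall>U'\<in>?U. U \<noteq> U' \<longrightarrow> ?B U \<inter> ?B U' = {}"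
    proof (intro ballI impI)
      fix U U' assume *: "U \<in> ?U" "U' \<in> ?U" "U \<noteq> U'"
      have False if zs: "zs \<in> ?B U" "zs \<in> ?B U'" for zs
      proof -
        have "lspan zs = U" by (rule full[OF zs(1) *(1)])
        moreover have "lspan zs = U'" by (rule full[OF zs(2) *(2)])
        ultimately show False using *(3) by simp
      qed
      then show "?B U \<inter> ?B U' = {}" by (intro equals0I) (elim IntE)
    qed
  qed
  then show ?thesis using card_indep_lists[OF H xs, of k] cB by simp
qed

end

section \<open>Alternating maps\<close>

context finite_vectorspace begin

definition wedge :: "('c \<Rightarrow> 'a) \<Rightarrow> ('c \<Rightarrow> 'a) \<Rightarrow> 'c \<Rightarrow> 'c \<Rightarrow> 'a" where
  "wedge f g x y = f x \<otimes>\<^bsub>K\<^esub> g y \<ominus>\<^bsub>K\<^esub> f y \<otimes>\<^bsub>K\<^esub> g x"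

lemma wedge_closed:
  assumes "functional f" "functional g" "x \<in> carrier V" "y \<in> carrier V"
  shows "wedge f g x y \<in> carrier K"
  using assms by (simp add: wedge_def functionalD)

lemma wedge_self:
  assumes "functional f" "functional g" "x \<in> carrier V"
  shows "wedge f g x x = \<zero>\<^bsub>K\<^esub>"
  using assms functionalD[OF assms(1)] functionalD[OF assms(2)]
  by (simp add: wedge_def R.minus_eq R.r_neg)

lemma wedge_add_right:
  assumes f: "functional f" and g: "functional g"
    and x: "x \<in> carrier V" and y: "y \<in> carrier V" "z \<in> carrier V"
  shows "wedge f g x (y \<oplus>\<^bsub>V\<^esub> z) = wedge f g x y \<oplus>\<^bsub>K\<^esub> wedge f g x z"
proof -
  note c = functionalD(1)[OF f] functionalD(1)[OF g]
  show ?thesis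
    unfolding wedge_def functionalD(2)[OF f y] functionalD(2)[OF g y]
    using c[OF x] c[OF y(1)] c[OF y(2)] by algebra
qed

lemma wedge_smult_right:
  assumes f: "functional f" and g: "functional g"
    and x: "x \<in> carrier V" and y: "y \<in> carrier V" and a: "a \<in> carrier K"
  shows "wedge f g x (a \<odot>\<^bsub>V\<^esub> y) = a \<otimes>\<^bsub>K\<^esub> wedge f g x y"
proof -
  note c = functionalD(1)[OF f] functionalD(1)[OF g]
  show ?thesis
    unfolding wedge_def functionalD(3)[OF f a y] functionalD(3)[OF g a y]
    using c[OF x] c[OF y] a by algebra
qed

lemma wedge_add_left:
  assumes f: "functional f" and g: "functional g"
    and x: "x \<in> carrier V" and y: "y \<in> carrier V" "z \<in> carrier V"
  shows "wedge f g (y \<oplus>\<^bsub>V\<^esub> z) x = wedge f g y x \<oplus>\<^bsub>K\<^esub> wedge f g z x"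
proof -
  note c = functionalD(1)[OF f] functionalD(1)[OF g]
  show ?thesis
    unfolding wedge_def functionalD(2)[OF f y] functionalD(2)[OF g y]
    using c[OF x] c[OF y(1)] c[OF y(2)] by algebra
qed

lemma wedge_smult_left:
  assumes f: "functional f" and g: "functional g"
    and x: "x \<in> carrier V" and y: "y \<in> carrier V" and a: "a \<in> carrier K"
  shows "wedge f g (a \<odot>\<^bsub>V\<^esub> y) x = a \<otimes>\<^bsub>K\<^esub> wedge f g y x"
proof -
  note c = functionalD(1)[OF f] functionalD(1)[OF g]
  show ?thesis
    unfolding wedge_def functionalD(3)[OF f a y] functionalD(3)[OF g a y]
    using c[OF x] c[OF y] a by algebra
qed

text \<open>
  A certificate that the vectors \<open>x \<and> y\<close>, for \<open>(x, y)\<close> in the list, are linearly independent in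
  the exterior square: a triangular system of decomposable forms. The exterior square itself is
  never formed.
\<close>

primrec windep :: "('c \<times> 'c) list \<Rightarrow> bool" where
  "windep [] = True"
| "windep (p # ps) = (windep ps \<and> fst p \<in> carrier V \<and> snd p \<in> carrier V \<and>
     (\<exists>f g. functional f \<and> functional g \<and> wedge f g (fst p) (snd p) = \<one>\<^bsub>K\<^esub> \<and>
        (\<forall>r\<in>set ps. wedge f g (fst r) (snd r) = \<zero>\<^bsub>K\<^esub>)))"

text \<open>The form for the pair \<open>(e, u)\<close> is \<open>f \<and> g\<close>, where
  \<open>f\<close> vanishes on \<open>S\<close> and is 1 at \<open>e\<close>, and \<open>g\<close>
  is 1 at \<open>u\<close> and vanishes on the remaining \<open>us\<close>. All old pairs and all of
  \<open>us\<close> lie in \<open>S\<close>, so \<open>f\<close> kills the old pairs, and the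
  uncontrolled value \<open>g e\<close> is always multiplied by 0.\<close>

lemma windep_extend:
  assumes ps: "windep ps" "set ps \<subseteq> S \<times> S" and S: "subspace K S V"
    and e: "e \<in> carrier V" "e \<notin> S"
  shows "indep us \<Longrightarrow> set us \<subseteq> S \<Longrightarrow> windep (map (Pair e) us @ ps)"
proof (induction us)
  case Nil then show ?case using ps by simp
next
  case (Cons u us)
  have us: "set us \<subseteq> carrier V" and u: "u \<in> carrier V" using Cons.prems indep_carrier by auto
  obtain f where f: "functional f" "f e = \<one>\<^bsub>K\<^esub>" "\<forall>h\<in>S. f h = \<zero>\<^bsub>K\<^esub>"
    by (rule separation[OF S e])
  obtain g where g: "functional g" "g u = \<one>\<^bsub>K\<^esub>" "\<forall>h\<in>lspan us. g h = \<zero>\<^bsub>K\<^esub>"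
    using separation[OF lspan_subspace[OF us], of u] Cons.prems by auto
  have ge: "g e \<in> carrier K" by (rule functionalD(1)[OF g(1) e(1)])
  have "wedge f g e u = \<one>\<^bsub>K\<^esub>"
    using f g ge Cons.prems by (simp add: wedge_def R.minus_eq)
  moreover have "wedge f g e u' = \<zero>\<^bsub>K\<^esub>" if "u' \<in> set us" for u'
  proof -
    have "g u' = \<zero>\<^bsub>K\<^esub>" using that lspan_superset[OF us] g by auto
    moreover have "f u' = \<zero>\<^bsub>K\<^esub>" using that Cons.prems f by auto
    ultimately show ?thesis using f ge by (simp add: wedge_def R.minus_eq)
  qed
  moreover have "wedge f g x y = \<zero>\<^bsub>K\<^esub>" if "(x, y) \<in> set ps" for x y
  proof -
    have "x \<in> S" "y \<in> S" using that ps by auto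
    moreover have "g x \<in> carrier K" "g y \<in> carrier K"
      using calculation subspaceD(2)[OF S] functionalD(1)[OF g(1)] by auto
    ultimately show ?thesis using f by (simp add: wedge_def R.minus_eq)
  qed
  moreover have "windep (map (Pair e) us @ ps)" using Cons by auto
  ultimately show ?case using e(1) u f(1) g(1) by fastforce
qed

primrec list_pairs :: "'c list \<Rightarrow> ('c \<times> 'c) list" where
  "list_pairs [] = []"
| "list_pairs (x # xs) = map (Pair x) xs @ list_pairs xs"

lemma set_list_pairs: "set (list_pairs xs) \<subseteq> set xs \<times> set xs"
  by (induction xs) auto

lemma length_list_pairs: "length (list_pairs xs) = length xs * (length xs - 1) div 2"
proof -
  have "2 * length (list_pairs xs) = length xs * (length xs - 1)"
    by (induction xs) (auto simp: algebra_simps diff_mult_distrib2 split: nat_diff_split)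
  then show ?thesis by simp
qed

lemma windep_list_pairs: "indep xs \<Longrightarrow> windep (list_pairs xs)"
proof (induction xs)
  case (Cons x xs)
  have xs: "set xs \<subseteq> carrier V" "indep xs" using Cons.prems indep_carrier by auto
  show ?case
    unfolding list_pairs.simps
  proof (rule windep_extend)
    show "set (list_pairs xs) \<subseteq> lspan xs \<times> lspan xs"
      using set_list_pairs lspan_superset[OF xs(1)] by fast
  qed (use Cons xs lspan_subspace lspan_superset in auto)
qed simp

end

section \<open>Independence and uniformity of the values of a random alternating map\<close>

locale alternating_setting = V: finite_vectorspace K V + W: finite_vectorspace K W
  for K :: "('a, 'e) ring_scheme" and V :: "('a, 'b, 'f) module_scheme"
    and W :: "('a, 'c, 'g) module_scheme"
begin

abbreviation "A \<equiv> alternating_maps K V W"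

lemma altD:
  assumes "B \<in> A"
  shows "x \<in> carrier V \<Longrightarrow> y \<in> carrier V \<Longrightarrow> B x y \<in> carrier W"
    "x \<in> carrier V \<Longrightarrow> y \<in> carrier V \<Longrightarrow> z \<in> carrier V \<Longrightarrow> B x (y \<oplus>\<^bsub>V\<^esub> z) = B x y \<oplus>\<^bsub>W\<^esub> B x z"
    "x \<in> carrier V \<Longrightarrow> y \<in> carrier V \<Longrightarrow> z \<in> carrier V \<Longrightarrow> B (y \<oplus>\<^bsub>V\<^esub> z) x = B y x \<oplus>\<^bsub>W\<^esub> B z x"
    "x \<in> carrier V \<Longrightarrow> y \<in> carrier V \<Longrightarrow> a \<in> carrier K \<Longrightarrow> B x (a \<odot>\<^bsub>V\<^esub> y) = a \<odot>\<^bsub>W\<^esub> B x y"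
    "x \<in> carrier V \<Longrightarrow> y \<in> carrier V \<Longrightarrow> a \<in> carrier K \<Longrightarrow> B (a \<odot>\<^bsub>V\<^esub> y) x = a \<odot>\<^bsub>W\<^esub> B y x"
    "x \<in> carrier V \<Longrightarrow> B x x = \<zero>\<^bsub>W\<^esub>"
  using assms by (auto simp: alternating_maps_def bilinear_maps_def module_hom_def PiE_iff)

lemma alt_zero:
  assumes "B \<in> A" "x \<in> carrier V"
  shows "B x \<zero>\<^bsub>V\<^esub> = \<zero>\<^bsub>W\<^esub>" "B \<zero>\<^bsub>V\<^esub> x = \<zero>\<^bsub>W\<^esub>"
  using altD(4,5)[OF assms(1), of x "\<zero>\<^bsub>V\<^esub>" "\<zero>\<^bsub>K\<^esub>"] altD(1)[OF assms(1)] assms(2) by auto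

lemma alt_swap:
  assumes B: "B \<in> A" and x: "x \<in> carrier V" and y: "y \<in> carrier V"
  shows "B y x = \<ominus>\<^bsub>W\<^esub> B x y"
proof -
  have "\<zero>\<^bsub>W\<^esub> = B (x \<oplus>\<^bsub>V\<^esub> y) (x \<oplus>\<^bsub>V\<^esub> y)" using altD(6)[OF B] x y by simp
  also have "\<dots> = (B x x \<oplus>\<^bsub>W\<^esub> B y x) \<oplus>\<^bsub>W\<^esub> (B x y \<oplus>\<^bsub>W\<^esub> B y y)"
    using x y by (simp add: altD(2,3)[OF B])
  also have "\<dots> = B x y \<oplus>\<^bsub>W\<^esub> B y x"
    using x y altD(1)[OF B x y] altD(1)[OF B y x] by (simp add: altD(6)[OF B] W.M.a_comm)
  finally show ?thesis using altD(1)[OF B x y] altD(1)[OF B y x] W.M.minus_equality W.M.a_comm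
    by metis
qed

lemma finite_A: "finite A"
proof (rule finite_subset)
  show "A \<subseteq> carrier V \<rightarrow>\<^sub>E (carrier V \<rightarrow>\<^sub>E carrier W)"
    by (auto simp: alternating_maps_def bilinear_maps_def)
  show "finite (carrier V \<rightarrow>\<^sub>E (carrier V \<rightarrow>\<^sub>E carrier W))"
    by (intro finite_PiE V.finite_V W.finite_V)
qed

lemma A_nonempty: "A \<noteq> {}"
proof -
  have "(\<lambda>x\<in>carrier V. \<lambda>y\<in>carrier V. \<zero>\<^bsub>W\<^esub>) \<in> A"
    by (auto simp: alternating_maps_def bilinear_maps_def module_hom_def)
  then show ?thesis by auto
qed

text \<open>Translation of the space of alternating maps by a decomposable one. The restrictions to
  the carrier keep the result extensional, as \<open>bilinear_maps\<close> demands.\<close>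

definition shift :: "('b \<Rightarrow> 'a) \<Rightarrow> ('b \<Rightarrow> 'a) \<Rightarrow> 'c \<Rightarrow> ('b \<Rightarrow> 'b \<Rightarrow> 'c) \<Rightarrow> 'b \<Rightarrow> 'b \<Rightarrow> 'c" where
  "shift f g w B = (\<lambda>x\<in>carrier V. \<lambda>y\<in>carrier V. B x y \<oplus>\<^bsub>W\<^esub> V.wedge f g x y \<odot>\<^bsub>W\<^esub> w)"

lemma shift_alt:
  assumes fg: "V.functional f" "V.functional g" and w: "w \<in> carrier W" and B: "B \<in> A"
  shows "shift f g w B \<in> A"
proof -
  note c = V.wedge_closed[OF fg] altD(1)[OF B]
  \<comment> \<open>The interchange of the two middle summands, needed for additivity in either
    argument.\<close>
  have h: "(a \<oplus>\<^bsub>W\<^esub> b) \<oplus>\<^bsub>W\<^esub> (c' \<oplus>\<^bsub>W\<^esub> d) = (a \<oplus>\<^bsub>W\<^esub> c') \<oplus>\<^bsub>W\<^esub> (b \<oplus>\<^bsub>W\<^esub> d)"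
    if "a \<in> carrier W" "b \<in> carrier W" "c' \<in> carrier W" "d \<in> carrier W" for a b c' d
    using that by (simp add: W.M.a_ac)
  let ?S = "shift f g w B"
  have ap: "?S x y = B x y \<oplus>\<^bsub>W\<^esub> V.wedge f g x y \<odot>\<^bsub>W\<^esub> w" if "x \<in> carrier V" "y \<in> carrier V" for x y
    using that by (simp add: shift_def)
  have mem: "?S \<in> carrier V \<rightarrow>\<^sub>E (carrier V \<rightarrow>\<^sub>E carrier W)"
    unfolding shift_def using w c by auto
  have "(\<lambda>y. ?S x y) \<in> module_hom K V W" if x: "x \<in> carrier V" for x
    unfolding module_hom_def
  proof (intro CollectI conjI allI impI funcsetI; (elim conjE)?)
    fix y z assume yz: "y \<in> carrier V" "z \<in> carrier V"
    show "?S x (y \<oplus>\<^bsub>V\<^esub> z) = ?S x y \<oplus>\<^bsub>W\<^esub> ?S x z"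
      using w c x yz by (simp add: ap altD(2)[OF B] V.wedge_add_right[OF fg] W.smult_l_distr h)
  next
    fix a y assume ay: "a \<in> carrier K" "y \<in> carrier V"
    show "?S x (a \<odot>\<^bsub>V\<^esub> y) = a \<odot>\<^bsub>W\<^esub> ?S x y"
      using w c x ay by (simp add: ap altD(4)[OF B] V.wedge_smult_right[OF fg] W.smult_r_distr W.smult_assoc1)
  qed (use w c x ap in auto)
  moreover have "(\<lambda>y. ?S y x) \<in> module_hom K V W" if x: "x \<in> carrier V" for x
    unfolding module_hom_def
  proof (intro CollectI conjI allI impI funcsetI; (elim conjE)?)
    fix y z assume yz: "y \<in> carrier V" "z \<in> carrier V"
    show "?S (y \<oplus>\<^bsub>V\<^esub> z) x = ?S y x \<oplus>\<^bsub>W\<^esub> ?S z x"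
      using w c x yz by (simp add: ap altD(3)[OF B] V.wedge_add_left[OF fg] W.smult_l_distr h)
  next
    fix a y assume ay: "a \<in> carrier K" "y \<in> carrier V"
    show "?S (a \<odot>\<^bsub>V\<^esub> y) x = a \<odot>\<^bsub>W\<^esub> ?S y x"
      using w c x ay by (simp add: ap altD(5)[OF B] V.wedge_smult_left[OF fg] W.smult_r_distr W.smult_assoc1)
  qed (use w c x ap in auto)
  moreover have "?S x x = \<zero>\<^bsub>W\<^esub>" if "x \<in> carrier V" for x
    using that w by (simp add: ap altD(6)[OF B] V.wedge_self[OF fg])
  ultimately show ?thesis
    unfolding alternating_maps_def bilinear_maps_def using mem by simp
qed

lemma shift_apply:
  "x \<in> carrier V \<Longrightarrow> y \<in> carrier V \<Longrightarrow> shift f g w B x y = B x y \<oplus>\<^bsub>W\<^esub> V.wedge f g x y \<odot>\<^bsub>W\<^esub> w"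
  by (simp add: shift_def)

lemma inj_shift:
  assumes fg: "V.functional f" "V.functional g" and w: "w \<in> carrier W"
  shows "inj_on (shift f g w) A"
proof (rule inj_onI)
  fix B C assume B: "B \<in> A" and C: "C \<in> A" and eq: "shift f g w B = shift f g w C"
  have "B x y = C x y" if "x \<in> carrier V" "y \<in> carrier V" for x y
  proof -
    have "B x y \<oplus>\<^bsub>W\<^esub> V.wedge f g x y \<odot>\<^bsub>W\<^esub> w = C x y \<oplus>\<^bsub>W\<^esub> V.wedge f g x y \<odot>\<^bsub>W\<^esub> w"
      using eq shift_apply[OF that] by metis
    then show ?thesis
      using that w altD(1)[OF B] altD(1)[OF C] V.wedge_closed[OF fg] by simp
  qed
  note eqBC = this
  have m: "B \<in> carrier V \<rightarrow>\<^sub>E (carrier V \<rightarrow>\<^sub>E carrier W)" "C \<in> carrier V \<rightarrow>\<^sub>E (carrier V \<rightarrow>\<^sub>E carrier W)"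
    using B C by (auto simp: alternating_maps_def bilinear_maps_def)
  show "B = C"
  proof (rule PiE_ext[OF m])
    fix x assume x: "x \<in> carrier V"
    show "B x = C x"
      by (rule PiE_ext[OF PiE_mem[OF m(1) x] PiE_mem[OF m(2) x]]) (rule eqBC[OF x])
  qed
qed

text \<open>
  Adding a multiple of the form attached to the first pair moves the value there arbitrarily and
  leaves the values at the other pairs alone, so the values are independent and uniform.
\<close>

lemma card_windep:
  assumes "V.windep ps" "W' \<subseteq> carrier W"
  shows "card {B \<in> A. \<forall>(x, y)\<in>set ps. B x y \<in> W'} * card (carrier W) ^ length ps
    = card A * card W' ^ length ps"
  using assms(1)
proof (induction ps)
  case Nil
  show ?case by simp
next
  case (Cons p ps)
  let ?P = "{B \<in> A. \<forall>(x, y)\<in>set ps. B x y \<in> W'}"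
  obtain a b where p: "p = (a, b)" by (cases p)
  from Cons.prems p obtain f g where fg: "V.functional f" "V.functional g"
    and ab: "a \<in> carrier V" "b \<in> carrier V" "V.wedge f g a b = \<one>\<^bsub>K\<^esub>"
    and z: "\<And>x y. (x, y) \<in> set ps \<Longrightarrow> V.wedge f g x y = \<zero>\<^bsub>K\<^esub>" by fastforce
  have psV: "x \<in> carrier V \<and> y \<in> carrier V" if "(x, y) \<in> set ps" for x y
    using Cons.prems that by (induction ps) auto
  \<comment> \<open>The fibres of the value at the first pair. Shifting by \<open>w' - w\<close>
    embeds \<open>N w\<close> into \<open>N w'\<close>, so all fibres have the same size.\<close>
  define N where "N w = {B \<in> ?P. B a b = w}" for w
  have fin: "finite (N w)" for w unfolding N_def using finite_A by auto
  have le: "card (N w) \<le> card (N w')" if w: "w \<in> carrier W" "w' \<in> carrier W" for w w'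
  proof (rule card_inj_on_le)
    let ?d = "w' \<oplus>\<^bsub>W\<^esub> (\<ominus>\<^bsub>W\<^esub> w)"
    have d: "?d \<in> carrier W" using w by simp
    show "inj_on (shift f g ?d) (N w)"
      by (rule inj_on_subset[OF inj_shift[OF fg d]]) (auto simp: N_def)
    have "w \<oplus>\<^bsub>W\<^esub> ?d = w'" using w W.M.r_neg2 by (metis W.M.a_comm W.M.a_inv_closed W.M.r_neg1 d)
    note wd = this
    show "shift f g ?d ` N w \<subseteq> N w'"
    proof (intro image_subsetI)
      fix B assume "B \<in> N w"
      then have B: "B \<in> A" "\<And>x y. (x, y) \<in> set ps \<Longrightarrow> B x y \<in> W'" "B a b = w"
        by (auto simp: N_def)
      have "shift f g ?d B x y = B x y" if xy: "(x, y) \<in> set ps" for x y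
        using psV[OF xy] z[OF xy] d altD(1)[OF B(1), of x y] by (simp add: shift_apply)
      moreover have "shift f g ?d B a b = w'" using ab B(3) d wd by (simp add: shift_apply)
      ultimately show "shift f g ?d B \<in> N w'"
        using shift_alt[OF fg d B(1)] B(2) by (auto simp: N_def)
    qed
    show "finite (N w')" by (rule fin)
  qed
  have Nw: "card (N w) = card (N \<zero>\<^bsub>W\<^esub>)" if "w \<in> carrier W" for w
    using le[OF that W.M.zero_closed] le[OF W.M.zero_closed that] by simp
  have U: "card (\<Union>w\<in>X. N w) = card X * card (N \<zero>\<^bsub>W\<^esub>)" if X: "X \<subseteq> carrier W" for X
  proof -
    have "card (\<Union>w\<in>X. N w) = (\<Sum>w\<in>X. card (N w))"
      using X W.finite_V finite_subset fin by (intro card_UN_disjoint) (auto simp: N_def)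
    also have "\<dots> = (\<Sum>w\<in>X. card (N \<zero>\<^bsub>W\<^esub>))" by (rule sum.cong[OF refl Nw]) (use X in blast)
    finally show ?thesis by simp
  qed
  have "?P = (\<Union>w\<in>carrier W. N w)" using ab altD(1) by (auto simp: N_def)
  then have P: "card ?P = card (carrier W) * card (N \<zero>\<^bsub>W\<^esub>)" using U by simp
  have "{B \<in> A. \<forall>(x, y)\<in>set (p # ps). B x y \<in> W'} = (\<Union>w\<in>W'. N w)"
    by (auto simp: N_def p)
  then have "card {B \<in> A. \<forall>(x, y)\<in>set (p # ps). B x y \<in> W'} = card W' * card (N \<zero>\<^bsub>W\<^esub>)"
    using U assms by simp
  then have "card {B \<in> A. \<forall>(x, y)\<in>set (p # ps). B x y \<in> W'} * card (carrier W) ^ length (p # ps)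
      = card W' * (card ?P * card (carrier W) ^ length ps)" using P by simp
  also have "\<dots> = card A * card W' ^ length (p # ps)" using Cons by simp
  finally show ?case .
qed

lemma alt_lspan_right:
  assumes B: "B \<in> A" and W': "subspace K W' W" and x: "x \<in> carrier V"
    and xs: "set xs \<subseteq> carrier V" "\<And>y. y \<in> set xs \<Longrightarrow> B x y \<in> W'"
  shows "v \<in> V.lspan xs \<Longrightarrow> B x v \<in> W'"
  using xs
proof (induction xs arbitrary: v)
  case Nil
  then show ?case using alt_zero[OF B x] W.subspaceD(3)[OF W'] by simp
next
  case (Cons y ys)
  obtain c u where cu: "c \<in> carrier K" "u \<in> V.lspan ys" "v = c \<odot>\<^bsub>V\<^esub> y \<oplus>\<^bsub>V\<^esub> u"
    using V.lspan_ConsE[OF Cons.prems(1)] by blast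
  have uV: "u \<in> carrier V" and yV: "y \<in> carrier V"
    using cu V.subspaceD(2)[OF V.lspan_subspace[of ys]] Cons.prems by auto
  have "B x u \<in> W'" using Cons cu by auto
  moreover have "c \<odot>\<^bsub>W\<^esub> B x y \<in> W'" using Cons.prems cu(1) by (intro W.subspaceD(5)[OF W']) auto
  ultimately show ?case using cu x uV yV by (simp add: altD[OF B] W.subspaceD(4)[OF W'])
qed

text \<open>\<open>list_pairs\<close> holds each pair in one order only and has no diagonal;
  antisymmetry and \<open>B x x = 0\<close> supply the rest.\<close>

lemma alt_lspan_pairs:
  assumes B: "B \<in> A" and W': "subspace K W' W"
  shows "set xs \<subseteq> carrier V \<Longrightarrow> (\<And>x y. (x, y) \<in> set (V.list_pairs xs) \<Longrightarrow> B x y \<in> W') \<Longrightarrow>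
    u \<in> V.lspan xs \<Longrightarrow> v \<in> V.lspan xs \<Longrightarrow> B u v \<in> W'"
proof (induction xs arbitrary: u v)
  case Nil
  then show ?case using alt_zero[OF B] W.subspaceD(3)[OF W'] by simp
next
  case (Cons x xs)
  have x: "x \<in> carrier V" and xs: "set xs \<subseteq> carrier V" using Cons.prems by auto
  obtain c s where cs: "c \<in> carrier K" "s \<in> V.lspan xs" "u = c \<odot>\<^bsub>V\<^esub> x \<oplus>\<^bsub>V\<^esub> s"
    using V.lspan_ConsE[OF Cons.prems(3)] by blast
  obtain d t where dt: "d \<in> carrier K" "t \<in> V.lspan xs" "v = d \<odot>\<^bsub>V\<^esub> x \<oplus>\<^bsub>V\<^esub> t"
    using V.lspan_ConsE[OF Cons.prems(4)] by blast
  have st: "s \<in> carrier V" "t \<in> carrier V"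
    using cs dt V.subspaceD(2)[OF V.lspan_subspace[OF xs]] by auto
  have right: "B x r \<in> W'" if "r \<in> V.lspan xs" for r
    using alt_lspan_right[OF B W' x xs _ that] Cons.prems(2) by auto
  have "B s x \<in> W'"
    using alt_swap[OF B x st(1)] right[OF cs(2)] W.subspace_neg[OF W'] by simp
  moreover have "B s t \<in> W'" using Cons.IH[OF xs _ cs(2) dt(2)] Cons.prems(2) by auto
  moreover have "B x t \<in> W'" by (rule right[OF dt(2)])
  \<comment> \<open>The expansion has no term in \<open>B x x\<close>, since that value is
    zero.\<close>
  moreover have "B u v = c \<odot>\<^bsub>W\<^esub> B x t \<oplus>\<^bsub>W\<^esub> (d \<odot>\<^bsub>W\<^esub> B s x \<oplus>\<^bsub>W\<^esub> B s t)"
    using x st cs(1,3) dt(1,3) altD(1)[OF B] by (simp add: altD[OF B] W.M.a_lcomm)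
  ultimately show ?case using cs(1) dt(1) by (simp add: W.subspaceD(4,5)[OF W'])
qed

lemma image_span_subspace:
  assumes "B \<in> A" "U \<subseteq> carrier V"
  shows "subspace K (image_span K W B U) W"
  unfolding image_span_def using assms altD(1)[OF assms(1)]
  by (intro W.span_is_subspace) auto

lemma image_span_subset_iff:
  assumes B: "B \<in> A" and U: "U \<subseteq> carrier V" and W': "subspace K W' W"
  shows "image_span K W B U \<subseteq> W' \<longleftrightarrow> (\<forall>x\<in>U. \<forall>y\<in>U. B x y \<in> W')"
proof -
  have sub: "{B x y |x y. x \<in> U \<and> y \<in> U} \<subseteq> carrier W" using altD(1)[OF B] U by auto
  show ?thesis
  proof
    assume "image_span K W B U \<subseteq> W'"
    then show "\<forall>x\<in>U. \<forall>y\<in>U. B x y \<in> W'"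
      using W.in_own_span[OF sub] unfolding image_span_def by blast
  next
    assume "\<forall>x\<in>U. \<forall>y\<in>U. B x y \<in> W'"
    then show "image_span K W B U \<subseteq> W'"
      unfolding image_span_def using W' by (intro W.span_is_subset) (auto simp: subspace_def)
  qed
qed

lemma totally_isotropic_iff:
  assumes B: "B \<in> A" and U: "U \<subseteq> carrier V"
  shows "totally_isotropic K W B U \<longleftrightarrow> (\<forall>x\<in>U. \<forall>y\<in>U. B x y = \<zero>\<^bsub>W\<^esub>)"
  using image_span_subset_iff[OF B U W.subspace_zero] W.subspaceD(3)[OF image_span_subspace[OF B U]]
  unfolding totally_isotropic_def by auto

end

section \<open>Tuples of three-dimensional subspaces\<close>

context finite_vectorspace begin

primrec ssum :: "'c set list \<Rightarrow> 'c set" where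
  "ssum [] = {\<zero>\<^bsub>V\<^esub>}"
| "ssum (U # Us) = U <+>\<^bsub>V\<^esub> ssum Us"

primrec indep_sum :: "'c set list \<Rightarrow> bool" where
  "indep_sum [] = True"
| "indep_sum (U # Us) = (U \<inter> ssum Us = {\<zero>\<^bsub>V\<^esub>} \<and> indep_sum Us)"

definition sub3 :: "'c set set" where
  "sub3 = {U. subspace K U V \<and> card U = q ^ 3}"

lemma sub3D: "U \<in> sub3 \<Longrightarrow> subspace K U V" "U \<in> sub3 \<Longrightarrow> card U = q ^ 3"
  by (simp_all add: sub3_def)

lemma ssum_subspace: "set Us \<subseteq> sub3 \<Longrightarrow> subspace K (ssum Us) V"
  by (induction Us) (auto intro: subspace_zero subspace_sum dest: sub3D)

lemma ssum_upper: "set Us \<subseteq> sub3 \<Longrightarrow> U \<in> set Us \<Longrightarrow> U \<subseteq> ssum Us"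
proof (induction Us)
  case (Cons X Us)
  have "X \<subseteq> ssum (X # Us)" "ssum Us \<subseteq> ssum (X # Us)"
    using sum_upper[of X "ssum Us"] ssum_subspace[of Us] Cons.prems sub3D(1) by auto
  then show ?case using Cons by auto
qed simp

lemma pairs_in_ssum:
  assumes "set Us \<subseteq> sub3" "set ps \<subseteq> (\<Union>X\<in>set Us. X \<times> X)"
  shows "set ps \<subseteq> ssum Us \<times> ssum Us"
  using assms ssum_upper[OF assms(1)] by blast

lemma q_power_inject: "q ^ a = q ^ b \<longleftrightarrow> a = b"
  using q_ge_2 power_inject_exp[of q a b] by auto

text \<open>For a basis \<open>es @ us\<close> of \<open>U\<close>, with \<open>us\<close> a basis
  of the part of \<open>U\<close> inside an earlier space \<open>S\<close>, these are the basis
  pairs that involve some entry of \<open>es\<close>. Pairs inside \<open>us\<close> are left out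
  because they may depend on conditions already imposed on \<open>S\<close>.\<close>

primrec cross_pairs :: "'c list \<Rightarrow> 'c list \<Rightarrow> ('c \<times> 'c) list" where
  "cross_pairs [] us = []"
| "cross_pairs (e # es) us = map (Pair e) (es @ us) @ cross_pairs es us"

lemma set_cross_pairs: "set (cross_pairs es us) \<subseteq> set (es @ us) \<times> set (es @ us)"
  by (induction es) auto

lemma cross_pairs_Nil: "cross_pairs es [] = list_pairs es"
  by (induction es) auto

lemma length_cross_pairs:
  "2 * length (cross_pairs es us) + length es = length es * (length es + 2 * length us)"
  by (induction es) (auto simp: algebra_simps)

text \<open>Two independent lists play different roles: \<open>es @ ss\<close> guarantees that each
  new \<open>e\<close> lies outside the space that carries the earlier pairs, while
  \<open>es @ us\<close> guarantees that the partners of \<open>e\<close> are independent. Each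
  entry of \<open>es\<close> is one use of \<open>windep_extend\<close>.\<close>

lemma windep_cross_pairs:
  assumes ps: "windep ps" "set ps \<subseteq> lspan ss \<times> lspan ss"
    and us: "indep us" "set us \<subseteq> lspan ss"
  shows "indep (es @ ss) \<Longrightarrow> indep (es @ us) \<Longrightarrow> windep (cross_pairs es us @ ps)"
proof (induction es)
  case Nil
  then show ?case using ps by simp
next
  case (Cons e es)
  have V: "set es \<subseteq> carrier V" "set ss \<subseteq> carrier V" "e \<in> carrier V"
    using indep_carrier[OF Cons.prems(1)] by auto
  have S: "subspace K (lspan (es @ ss)) V" using V by (intro lspan_subspace) auto
  have up: "lspan ss \<subseteq> lspan (es @ ss)" "set es \<subseteq> lspan (es @ ss)"
    using lspan_append[OF V(1,2)] sum_upper lspan_subspace V lspan_superset[of "es @ ss"] by auto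
  have "windep (map (Pair e) (es @ us) @ (cross_pairs es us @ ps))"
  proof (rule windep_extend[OF _ _ S])
    have "set (es @ us) \<subseteq> lspan (es @ ss)" using us(2) up by auto
    then show "set (cross_pairs es us @ ps) \<subseteq> lspan (es @ ss) \<times> lspan (es @ ss)"
      using set_cross_pairs[of es us] ps(2) up(1) unfolding set_append by blast
  qed (use Cons us(2) up V in auto)
  then show ?case by simp
qed

text \<open>Here \<open>j\<close> is the dimension of \<open>U\<close> modulo \<open>S\<close>. For
  \<open>j = 1\<close> and \<open>j = 2\<close> the number of new conditions exceeds
  \<open>j\<close>, which is the gain exploited for overlapping tuples; for \<open>j = 3\<close> the
  new pairs determine isotropy of \<open>U\<close> completely.\<close>

lemma extend_by_subspace:
  assumes ps: "windep ps" "set ps \<subseteq> S \<times> S" and S: "subspace K S V" and U: "U \<in> sub3"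
  obtains j rs where "j \<le> 3" "card (U \<inter> S) = q ^ (3 - j)" "card (U <+>\<^bsub>V\<^esub> S) = q ^ j * card S"
    "set rs \<subseteq> U \<times> U" "windep (rs @ ps)"
    "length rs \<ge> (if j = 0 then 0 else if j = 3 then 3 else j + 1)"
    "j = 3 \<Longrightarrow> length rs = 3 \<and> (\<exists>xs. lspan xs = U \<and> set xs \<subseteq> U \<and> rs = list_pairs xs)"
proof -
  note SU = sub3D(1)[OF U]
  obtain ss where ss: "indep ss" "lspan ss = S" "card S = q ^ length ss" using subspace_basis[OF S] by metis
  obtain us where us: "indep us" "lspan us = U \<inter> S" "set us \<subseteq> U \<inter> S" "card (U \<inter> S) = q ^ length us"
    using subspace_basis[OF subspace_inter[OF SU S]] by metis
  obtain es where es: "set es \<subseteq> U" "indep (es @ us)" "lspan (es @ us) = U"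
    using indep_extend[OF SU us(1)] us(3) by auto
  have "q ^ 3 = q ^ length (es @ us)" using card_lspan[OF es(2)] es(3) sub3D(2)[OF U] by simp
  then have len: "length es + length us = 3" using q_power_inject by simp
  have V: "set es \<subseteq> carrier V" "set us \<subseteq> carrier V" "set ss \<subseteq> carrier V"
    using indep_carrier[OF es(2)] indep_carrier[OF ss(1)] by auto
  have e: "indep es" "lspan es \<inter> lspan us = {\<zero>\<^bsub>V\<^esub>}" using es(2) indep_append[OF V(1,2)] by auto
  have sub: "lspan es \<subseteq> U" using lspan_least[OF SU es(1)] .
  \<comment> \<open>The span of \<open>es\<close> lies in \<open>U\<close>, so it can meet
    \<open>S\<close> only inside the span of \<open>us\<close>, from which it is
    independent.\<close>
  have "lspan es \<inter> lspan ss = lspan es \<inter> lspan us" using sub us(2) ss(2) by auto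
  then have ies: "indep (es @ ss)" using indep_append[OF V(1,3)] e ss(1) by auto
  have US: "U <+>\<^bsub>V\<^esub> S = lspan (es @ ss)"
  proof
    have "U \<subseteq> lspan (es @ ss)"
      unfolding es(3)[symmetric]
    proof (rule lspan_least)
      show "subspace K (lspan (es @ ss)) V" using V by (intro lspan_subspace) auto
      have "S \<subseteq> lspan (es @ ss)"
        using lspan_append[OF V(1,3)] sum_upper(2) lspan_subspace V ss(2) by auto
      then show "set (es @ us) \<subseteq> lspan (es @ ss)" using us(3) lspan_superset[of "es @ ss"] V by auto
    qed
    moreover have "S \<subseteq> lspan (es @ ss)"
      using lspan_append[OF V(1,3)] sum_upper(2) lspan_subspace V ss(2) by auto
    ultimately show "U <+>\<^bsub>V\<^esub> S \<subseteq> lspan (es @ ss)" 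
      using V by (intro sum_least lspan_subspace) auto
    show "lspan (es @ ss) \<subseteq> U <+>\<^bsub>V\<^esub> S"
      unfolding lspan_append[OF V(1,3)] ss(2) using sub by (auto simp: set_add_def')
  qed
  show ?thesis
  proof (rule that[of "length es" "cross_pairs es us"])
    show "length es \<le> 3" using len by simp
    show "card (U \<inter> S) = q ^ (3 - length es)" using us(4) len by (metis add_diff_cancel_left')
    show "card (U <+>\<^bsub>V\<^esub> S) = q ^ length es * card S"
      using card_lspan[OF ies] US ss by (simp add: power_add)
    show "set (cross_pairs es us) \<subseteq> U \<times> U"
      using set_cross_pairs[of es us] es(1) us(3) unfolding set_append by blast
    show "windep (cross_pairs es us @ ps)"
      using windep_cross_pairs[OF _ _ us(1) _ ies es(2)] ps us(3) ss(2) by auto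
    have us3: "length us = 3 - length es" using len by simp
    \<comment> \<open>With \<open>us\<close> of length \<open>3 - j\<close> the number
      \<open>L\<close> of pairs satisfies \<open>2 * L + j = j * (6 - j)\<close>, so
      \<open>L\<close> is 0, 2, 3, 3 for \<open>j\<close> equal to 0, 1, 2, 3.\<close>
    have "length es = 0 \<or> length es = 1 \<or> length es = 2 \<or> length es = 3" using len by presburger
    then show "length (cross_pairs es us) \<ge> (if length es = 0 then 0 else if length es = 3 then 3 else length es + 1)"
      using length_cross_pairs[of es us] unfolding us3 by auto
    assume 3: "length es = 3"
    then have "us = []" using len by simp
    then show "length (cross_pairs es us) = 3 \<and>
        (\<exists>xs. lspan xs = U \<and> set xs \<subseteq> U \<and> cross_pairs es us = list_pairs xs)"
      using es(1,3) cross_pairs_Nil[of es] length_cross_pairs[of es us] 3 by auto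
  qed
qed

lemma card_zero_subspace_iff: "subspace K H V \<Longrightarrow> card H = 1 \<longleftrightarrow> H = {\<zero>\<^bsub>V\<^esub>}"
  using subspaceD(3) by (auto simp: card_1_singleton_iff)

text \<open>In a direct sum every use of \<open>extend_by_subspace\<close> has \<open>j = 3\<close>.
  The last clause records that the pairs generate all conditions on each summand, which later makes
  the probability exact and not only bounded.\<close>

lemma indep_sum_windep:
  "indep_sum Us \<Longrightarrow> set Us \<subseteq> sub3 \<Longrightarrow> card (ssum Us) = q ^ (3 * length Us) \<and>
    (\<exists>ps. windep ps \<and> length ps = 3 * length Us \<and> set ps \<subseteq> (\<Union>X\<in>set Us. X \<times> X) \<and>
      (\<forall>X\<in>set Us. \<exists>xs. lspan xs = X \<and> set xs \<subseteq> X \<and> set (list_pairs xs) \<subseteq> set ps))"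
proof (induction Us)
  case Nil
  show ?case by (auto intro!: exI[of _ "[]"])
next
  case (Cons U Us)
  then obtain ps where ps: "windep ps" "length ps = 3 * length Us" "set ps \<subseteq> (\<Union>X\<in>set Us. X \<times> X)"
    "\<forall>X\<in>set Us. \<exists>xs. lspan xs = X \<and> set xs \<subseteq> X \<and> set (list_pairs xs) \<subseteq> set ps" by auto
  have c: "card (ssum Us) = q ^ (3 * length Us)" and sU: "set Us \<subseteq> sub3" "U \<in> sub3" using Cons by auto
  obtain j rs where j: "j \<le> 3" "card (U \<inter> ssum Us) = q ^ (3 - j)"
    "card (U <+>\<^bsub>V\<^esub> ssum Us) = q ^ j * card (ssum Us)"
    "set rs \<subseteq> U \<times> U" "windep (rs @ ps)"
    "j = 3 \<Longrightarrow> length rs = 3 \<and> (\<exists>xs. lspan xs = U \<and> set xs \<subseteq> U \<and> rs = list_pairs xs)"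
    using extend_by_subspace[OF ps(1) pairs_in_ssum[OF sU(1) ps(3)] ssum_subspace[OF sU(1)] sU(2)] by metis
  have "q ^ (3 - j) = q ^ 0" using j(2) Cons.prems by simp
  then have "j = 3" using j(1) q_power_inject[of "3 - j" 0] by simp
  then obtain xs where xs: "length rs = 3" "lspan xs = U" "set xs \<subseteq> U" "rs = list_pairs xs" using j(6) by auto
  have "card (ssum (U # Us)) = q ^ (3 * length (U # Us))"
    using j(3) c \<open>j = 3\<close> by (simp add: power_add)
  moreover have "length (rs @ ps) = 3 * length (U # Us)" using ps(2) xs(1) by simp
  moreover have "set (rs @ ps) \<subseteq> (\<Union>X\<in>set (U # Us). X \<times> X)" using j(4) ps(3) by auto
  moreover have "\<exists>xs. lspan xs = X \<and> set xs \<subseteq> X \<and> set (list_pairs xs) \<subseteq> set (rs @ ps)"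
    if X: "X \<in> set (U # Us)" for X
  proof (cases "X = U")
    case True
    then show ?thesis using xs by auto
  next
    case False
    then have "X \<in> set Us" using X by simp
    with ps(4) have "\<exists>ys. lspan ys = X \<and> set ys \<subseteq> X \<and> set (list_pairs ys) \<subseteq> set ps" ..
    then show ?thesis unfolding set_append by blast
  qed
  ultimately show ?case using j(5) by blast
qed

text \<open>Pigeonhole: more than \<open>q\<close> vectors cannot have distinct values under
  \<open>f\<close>, and the difference of two with equal values is the required vector.\<close>

lemma functional_kernel:
  assumes f: "functional f" and U: "subspace K U V" "card U > q"
  obtains v where "v \<in> U" "v \<noteq> \<zero>\<^bsub>V\<^esub>" "f v = \<zero>\<^bsub>K\<^esub>"
proof -
  note UV = subspaceD(2)[OF U(1)]
  have "\<not> inj_on f U"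
  proof
    assume "inj_on f U"
    then have "card U \<le> q" using f UV finite_K by (intro card_inj_on_le[of f]) (auto simp: functionalD)
    then show False using U by simp
  qed
  then obtain x y where xy: "x \<in> U" "y \<in> U" "x \<noteq> y" "f x = f y" by (auto simp: inj_on_def)
  let ?m = "(\<ominus>\<^bsub>K\<^esub> \<one>\<^bsub>K\<^esub>) \<odot>\<^bsub>V\<^esub> y"
  have m1: "?m \<in> U" by (rule subspaceD(5)[OF U(1)]) (use xy in auto)
  have "?m = \<ominus>\<^bsub>V\<^esub> y" using UV[OF xy(2)] by (simp add: smult_l_minus)
  note m = m1 this
  have "f (x \<oplus>\<^bsub>V\<^esub> ?m) = f x \<oplus>\<^bsub>K\<^esub> (\<ominus>\<^bsub>K\<^esub> \<one>\<^bsub>K\<^esub>) \<otimes>\<^bsub>K\<^esub> f y"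
    using xy UV m(1) by (simp add: functionalD(2)[OF f] functionalD(3)[OF f])
  also have "\<dots> = \<zero>\<^bsub>K\<^esub>" using xy UV functionalD(1)[OF f] by (simp add: R.l_minus R.r_neg)
  finally have 0: "f (x \<oplus>\<^bsub>V\<^esub> ?m) = \<zero>\<^bsub>K\<^esub>" .
  have "x \<oplus>\<^bsub>V\<^esub> ?m \<noteq> \<zero>\<^bsub>V\<^esub>"
  proof
    assume "x \<oplus>\<^bsub>V\<^esub> ?m = \<zero>\<^bsub>V\<^esub>"
    then have "\<ominus>\<^bsub>V\<^esub> ?m = x" using xy(1) m UV by (intro M.minus_equality) auto
    then show False using m(2) xy UV by simp
  qed
  then show ?thesis using that[of "x \<oplus>\<^bsub>V\<^esub> ?m"] 0 subspaceD(4)[OF U(1) xy(1) m(1)] by blast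
qed

lemma card_sub3_gt: "U \<in> sub3 \<Longrightarrow> card U > q"
  using q_ge_2 sub3D(2) power_strict_increasing[of 1 3 q] by auto

text \<open>
  The form \<open>f \<and> g\<close> vanishes on both \<open>S\<close> and \<open>M\<close> but not on \<open>U\<close>.
\<close>

lemma separating_wedge:
  assumes S: "subspace K S V" and M: "subspace K M V" "M \<inter> S = {\<zero>\<^bsub>V\<^esub>}"
    and U: "U \<in> sub3" "\<not> U \<subseteq> S" "\<not> U \<subseteq> M"
  obtains f g u v where "functional f" "functional g" "u \<in> U" "v \<in> U" "wedge f g u v = \<one>\<^bsub>K\<^esub>"
    "\<forall>x\<in>S. f x = \<zero>\<^bsub>K\<^esub>" "\<forall>x\<in>M. g x = \<zero>\<^bsub>K\<^esub>"
proof (cases "U \<inter> M = {\<zero>\<^bsub>V\<^esub>}")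
  note SU = sub3D(1)[OF U(1)]
  \<comment> \<open>The nonzero vector \<open>v\<close> of \<open>U\<close> killed by
    \<open>f\<close> lies outside \<open>M\<close>, since \<open>U\<close> meets \<open>M\<close>
    trivially; so \<open>g\<close> can be 1 at \<open>v\<close>.\<close>
  case True
  obtain u where u: "u \<in> U" "u \<notin> S" using U(2) by auto
  have uV: "u \<in> carrier V" using u subspaceD(2)[OF SU] by auto
  obtain f where f: "functional f" "f u = \<one>\<^bsub>K\<^esub>" "\<forall>h\<in>S. f h = \<zero>\<^bsub>K\<^esub>" by (rule separation[OF S uV u(2)])
  obtain v where v: "v \<in> U" "v \<noteq> \<zero>\<^bsub>V\<^esub>" "f v = \<zero>\<^bsub>K\<^esub>"
    by (rule functional_kernel[OF f(1) SU card_sub3_gt[OF U(1)]])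
  have vV: "v \<in> carrier V" and vM: "v \<notin> M" using v True subspaceD(2)[OF SU] by auto
  obtain g where g: "functional g" "g v = \<one>\<^bsub>K\<^esub>" "\<forall>h\<in>M. g h = \<zero>\<^bsub>K\<^esub>" by (rule separation[OF M(1) vV vM])
  have "wedge f g u v = \<one>\<^bsub>K\<^esub>"
    using f g v functionalD(1)[OF g(1) uV] by (simp add: wedge_def R.minus_eq)
  then show ?thesis using that f g u v by blast
next
  note SU = sub3D(1)[OF U(1)]
  \<comment> \<open>A nonzero \<open>u\<close> in both \<open>U\<close> and \<open>M\<close> lies
    outside \<open>S\<close>, and \<open>g\<close> kills it. So only \<open>f u\<close> and
    \<open>g v\<close> contribute, and both are 1.\<close>
  case False
  have "\<zero>\<^bsub>V\<^esub> \<in> U \<inter> M" using subspaceD(3)[OF SU] subspaceD(3)[OF M(1)] by auto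
  then obtain u where u: "u \<in> U" "u \<in> M" "u \<noteq> \<zero>\<^bsub>V\<^esub>" using False by blast
  then have uV: "u \<in> carrier V" and uS: "u \<notin> S" using M(2) subspaceD(2)[OF SU] by auto
  obtain v where v: "v \<in> U" "v \<notin> M" using U(3) by auto
  have vV: "v \<in> carrier V" using v subspaceD(2)[OF SU] by auto
  obtain f where f: "functional f" "f u = \<one>\<^bsub>K\<^esub>" "\<forall>h\<in>S. f h = \<zero>\<^bsub>K\<^esub>" by (rule separation[OF S uV uS])
  obtain g where g: "functional g" "g v = \<one>\<^bsub>K\<^esub>" "\<forall>h\<in>M. g h = \<zero>\<^bsub>K\<^esub>" by (rule separation[OF M(1) vV v(2)])
  have "g u = \<zero>\<^bsub>K\<^esub>" using g u by blast
  then have "wedge f g u v = \<one>\<^bsub>K\<^esub>"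
    using f g functionalD(1)[OF f(1) vV] by (simp add: wedge_def R.minus_eq)
  then show ?thesis using that f g u v by blast
qed

lemma sub3_subset_eq: "U \<in> sub3 \<Longrightarrow> M \<in> sub3 \<Longrightarrow> U \<subseteq> M \<Longrightarrow> U = M"
  using card_subset_eq[of M U] finite_subspace sub3D by auto

lemma wedge_zero:
  assumes "functional f" "functional g" "x \<in> carrier V" "y \<in> carrier V"
    and "f x = \<zero>\<^bsub>K\<^esub> \<and> f y = \<zero>\<^bsub>K\<^esub> \<or> g x = \<zero>\<^bsub>K\<^esub> \<and> g y = \<zero>\<^bsub>K\<^esub>"
  shows "wedge f g x y = \<zero>\<^bsub>K\<^esub>"
  using assms functionalD(1)[OF assms(1)] functionalD(1)[OF assms(2)]
  by (auto simp: wedge_def R.minus_eq)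

text \<open>The summands are removed one at a time. While \<open>U\<close> still lies in the sum
  \<open>S\<close> of the remaining ones, the induction hypothesis supplies the surplus pair and
  \<open>M\<close> adds its own three. Once \<open>U\<close> is not contained in \<open>S\<close>,
  it is contained in neither \<open>S\<close> nor \<open>M\<close>, and
  \<open>separating_wedge\<close> gives a form that vanishes on every summand but not on
  \<open>U\<close>.\<close>

lemma excess_windep_inside:
  "indep_sum Us \<Longrightarrow> set Us \<subseteq> sub3 \<Longrightarrow> U \<in> sub3 \<Longrightarrow> U \<subseteq> ssum Us \<Longrightarrow> U \<notin> set Us \<Longrightarrow>
    \<exists>ps. windep ps \<and> length ps = 3 * length Us + 1 \<and> set ps \<subseteq> (\<Union>X\<in>set (U # Us). X \<times> X)"
proof (induction Us)
  case Nil
  then have "card U \<le> card {\<zero>\<^bsub>V\<^esub>}" by (intro card_mono) auto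
  then show ?case using card_sub3_gt[OF Nil(3)] q_ge_2 by simp
next
  case (Cons M Us)
  let ?S = "ssum Us"
  have sU: "set Us \<subseteq> sub3" and M: "M \<in> sub3" and ind: "indep_sum Us" and MS: "M \<inter> ?S = {\<zero>\<^bsub>V\<^esub>}"
    using Cons.prems by auto
  note S = ssum_subspace[OF sU] and SM = sub3D(1)[OF M] and SU = sub3D(1)[OF Cons.prems(3)]
  show ?case
  proof (cases "U \<subseteq> ?S")
    case True
    then obtain ps where ps: "windep ps" "length ps = 3 * length Us + 1"
      "set ps \<subseteq> (\<Union>X\<in>set (U # Us). X \<times> X)" using Cons by auto
    have "set ps \<subseteq> ?S \<times> ?S" using ps(3) True ssum_upper[OF sU] by fastforce
    then obtain j rs where j: "j \<le> 3" "card (M \<inter> ?S) = q ^ (3 - j)" "set rs \<subseteq> M \<times> M" "windep (rs @ ps)"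
      "j = 3 \<Longrightarrow> length rs = 3" using extend_by_subspace[OF ps(1) _ S M] by metis
    have "q ^ (3 - j) = q ^ 0" using j(2) MS by simp
    then have "j = 3" using j(1) q_power_inject[of "3 - j" 0] by simp
    then show ?thesis using j ps by (intro exI[of _ "rs @ ps"]) auto
  next
    case False
    obtain ps where ps: "windep ps" "length ps = 3 * length (M # Us)"
      "set ps \<subseteq> (\<Union>X\<in>set (M # Us). X \<times> X)"
      using indep_sum_windep[OF Cons.prems(1,2)] by blast
    have "\<not> U \<subseteq> M" using sub3_subset_eq[OF Cons.prems(3) M] Cons.prems(5) by auto
    then obtain f g u v where fg: "functional f" "functional g" "u \<in> U" "v \<in> U" "wedge f g u v = \<one>\<^bsub>K\<^esub>"
      "\<forall>x\<in>?S. f x = \<zero>\<^bsub>K\<^esub>" "\<forall>x\<in>M. g x = \<zero>\<^bsub>K\<^esub>"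
      using separating_wedge[OF S SM MS Cons.prems(3) False] by metis
    have "wedge f g x y = \<zero>\<^bsub>K\<^esub>" if xy: "(x, y) \<in> set ps" for x y
    proof -
      obtain X where X: "X \<in> set (M # Us)" "x \<in> X" "y \<in> X" using ps(3) xy by blast
      have "X = M \<or> X \<subseteq> ?S" using X(1) ssum_upper[OF sU] by auto
      then show ?thesis
        using fg X subspaceD(2)[OF SM] subspaceD(2)[OF S] by (intro wedge_zero) auto
    qed
    then have "\<forall>r\<in>set ps. wedge f g (fst r) (snd r) = \<zero>\<^bsub>K\<^esub>" by auto
    then have "windep ((u, v) # ps)"
      unfolding windep.simps fst_conv snd_conv
      using ps(1) fg(1,2,5) subspaceD(2)[OF SU fg(3)] subspaceD(2)[OF SU fg(4)] by blast
    then show ?thesis using ps(2,3) fg(3,4) by (intro exI[of _ "(u, v) # ps"]) auto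
  qed
qed

text \<open>
  The heart of the moment computation. If \<open>s\<close> is the dimension of the sum of distinct
  three-dimensional subspaces, there are about \<open>q ^ (n * s)\<close> such tuples, and each is isotropic with
  probability \<open>q ^ (- (n - 3) * d)\<close>, where \<open>d\<close> is the rank of the conditions. Direct sums have
  \<open>d = s = 3 * r\<close>; every other tuple has \<open>d \<ge> s + 1\<close> and so contributes \<open>O(q ^ (- n))\<close>.
\<close>

lemma dependent_tuple_windep:
  "distinct Us \<Longrightarrow> set Us \<subseteq> sub3 \<Longrightarrow> indep_sum Us \<or>
    (\<exists>ps s. windep ps \<and> set ps \<subseteq> (\<Union>X\<in>set Us. X \<times> X) \<and> card (ssum Us) = q ^ s \<and> length ps \<ge> s + 1)"
proof (induction Us)
  case Nil
  then show ?case by simp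
next
  case (Cons U Us)
  let ?S = "ssum Us"
  have sU: "set Us \<subseteq> sub3" and U: "U \<in> sub3" using Cons.prems by auto
  note S = ssum_subspace[OF sU] and SU = sub3D(1)[OF U]
  show ?case
  proof (cases "indep_sum Us")
    case True
    obtain ps where c: "card ?S = q ^ (3 * length Us)" and ps: "windep ps" "length ps = 3 * length Us"
      "set ps \<subseteq> (\<Union>X\<in>set Us. X \<times> X)" using indep_sum_windep[OF True sU] by blast
    obtain j rs where j: "j \<le> 3" "card (U \<inter> ?S) = q ^ (3 - j)" "card (U <+>\<^bsub>V\<^esub> ?S) = q ^ j * card ?S"
      "set rs \<subseteq> U \<times> U" "windep (rs @ ps)"
      "length rs \<ge> (if j = 0 then 0 else if j = 3 then 3 else j + 1)"
      using extend_by_subspace[OF ps(1) pairs_in_ssum[OF sU ps(3)] S U] by metis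
    \<comment> \<open>The first overlap creates the surplus: \<open>j = 0\<close> through
      \<open>excess_windep_inside\<close>, \<open>j = 1\<close> and \<open>j = 2\<close> through the
      extra pair of \<open>extend_by_subspace\<close>. For \<open>j = 3\<close> the sum is still
      direct.\<close>
    consider "j = 0" | "j = 1 \<or> j = 2" | "j = 3" using j(1) by linarith
    then show ?thesis
    proof cases
      case 1
      then have "card (U \<inter> ?S) = card U" using j(2) sub3D(2)[OF U] by simp
      then have "U \<inter> ?S = U" using finite_subspace[OF SU] by (intro card_subset_eq) auto
      then have "U \<subseteq> ?S" by blast
      then obtain ps where "windep ps" "length ps = 3 * length Us + 1" "set ps \<subseteq> (\<Union>X\<in>set (U # Us). X \<times> X)"
        using excess_windep_inside[OF True sU U] Cons.prems by auto
      then show ?thesis using j(3) 1 c by (intro disjI2 exI[of _ ps] exI[of _ "3 * length Us"]) auto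
    next
      case 2
      then show ?thesis using j ps c
        by (intro disjI2 exI[of _ "rs @ ps"] exI[of _ "3 * length Us + j"]) (auto simp: power_add)
    next
      case 3
      then have "U \<inter> ?S = {\<zero>\<^bsub>V\<^esub>}" using j(2) card_zero_subspace_iff[OF subspace_inter[OF SU S]] by simp
      then show ?thesis using True by simp
    qed
  next
    case False
    then obtain ps s where ps: "windep ps" "set ps \<subseteq> (\<Union>X\<in>set Us. X \<times> X)" "card ?S = q ^ s"
      "length ps \<ge> s + 1" using Cons by auto
    obtain j rs where j: "j \<le> 3" "card (U <+>\<^bsub>V\<^esub> ?S) = q ^ j * card ?S"
      "set rs \<subseteq> U \<times> U" "windep (rs @ ps)"
      "length rs \<ge> (if j = 0 then 0 else if j = 3 then 3 else j + 1)"
      using extend_by_subspace[OF ps(1) pairs_in_ssum[OF sU ps(2)] S U] by metis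
    \<comment> \<open>A subspace always adds at least as many conditions as dimensions, so a surplus
      that was gained earlier persists.\<close>
    have "length rs \<ge> j" using j(5) by (auto split: if_splits)
    then show ?thesis using j ps
      by (intro disjI2 exI[of _ "rs @ ps"] exI[of _ "s + j"]) (auto simp: power_add)
  qed
qed

end

section \<open>Counting subspaces and tuples\<close>

lemma card_distinct_lists:
  assumes "finite S"
  shows "card {xs. length xs = r \<and> distinct xs \<and> set xs \<subseteq> S} = fact r * (card S choose r)"
proof (cases "r \<le> card S")
  case True
  have "card {xs. length xs = r \<and> distinct xs \<and> set xs \<subseteq> S} = \<Prod>{card S - r + 1..card S}"
    using card_lists_distinct_length_eq[OF assms True] by simp
  also have "\<dots> = fact (card S) div fact (card S - r)"
    using fact_div_fact[of "card S - r" "card S"] by simp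
  also have "\<dots> = fact r * (card S choose r)"
    using binomial_fact_lemma[OF True] by (metis fact_nonzero mult.commute mult.left_commute nonzero_mult_div_cancel_left)
  finally show ?thesis .
next
  case False
  have "length xs \<le> card S" if "distinct xs" "set xs \<subseteq> S" for xs
    using that assms by (metis card_mono distinct_card)
  then have e: "{xs. length xs = r \<and> distinct xs \<and> set xs \<subseteq> S} = {}" using False by auto
  show ?thesis unfolding e using False by (simp add: binomial_eq_0)
qed

text \<open>
  The first terms of Euler's pentagonal number theorem; the last power makes the induction work.
\<close>

lemma prod_one_minus_power_ge:
  fixes x :: real
  assumes "0 \<le> x" "x \<le> 1"
  shows "1 - x - x ^ 2 + x ^ Suc k \<le> (\<Prod>i<k. 1 - x ^ Suc i)"
proof (induction k)
  case 0
  show ?case using assms by simp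
next
  case (Suc k)
  show ?case
  proof (cases k)
    case 0
    then show ?thesis by (simp add: power2_eq_square)
  next
    case (Suc l)
    \<comment> \<open>Expanding the product below leaves an excess of
      \<open>x ^ (k + 3) - x ^ (2 * k + 2)\<close> over the claim. It is nonnegative as soon as
      \<open>k\<close> is at least 1, hence the case split.\<close>
    have "x ^ (2 * Suc k) \<le> x ^ (k + 3)"
      using assms Suc by (intro power_decreasing) auto
    then have "1 - x - x ^ 2 + x ^ Suc (Suc k) \<le> (1 - x - x ^ 2 + x ^ Suc k) * (1 - x ^ Suc k)"
      by (simp add: algebra_simps power2_eq_square power_add[symmetric] numeral_eq_Suc mult_2)
    also have "\<dots> \<le> (\<Prod>i<k. 1 - x ^ Suc i) * (1 - x ^ Suc k)"
      using Suc.IH assms by (intro mult_right_mono) (auto intro: power_le_one simp del: power_Suc)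
    finally show ?thesis by simp
  qed
qed

text \<open>A bound, uniform in \<open>k\<close>, for the reciprocal of the product of
  \<open>1 - 1 / q ^ i\<close> over \<open>i\<close> from 1 to \<open>k\<close>, taken from
  \<open>prod_one_minus_power_ge\<close>. It is 4 at \<open>q = 2\<close> and decreases in
  \<open>q\<close>.\<close>

definition euler_const :: "nat \<Rightarrow> real" where
  "euler_const q = 1 / (1 - 1 / real q - 1 / real q ^ 2)"

definition gl_order :: "nat \<Rightarrow> nat \<Rightarrow> nat" where
  "gl_order q k = (\<Prod>i<k. q ^ k - q ^ i)"

lemma gl_order_eq:
  assumes "q \<ge> 2"
  shows "real (gl_order q k) = real q ^ (k * k) * (\<Prod>i<k. 1 - (1 / real q) ^ Suc i)"
proof -
  have "real (gl_order q k) = (\<Prod>i<k. real q ^ k - real q ^ i)"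
    unfolding gl_order_def of_nat_prod using assms
    by (intro prod.cong) (auto simp: of_nat_diff power_increasing)
  also have "\<dots> = (\<Prod>i<k. real q ^ k * (1 - (1 / real q) ^ (k - i)))"
    using assms by (intro prod.cong) (auto simp: algebra_simps power_diff power_one_over)
  also have "\<dots> = real q ^ (k * k) * (\<Prod>i<k. 1 - (1 / real q) ^ (k - i))"
    by (simp add: prod.distrib power_mult)
  also have "(\<Prod>i<k. 1 - (1 / real q) ^ (k - i)) = (\<Prod>i<k. 1 - (1 / real q) ^ Suc i)"
    by (subst prod.nat_diff_reindex[symmetric]) (auto intro!: prod.cong simp: Suc_diff_Suc)
  finally show ?thesis .
qed

lemma euler_const_pos:
  assumes "q \<ge> 2"
  shows "1 - 1 / real q - 1 / real q ^ 2 \<ge> 1 / 4"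
proof -
  have "1 / real q \<le> 1 / 2" using assms by (simp add: field_simps)
  moreover have "1 / real q ^ 2 \<le> 1 / 2 ^ 2" using assms by (intro divide_left_mono power_mono) auto
  ultimately show ?thesis by simp
qed

lemma gl_order_ge:
  assumes "q \<ge> 2"
  shows "real q ^ (k * k) \<le> euler_const q * real (gl_order q k)"
proof -
  have "1 - 1 / real q - 1 / real q ^ 2 \<le> (\<Prod>i<k. 1 - (1 / real q) ^ Suc i)"
    using prod_one_minus_power_ge[of "1 / real q" k] assms
    by (simp add: power_one_over) (smt (verit) divide_nonneg_nonneg of_nat_0_le_iff zero_le_power mult_nonneg_nonneg)
  then have "real q ^ (k * k) * (1 - 1 / real q - 1 / real q ^ 2) \<le> real (gl_order q k)"
    unfolding gl_order_eq[OF assms] by (intro mult_left_mono) auto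
  then show ?thesis
    using euler_const_pos[OF assms] unfolding euler_const_def by (simp add: field_simps)
qed

lemma gl_order_pos: "q \<ge> 2 \<Longrightarrow> gl_order q k > 0"
  unfolding gl_order_def by (intro prod_pos) auto

context finite_vectorspace begin

definition n_subspaces :: "'c set \<Rightarrow> nat \<Rightarrow> nat" where
  "n_subspaces H k = card {U. subspace K U V \<and> U \<subseteq> H \<and> card U = q ^ k}"

lemma n_subspaces_bound:
  assumes H: "subspace K H V" "card H = q ^ s"
  shows "n_subspaces H k * gl_order q k \<le> q ^ (s * k)"
proof -
  have "{U. subspace K U V \<and> U \<subseteq> H \<and> card U = q ^ k \<and> U \<inter> lspan [] = {\<zero>\<^bsub>V\<^esub>}}
      = {U. subspace K U V \<and> U \<subseteq> H \<and> card U = q ^ k}" using subspaceD(3) by auto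
  then have "n_subspaces H k * gl_order q k = (\<Prod>i<k. q ^ s - q ^ i)"
    using card_complementary_subspaces[OF H(1), of "[]" k] H(2)
    by (simp add: n_subspaces_def gl_order_def)
  also have "\<dots> \<le> (\<Prod>i<k. q ^ s)" by (intro prod_mono) auto
  finally show ?thesis by (simp add: power_mult)
qed

text \<open>A Gaussian binomial coefficient is \<open>q ^ (k * (s - k))\<close> up to a bounded
  factor. The quotient form remains meaningful for \<open>k > s\<close>, where \<open>s - k\<close>
  would be truncated.\<close>

lemma n_subspaces_le:
  assumes H: "subspace K H V" "card H = q ^ s"
  shows "real (n_subspaces H k) \<le> euler_const q * real q ^ (s * k) / real q ^ (k * k)"
proof -
  have "real (n_subspaces H k) * real q ^ (k * k)
      \<le> real (n_subspaces H k) * (euler_const q * real (gl_order q k))"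
    by (intro mult_left_mono gl_order_ge q_ge_2) auto
  also have "\<dots> = euler_const q * real (n_subspaces H k * gl_order q k)" by simp
  also have "\<dots> \<le> euler_const q * real (q ^ (s * k))"
    using n_subspaces_bound[OF H, of k] euler_const_pos[OF q_ge_2]
    by (intro mult_left_mono) (simp_all only: of_nat_le_iff euler_const_def, simp)
  finally show ?thesis using q_ge_2 by (simp add: field_simps)
qed

text \<open>The exact \<open>gl_order q 3\<close> replaces \<open>euler_const\<close> here, because
  this bound is raised to the \<open>r\<close>-th power and should combine with
  \<open>isotropic_rate\<close>.\<close>

lemma n_subspaces_3_le:
  assumes H: "subspace K H V" "card H = q ^ s"
  shows "real (n_subspaces H 3) \<le> real q ^ (3 * s) / real (gl_order q 3)"
proof -
  have "real (n_subspaces H 3 * gl_order q 3) \<le> real (q ^ (s * 3))"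
    using n_subspaces_bound[OF H, of 3] by (simp only: of_nat_le_iff)
  then show ?thesis using gl_order_pos[OF q_ge_2, of 3] by (simp add: field_simps)
qed

lemma finite_sub3: "finite sub3"
  unfolding sub3_def by (rule finite_subset[OF _ finite_subspaces]) auto

lemma finite_sub3_lists: "finite {Us. length Us = r \<and> set Us \<subseteq> sub3}"
  using finite_lists_length_eq[OF finite_sub3, of r] by (simp add: conj_commute)

text \<open>Each new summand is a complement-type choice against the sum so far, of dimension
  \<open>3 * r\<close>; it contributes the next three factors of the product.\<close>

lemma card_indep_sums:
  "card {Us. length Us = r \<and> set Us \<subseteq> sub3 \<and> indep_sum Us} * gl_order q 3 ^ r
    = (\<Prod>j<3 * r. card (carrier V) - q ^ j)"
proof (induction r)
  case 0
  have "{Us. length Us = 0 \<and> set Us \<subseteq> sub3 \<and> indep_sum Us} = {[]}" by auto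
  then show ?case by simp
next
  case (Suc r)
  let ?I = "\<lambda>r. {Us. length Us = r \<and> set Us \<subseteq> sub3 \<and> indep_sum Us}"
  let ?F = "\<lambda>Us. {U \<in> sub3. U \<inter> ssum Us = {\<zero>\<^bsub>V\<^esub>}}"
  have eq: "?I (Suc r) = (\<lambda>(Us, U). U # Us) ` (SIGMA Us:?I r. ?F Us)"
  proof (intro equalityI subsetI)
    fix Us assume "Us \<in> ?I (Suc r)"
    then obtain U Us' where "Us = U # Us'" "Us' \<in> ?I r" "U \<in> ?F Us'" by (cases Us) auto
    then show "Us \<in> (\<lambda>(Us, U). U # Us) ` (SIGMA Us:?I r. ?F Us)"
      by (intro image_eqI[of _ _ "(Us', U)"]) auto
  qed auto
  have fin: "finite (?I r)" by (rule finite_subset[OF _ finite_sub3_lists[of r]]) auto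
  have F: "card (?F Us) * gl_order q 3 = (\<Prod>i<3. card (carrier V) - q ^ (3 * r + i))" if Us: "Us \<in> ?I r" for Us
  proof -
    have S: "subspace K (ssum Us) V" "card (ssum Us) = q ^ (3 * r)"
      using Us ssum_subspace indep_sum_windep by auto
    obtain ss where ss: "indep ss" "lspan ss = ssum Us" "card (ssum Us) = q ^ length ss"
      using subspace_basis[OF S(1)] by metis
    have len: "length ss = 3 * r" using ss(3) S(2) q_power_inject by simp
    have "?F Us = {U. subspace K U V \<and> U \<subseteq> carrier V \<and> card U = q ^ 3 \<and> U \<inter> lspan ss = {\<zero>\<^bsub>V\<^esub>}}"
      using subspaceD(1) by (auto simp: sub3_def ss(2))
    then show ?thesis
      using card_complementary_subspaces[OF subspace_carrier ss(1) indep_carrier[OF ss(1)], of 3] len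
      by (simp add: gl_order_def)
  qed
  have "card (?I (Suc r)) = card (SIGMA Us:?I r. ?F Us)"
    unfolding eq by (intro card_image inj_onI) auto
  also have "\<dots> = (\<Sum>Us\<in>?I r. card (?F Us))"
    using fin finite_sub3 by (intro card_SigmaI) auto
  finally have "card (?I (Suc r)) * gl_order q 3 = (\<Sum>Us\<in>?I r. card (?F Us) * gl_order q 3)"
    by (simp add: sum_distrib_right)
  also have "\<dots> = card (?I r) * (\<Prod>i<3. card (carrier V) - q ^ (3 * r + i))"
    using F by simp
  finally have *: "card (?I (Suc r)) * gl_order q 3 = card (?I r) * (\<Prod>i<3. card (carrier V) - q ^ (3 * r + i))" .
  have "card (?I (Suc r)) * gl_order q 3 ^ Suc r = card (?I (Suc r)) * gl_order q 3 * gl_order q 3 ^ r"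
    by simp
  also have "\<dots> = (card (?I r) * gl_order q 3 ^ r) * (\<Prod>i<3. card (carrier V) - q ^ (3 * r + i))"
    unfolding * by simp
  also have "\<dots> = (\<Prod>j<3 * Suc r. card (carrier V) - q ^ j)"
  proof -
    have "(\<Prod>i<3. g i) = g 0 * g 1 * g 2" for g :: "nat \<Rightarrow> nat"
      by (simp add: numeral_3_eq_3 numeral_2_eq_2)
    moreover have "(\<Prod>j<3 * Suc r. g j) = (\<Prod>j<3 * r. g j) * g (3 * r) * g (3 * r + 1) * g (3 * r + 2)"
      for g :: "nat \<Rightarrow> nat"
    proof -
      have "3 * Suc r = Suc (Suc (Suc (3 * r)))" by simp
      then show ?thesis by (simp only: prod.lessThan_Suc) simp
    qed
    ultimately show ?thesis unfolding Suc.IH by (simp only: add_0_right mult.assoc)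
  qed
  finally show ?case .
qed

lemma indep_sum_distinct: "indep_sum Us \<Longrightarrow> set Us \<subseteq> sub3 \<Longrightarrow> distinct Us"
proof (induction Us)
  case (Cons U Us)
  have "U \<notin> set Us"
  proof
    assume "U \<in> set Us"
    then have "U \<subseteq> ssum Us" using ssum_upper Cons.prems by auto
    then have "U = {\<zero>\<^bsub>V\<^esub>}" using Cons.prems by auto
    then show False using card_sub3_gt[of U] Cons.prems q_ge_2 by auto
  qed
  then show ?case using Cons by auto
qed simp

lemma card_ssum_le: "set Us \<subseteq> sub3 \<Longrightarrow> card (ssum Us) \<le> q ^ (3 * length Us)"
proof (induction Us)
  case (Cons U Us)
  have "U <+>\<^bsub>V\<^esub> ssum Us = (\<lambda>(a, b). a \<oplus>\<^bsub>V\<^esub> b) ` (U \<times> ssum Us)" by (auto simp: set_add_def')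
  moreover have "finite U" "finite (ssum Us)"
    using Cons.prems finite_subspace ssum_subspace sub3D(1) by auto
  ultimately have "card (U <+>\<^bsub>V\<^esub> ssum Us) \<le> card U * card (ssum Us)"
    using card_image_le[of "U \<times> ssum Us" "\<lambda>(a, b). a \<oplus>\<^bsub>V\<^esub> b"] by (simp add: card_cartesian_product)
  also have "\<dots> \<le> q ^ 3 * q ^ (3 * length Us)"
    using Cons sub3D(2)[of U] by (intro mult_mono) auto
  finally show ?case by (simp add: power_add)
qed simp

end

text \<open>The certificate contains all pairs from a spanning list of each summand, so vanishing on
  it is equivalent to isotropy and the count is exact.\<close>

lemma (in alternating_setting) card_isotropic_indep:
  assumes Us: "V.indep_sum Us" "set Us \<subseteq> V.sub3"
  shows "card {B \<in> A. \<forall>U\<in>set Us. \<forall>x\<in>U. \<forall>y\<in>U. B x y = \<zero>\<^bsub>W\<^esub>} * card (carrier W) ^ (3 * length Us) = card A"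
proof -
  obtain ps where ps: "V.windep ps" "length ps = 3 * length Us" "set ps \<subseteq> (\<Union>X\<in>set Us. X \<times> X)"
    "\<forall>X\<in>set Us. \<exists>xs. V.lspan xs = X \<and> set xs \<subseteq> X \<and> set (V.list_pairs xs) \<subseteq> set ps"
    using V.indep_sum_windep[OF Us] by blast
  have "(\<forall>U\<in>set Us. \<forall>x\<in>U. \<forall>y\<in>U. B x y = \<zero>\<^bsub>W\<^esub>) \<longleftrightarrow> (\<forall>(x, y)\<in>set ps. B x y \<in> {\<zero>\<^bsub>W\<^esub>})" if B: "B \<in> A" for B
  proof
    assume "\<forall>U\<in>set Us. \<forall>x\<in>U. \<forall>y\<in>U. B x y = \<zero>\<^bsub>W\<^esub>"
    then show "\<forall>(x, y)\<in>set ps. B x y \<in> {\<zero>\<^bsub>W\<^esub>}" using ps(3) by blast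
  next
    assume 0: "\<forall>(x, y)\<in>set ps. B x y \<in> {\<zero>\<^bsub>W\<^esub>}"
    show "\<forall>U\<in>set Us. \<forall>x\<in>U. \<forall>y\<in>U. B x y = \<zero>\<^bsub>W\<^esub>"
    proof (intro ballI)
      fix U x y assume U: "U \<in> set Us" and xy: "x \<in> U" "y \<in> U"
      obtain xs where xs: "V.lspan xs = U" "set xs \<subseteq> U" "set (V.list_pairs xs) \<subseteq> set ps"
        using ps(4) U by blast
      have "U \<subseteq> carrier V" using Us(2) U V.sub3D(1) V.subspaceD(1) by blast
      have "B x y \<in> {\<zero>\<^bsub>W\<^esub>}"
      proof (rule alt_lspan_pairs[OF B W.subspace_zero])
        show "set xs \<subseteq> carrier V" using xs(2) \<open>U \<subseteq> carrier V\<close> by blast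
        show "B a b \<in> {\<zero>\<^bsub>W\<^esub>}" if "(a, b) \<in> set (V.list_pairs xs)" for a b
          using 0 xs(3) that by blast
      qed (use xs(1) xy in simp_all)
      then show "B x y = \<zero>\<^bsub>W\<^esub>" by simp
    qed
  qed
  note key = this
  have "{B \<in> A. \<forall>U\<in>set Us. \<forall>x\<in>U. \<forall>y\<in>U. B x y = \<zero>\<^bsub>W\<^esub>} = {B \<in> A. \<forall>(x, y)\<in>set ps. B x y \<in> {\<zero>\<^bsub>W\<^esub>}}"
    by (intro Collect_cong conj_cong refl key)
  then show ?thesis using card_windep[OF ps(1), of "{\<zero>\<^bsub>W\<^esub>}"] ps(2) by simp
qed

text \<open>Isotropy implies vanishing on the certificate pairs, which gives an inequality only; of
  these at least \<open>s + 1\<close> conditions just \<open>s + 1\<close> are charged.\<close>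

lemma (in alternating_setting) card_isotropic_dep:
  assumes Us: "\<not> V.indep_sum Us" "distinct Us" "set Us \<subseteq> V.sub3" "card (V.ssum Us) = card (carrier K) ^ s"
  shows "card {B \<in> A. \<forall>U\<in>set Us. \<forall>x\<in>U. \<forall>y\<in>U. B x y = \<zero>\<^bsub>W\<^esub>} * card (carrier W) ^ (s + 1) \<le> card A"
proof -
  obtain ps s' where ps: "V.windep ps" "set ps \<subseteq> (\<Union>X\<in>set Us. X \<times> X)"
    "card (V.ssum Us) = card (carrier K) ^ s'" "length ps \<ge> s' + 1"
    using V.dependent_tuple_windep[OF Us(2,3)] Us(1) by blast
  have s: "s' = s" using ps(3) Us(4) V.q_power_inject by simp
  have W1: "card (carrier W) \<ge> 1"
    using W.finite_V W.M.zero_closed by (metis One_nat_def Suc_leI card_gt_0_iff empty_iff)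
  have "{B \<in> A. \<forall>U\<in>set Us. \<forall>x\<in>U. \<forall>y\<in>U. B x y = \<zero>\<^bsub>W\<^esub>} \<subseteq> {B \<in> A. \<forall>(x, y)\<in>set ps. B x y \<in> {\<zero>\<^bsub>W\<^esub>}}"
  proof
    fix B assume B: "B \<in> {B \<in> A. \<forall>U\<in>set Us. \<forall>x\<in>U. \<forall>y\<in>U. B x y = \<zero>\<^bsub>W\<^esub>}"
    have "B x y = \<zero>\<^bsub>W\<^esub>" if xy: "(x, y) \<in> set ps" for x y
    proof -
      obtain U where "U \<in> set Us" "x \<in> U" "y \<in> U" using ps(2) xy by blast
      then show ?thesis using B by simp
    qed
    then show "B \<in> {B \<in> A. \<forall>(x, y)\<in>set ps. B x y \<in> {\<zero>\<^bsub>W\<^esub>}}" using B by auto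
  qed
  then have "card {B \<in> A. \<forall>U\<in>set Us. \<forall>x\<in>U. \<forall>y\<in>U. B x y = \<zero>\<^bsub>W\<^esub>} * card (carrier W) ^ (s + 1)
    \<le> card {B \<in> A. \<forall>(x, y)\<in>set ps. B x y \<in> {\<zero>\<^bsub>W\<^esub>}} * card (carrier W) ^ length ps"
    using ps(4) s finite_A W1 by (intro mult_mono card_mono power_increasing) simp_all
  then show ?thesis using card_windep[OF ps(1), of "{\<zero>\<^bsub>W\<^esub>}"] by simp
qed

section \<open>Binomial moments and large bad subspaces\<close>

text \<open>The limiting mean in the form in which the counting produces it;
  \<open>isotropic_rate_eq\<close> identifies it with \<open>poisson_parameter\<close>.\<close>

definition isotropic_rate :: "nat \<Rightarrow> real" where
  "isotropic_rate q = real q ^ 9 / real (gl_order q 3)"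

text \<open>
  The \<open>r\<close>-th binomial moment is \<open>isotropic_rate q ^ r / fact r\<close> times \<open>main_factor q n r\<close>, from the
  tuples in direct sum, plus at most \<open>error_term q n r / fact r\<close>, whose \<open>s\<close>-th summand is for the
  other tuples with an \<open>s\<close>-dimensional sum.
\<close>

definition main_factor :: "nat \<Rightarrow> nat \<Rightarrow> nat \<Rightarrow> real" where
  "main_factor q n r = (\<Prod>j<3 * r. 1 - real q ^ j / real q ^ n)"

definition error_term :: "nat \<Rightarrow> nat \<Rightarrow> nat \<Rightarrow> real" where
  "error_term q n r = euler_const q * isotropic_rate q ^ r *
     (\<Sum>s\<le>3 * r. real q ^ (3 * s * r + 3 * s + 3) / real q ^ (s * s + 9 * r + n))"

locale codim3_setting = alternating_setting K V W
  for K :: "('a, 'e) ring_scheme" and V :: "('a, 'b, 'f) module_scheme"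
    and W :: "('a, 'c, 'g) module_scheme" +
  fixes n :: nat
  assumes n_ge_3: "n \<ge> 3"
    and card_V: "card (carrier V) = card (carrier K) ^ n"
    and card_W: "card (carrier W) = card (carrier K) ^ (n - 3)"
begin

abbreviation "q \<equiv> card (carrier K)"

abbreviation isotropic :: "('b \<Rightarrow> 'b \<Rightarrow> 'c) \<Rightarrow> 'b set \<Rightarrow> bool" where
  "isotropic B U \<equiv> \<forall>x\<in>U. \<forall>y\<in>U. B x y = \<zero>\<^bsub>W\<^esub>"

definition n_isotropic :: "('b \<Rightarrow> 'b \<Rightarrow> 'c) \<Rightarrow> nat" where
  "n_isotropic B = card {U \<in> V.sub3. isotropic B U}"

definition binomial_moment :: "nat \<Rightarrow> real" where
  "binomial_moment r = (\<Sum>B\<in>A. real (n_isotropic B choose r)) / real (card A)"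

definition tuples :: "nat \<Rightarrow> 'b set list set" where
  "tuples r = {Us. length Us = r \<and> distinct Us \<and> set Us \<subseteq> V.sub3}"

definition n_vanishing :: "'b set list \<Rightarrow> nat" where
  "n_vanishing Us = card {B \<in> A. \<forall>U\<in>set Us. isotropic B U}"

lemma q_gt_1: "q > 1"
  using V.q_ge_2 by simp

lemma card_A_pos: "card A > 0"
  using finite_A A_nonempty by (simp add: card_gt_0_iff)

lemma finite_tuples: "finite (tuples r)"
  by (rule finite_subset[OF _ V.finite_sub3_lists[of r]]) (auto simp: tuples_def)

text \<open>Double counting of pairs formed by a map and an ordered tuple of distinct subspaces
  isotropic for it; the factorial accounts for the order.\<close>

lemma sum_choose: "(\<Sum>B\<in>A. fact r * (n_isotropic B choose r)) = (\<Sum>Us\<in>tuples r. n_vanishing Us)"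
proof -
  have "fact r * (n_isotropic B choose r) = card {Us \<in> tuples r. \<forall>U\<in>set Us. isotropic B U}" for B
  proof -
    have "{Us \<in> tuples r. \<forall>U\<in>set Us. isotropic B U}
        = {Us. length Us = r \<and> distinct Us \<and> set Us \<subseteq> {U \<in> V.sub3. isotropic B U}}"
      by (auto simp: tuples_def)
    then show ?thesis
      using card_distinct_lists[of "{U \<in> V.sub3. isotropic B U}" r] V.finite_sub3
      by (simp add: n_isotropic_def)
  qed
  then have "(\<Sum>B\<in>A. fact r * (n_isotropic B choose r))
      = (\<Sum>B\<in>A. card {Us \<in> tuples r. \<forall>U\<in>set Us. isotropic B U})" by simp
  also have "\<dots> = (\<Sum>Us\<in>tuples r. n_vanishing Us)"
    unfolding n_vanishing_def
    by (rule sum_multicount_gen) (use finite_A finite_tuples in auto)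
  finally show ?thesis .
qed

lemma binomial_moment_eq:
  "fact r * binomial_moment r = (\<Sum>Us\<in>tuples r. real (n_vanishing Us)) / real (card A)"
proof -
  have "(\<Sum>B\<in>A. fact r * real (n_isotropic B choose r)) = real (\<Sum>B\<in>A. fact r * (n_isotropic B choose r))"
    by (simp add: of_nat_fact)
  then show ?thesis
    unfolding binomial_moment_def sum_choose by (simp add: sum_distrib_left)
qed

lemma q_power_split: "real q ^ (n * k) = real q ^ ((n - 3) * k) * real q ^ (3 * k)"
  using n_ge_3 by (simp add: power_add[symmetric] add_mult_distrib[symmetric])

lemma sum_indep_tuples:
  "(\<Sum>Us\<in>{Us \<in> tuples r. V.indep_sum Us}. real (n_vanishing Us)) / real (card A)
    = isotropic_rate q ^ r * main_factor q n r"
proof -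
  let ?I = "{Us. length Us = r \<and> set Us \<subseteq> V.sub3 \<and> V.indep_sum Us}"
  have I: "{Us \<in> tuples r. V.indep_sum Us} = ?I"
    using V.indep_sum_distinct by (auto simp: tuples_def)
  have v: "real (n_vanishing Us) = real (card A) / real q ^ ((n - 3) * (3 * r))" if "Us \<in> ?I" for Us
  proof -
    have "n_vanishing Us * q ^ ((n - 3) * (3 * r)) = card A"
      using card_isotropic_indep[of Us] that by (simp add: n_vanishing_def card_W power_mult)
    then have "real (n_vanishing Us) * real q ^ ((n - 3) * (3 * r)) = real (card A)"
      by (metis of_nat_mult of_nat_power)
    then show ?thesis using q_gt_1 by (simp add: field_simps)
  qed
  have prod: "real (\<Prod>j<3 * r. q ^ n - q ^ j) = real q ^ (n * (3 * r)) * main_factor q n r"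
  proof (cases "3 * r \<le> n")
    case True
    have "real (\<Prod>j<3 * r. q ^ n - q ^ j) = (\<Prod>j<3 * r. real q ^ n * (1 - real q ^ j / real q ^ n))"
      unfolding of_nat_prod using True q_gt_1
      by (intro prod.cong) (auto simp: of_nat_diff power_increasing field_simps)
    then show ?thesis by (simp add: prod.distrib power_mult main_factor_def)
  next
    \<comment> \<open>Both products contain the vanishing factor \<open>j = n\<close>: the space is
      too small for such a direct sum.\<close>
    case False
    then have "(\<Prod>j<3 * r. q ^ n - q ^ j) = 0" "main_factor q n r = 0"
      using q_gt_1 by (auto simp: main_factor_def intro!: bexI[of _ n])
    then show ?thesis by simp
  qed
  have g: "real (gl_order q 3) > 0" using gl_order_pos[OF V.q_ge_2] by simp
  have "real (card ?I) * real (gl_order q 3) ^ r = real q ^ (n * (3 * r)) * main_factor q n r"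
    using arg_cong[OF V.card_indep_sums[of r, unfolded card_V], of real] unfolding prod[symmetric]
    by (simp only: of_nat_mult of_nat_power)
  then have cI: "real (card ?I) = real q ^ (n * (3 * r)) * main_factor q n r / real (gl_order q 3) ^ r"
    using g by (simp add: field_simps)
  have "(\<Sum>Us\<in>?I. real (n_vanishing Us)) / real (card A) = real (card ?I) / real q ^ ((n - 3) * (3 * r))"
    using v card_A_pos by simp
  also have "\<dots> = (real q ^ 9 / real (gl_order q 3)) ^ r * main_factor q n r"
  proof -
    have "real q ^ (n * (3 * r)) = real q ^ ((n - 3) * (3 * r)) * (real q ^ 9) ^ r"
      using q_power_split[of "3 * r"] by (simp add: power_mult[symmetric] mult.assoc)
    then show ?thesis unfolding cI using g q_gt_1 by (simp add: power_divide field_simps)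
  qed
  finally show ?thesis unfolding I isotropic_rate_def .
qed

lemma isotropic_rate_pos: "isotropic_rate q > 0"
  using gl_order_pos[OF V.q_ge_2, of 3] q_gt_1 by (simp add: isotropic_rate_def)

text \<open>The sum \<open>S\<close> is chosen first, and then each of the \<open>r\<close> entries
  freely among the three-dimensional subspaces of \<open>S\<close>.\<close>

lemma card_dependent_tuples:
  "real (card {Us \<in> tuples r. card (V.ssum Us) = q ^ s})
    \<le> euler_const q * real q ^ (n * s) / real q ^ (s * s) * (isotropic_rate q * real q ^ (3 * s) / real q ^ 9) ^ r"
proof -
  let ?S = "{S. subspace K S V \<and> S \<subseteq> carrier V \<and> card S = q ^ s}"
  let ?T = "\<lambda>S. {Us. set Us \<subseteq> {U. subspace K U V \<and> U \<subseteq> S \<and> card U = q ^ 3} \<and> length Us = r}"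
  have fS: "finite ?S" by (rule finite_subset[OF _ V.finite_subspaces]) auto
  have fU: "finite {U. subspace K U V \<and> U \<subseteq> S \<and> card U = q ^ 3}" for S
    by (rule finite_subset[OF _ V.finite_subspaces]) auto
  have cT: "card (?T S) = V.n_subspaces S 3 ^ r" for S
    using card_lists_length_eq[OF fU[of S], of r] by (simp add: V.n_subspaces_def)
  have "{Us \<in> tuples r. card (V.ssum Us) = q ^ s} \<subseteq> (\<Union>S\<in>?S. ?T S)"
  proof
    fix Us assume "Us \<in> {Us \<in> tuples r. card (V.ssum Us) = q ^ s}"
    then have *: "set Us \<subseteq> V.sub3" "length Us = r" "card (V.ssum Us) = q ^ s" by (auto simp: tuples_def)
    have S: "subspace K (V.ssum Us) V" using V.ssum_subspace[OF *(1)] .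
    have "V.ssum Us \<in> ?S" using S V.subspaceD(1)[OF S] *(3) by simp
    moreover have "Us \<in> ?T (V.ssum Us)"
      using *(1,2) V.ssum_upper[OF *(1)] V.sub3D by blast
    ultimately show "Us \<in> (\<Union>S\<in>?S. ?T S)" by blast
  qed
  then have "card {Us \<in> tuples r. card (V.ssum Us) = q ^ s} \<le> card (\<Union>S\<in>?S. ?T S)"
    using fS fU by (intro card_mono) (auto intro: finite_lists_length_eq)
  also have "\<dots> \<le> (\<Sum>S\<in>?S. V.n_subspaces S 3 ^ r)"
    using card_UN_le[OF fS, of ?T] by (simp only: cT)
  finally have "real (card {Us \<in> tuples r. card (V.ssum Us) = q ^ s})
      \<le> real (\<Sum>S\<in>?S. V.n_subspaces S 3 ^ r)" by (simp only: of_nat_le_iff)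
  also have "\<dots> \<le> (\<Sum>S\<in>?S. (isotropic_rate q * real q ^ (3 * s) / real q ^ 9) ^ r)"
    unfolding of_nat_sum of_nat_power
  proof (intro sum_mono power_mono)
    fix S assume "S \<in> ?S"
    then have "real (V.n_subspaces S 3) \<le> real q ^ (3 * s) / real (gl_order q 3)"
      by (intro V.n_subspaces_3_le) auto
    then show "real (V.n_subspaces S 3) \<le> isotropic_rate q * real q ^ (3 * s) / real q ^ 9"
      using q_gt_1 by (simp add: isotropic_rate_def)
  qed auto
  also have "\<dots> = real (V.n_subspaces (carrier V) s) * (isotropic_rate q * real q ^ (3 * s) / real q ^ 9) ^ r"
    by (simp add: V.n_subspaces_def)
  also have "\<dots> \<le> euler_const q * real q ^ (n * s) / real q ^ (s * s) * (isotropic_rate q * real q ^ (3 * s) / real q ^ 9) ^ r"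
    using isotropic_rate_pos
    by (intro mult_right_mono V.n_subspaces_le V.subspace_carrier card_V zero_le_power) auto
  finally show ?thesis .
qed

lemma sum_dep_tuples:
  "(\<Sum>Us\<in>{Us \<in> tuples r. \<not> V.indep_sum Us}. real (n_vanishing Us)) / real (card A) \<le> error_term q n r"
proof -
  let ?D = "{Us \<in> tuples r. \<not> V.indep_sum Us}"
  let ?E = "\<lambda>s. {Us \<in> tuples r. card (V.ssum Us) = q ^ s}"
  let ?R = "isotropic_rate q"
  have fin: "finite ?D" "finite (?E s)" for s using finite_tuples by auto
  have sub: "\<exists>s\<le>3 * r. card (V.ssum Us) = q ^ s" if "Us \<in> ?D" for Us
  proof -
    have *: "set Us \<subseteq> V.sub3" "length Us = r" using that by (auto simp: tuples_def)
    obtain ss :: "'b list" where ss: "card (V.ssum Us) = q ^ length ss"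
      using V.subspace_basis[OF V.ssum_subspace[OF *(1)]] by metis
    have "q ^ length ss \<le> q ^ (3 * r)" using V.card_ssum_le[OF *(1)] *(2) ss by simp
    then have "length ss \<le> 3 * r" using q_gt_1 power_le_imp_le_exp by blast
    then show ?thesis using ss by blast
  qed
  have "(\<Sum>Us\<in>?D. real (n_vanishing Us)) / real (card A) = (\<Sum>Us\<in>?D. real (n_vanishing Us) / real (card A))"
    by (simp add: sum_divide_distrib)
  also have "\<dots> \<le> (\<Sum>Us\<in>(\<Union>s\<le>3 * r. ?D \<inter> ?E s). real (n_vanishing Us) / real (card A))"
    using fin sub by (intro sum_mono2) auto
  also have "\<dots> \<le> (\<Sum>s\<le>3 * r. \<Sum>Us\<in>?D \<inter> ?E s. real (n_vanishing Us) / real (card A))"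
  proof (rule eq_refl, rule sum.UNION_disjoint)
    show "\<forall>s\<in>{..3 * r}. \<forall>t\<in>{..3 * r}. s \<noteq> t \<longrightarrow> ?D \<inter> ?E s \<inter> (?D \<inter> ?E t) = {}"
      using V.q_power_inject by auto
  qed (use fin in auto)
  also have "\<dots> \<le> (\<Sum>s\<le>3 * r. euler_const q * ?R ^ r *
     (real q ^ (3 * s * r + 3 * s + 3) / real q ^ (s * s + 9 * r + n)))"
  proof (rule sum_mono)
    fix s
    have v: "real (n_vanishing Us) / real (card A) \<le> 1 / real q ^ ((n - 3) * (s + 1))" if "Us \<in> ?D \<inter> ?E s" for Us
    proof -
      have "n_vanishing Us * q ^ ((n - 3) * (s + 1)) \<le> card A"
        using card_isotropic_dep[of Us s] that
        unfolding n_vanishing_def card_W tuples_def power_mult by blast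
      then have "real (n_vanishing Us) * real q ^ ((n - 3) * (s + 1)) \<le> real (card A)"
        by (metis of_nat_mult of_nat_power of_nat_le_iff)
      then show ?thesis using q_gt_1 card_A_pos by (simp add: field_simps)
    qed
    have "(\<Sum>Us\<in>?D \<inter> ?E s. real (n_vanishing Us) / real (card A))
        \<le> real (card (?D \<inter> ?E s)) * (1 / real q ^ ((n - 3) * (s + 1)))"
      using v by (intro sum_bounded_above)
    also have "\<dots> \<le> real (card (?E s)) * (1 / real q ^ ((n - 3) * (s + 1)))"
      using fin by (intro mult_right_mono of_nat_mono card_mono) auto
    also have "\<dots> \<le> (euler_const q * real q ^ (n * s) / real q ^ (s * s) *
        (?R * real q ^ (3 * s) / real q ^ 9) ^ r) * (1 / real q ^ ((n - 3) * (s + 1)))"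
      by (intro mult_right_mono card_dependent_tuples) auto
    also have "\<dots> = euler_const q * ?R ^ r *
      (real q ^ (3 * s * r + 3 * s + 3) / real q ^ (s * s + 9 * r + n))"
    proof -
      \<comment> \<open>The \<open>s + 1\<close> conditions outweigh the choice of the
        \<open>s\<close>-dimensional sum; this cancellation is the source of the factor
        \<open>q ^ (- n)\<close>.\<close>
      have "real q ^ (n * s) * real q ^ n = real q ^ ((n - 3) * (s + 1)) * real q ^ (3 * (s + 1))"
        using q_power_split[of "s + 1"] by (simp add: power_add algebra_simps)
      then have e: "real q ^ (n * s) / real q ^ ((n - 3) * (s + 1)) = real q ^ (3 * s + 3) / real q ^ n"
        using q_gt_1 by (simp add: field_simps)
      have "(?R * real q ^ (3 * s) / real q ^ 9) ^ r = ?R ^ r * real q ^ (3 * s * r) / real q ^ (9 * r)"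
        by (simp add: power_mult_distrib power_divide power_mult)
      then have "(euler_const q * real q ^ (n * s) / real q ^ (s * s) *
        (?R * real q ^ (3 * s) / real q ^ 9) ^ r) * (1 / real q ^ ((n - 3) * (s + 1)))
        = euler_const q * ?R ^ r * real q ^ (3 * s * r) / (real q ^ (9 * r) * real q ^ (s * s)) *
          (real q ^ (n * s) / real q ^ ((n - 3) * (s + 1)))"
        by (simp add: mult_ac)
      then show ?thesis unfolding e by (simp add: power_add mult_ac)
    qed
    finally show "(\<Sum>Us\<in>?D \<inter> ?E s. real (n_vanishing Us) / real (card A)) \<le> \<dots>" .
  qed
  finally show ?thesis by (simp add: error_term_def sum_distrib_left)
qed

lemma binomial_moment_bounds:
  "isotropic_rate q ^ r * main_factor q n r / fact r \<le> binomial_moment r"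
  "binomial_moment r \<le> (isotropic_rate q ^ r * main_factor q n r + error_term q n r) / fact r"
proof -
  let ?v = "\<lambda>S. (\<Sum>Us\<in>S. real (n_vanishing Us)) / real (card A)"
  have "tuples r = {Us \<in> tuples r. V.indep_sum Us} \<union> {Us \<in> tuples r. \<not> V.indep_sum Us}" by auto
  then have "(\<Sum>Us\<in>tuples r. real (n_vanishing Us))
    = (\<Sum>Us\<in>{Us \<in> tuples r. V.indep_sum Us}. real (n_vanishing Us)) +
      (\<Sum>Us\<in>{Us \<in> tuples r. \<not> V.indep_sum Us}. real (n_vanishing Us))"
    using finite_tuples by (subst sum.union_disjoint[symmetric]) auto
  then have e: "fact r * binomial_moment r = isotropic_rate q ^ r * main_factor q n r + ?v {Us \<in> tuples r. \<not> V.indep_sum Us}"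
    unfolding binomial_moment_eq sum_indep_tuples[symmetric] by (simp add: add_divide_distrib)
  have "?v {Us \<in> tuples r. \<not> V.indep_sum Us} \<ge> 0" by (auto intro!: divide_nonneg_nonneg sum_nonneg)
  then have "isotropic_rate q ^ r * main_factor q n r \<le> fact r * binomial_moment r" using e by simp
  then show "isotropic_rate q ^ r * main_factor q n r / fact r \<le> binomial_moment r"
    by (simp add: field_simps)
  have "fact r * binomial_moment r \<le> isotropic_rate q ^ r * main_factor q n r + error_term q n r"
    using e sum_dep_tuples[of r] by simp
  then show "binomial_moment r \<le> (isotropic_rate q ^ r * main_factor q n r + error_term q n r) / fact r"
    by (simp add: field_simps)
qed

end

section \<open>Codimensions and bad subspaces of dimension at least four\<close>

lemma (in finite_vectorspace) quotient_dim:
  assumes H: "subspace K H V"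
  shows "card H * q ^ vectorspace.dim K (quotient_space V H) = card (carrier V)"
proof -
  interpret S: abelian_subgroup H V by (rule subspace_abelian_subgroup[OF H])
  interpret Q: vectorspace K "quotient_space V H" by (rule quotient_space_vectorspace[OF H])
  have carr: "carrier (quotient_space V H) = rcosets\<^bsub>add_monoid V\<^esub> H"
    by (simp add: quotient_space_def A_RCOSETS_def)
  have "finite (rcosets\<^bsub>add_monoid V\<^esub> H)"
    using finite_V by (simp add: RCOSETS_def)
  then interpret Q: finite_vectorspace K "quotient_space V H"
    by unfold_locales (use finite_K carr in auto)
  have "card (rcosets\<^bsub>add_monoid V\<^esub> H) * card H = card (carrier V)"
    using M.add.lagrange[OF S.a_subgroup] by (simp add: Coset.order_def)
  then show ?thesis using Q.card_carrier carr by (simp add: mult.commute)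
qed

text \<open>With \<open>h\<close> the dimension and \<open>m\<close> the codimension:
  \<open>h * (h - 1) / 2 - (2 * h - 3)\<close> equals \<open>(h - 2) * (h - 3) / 2\<close>, which is
  at least \<open>h - 3\<close>, and \<open>m * (h - 3) - (m + h - 4)\<close> equals
  \<open>(m - 1) * (h - 4)\<close>.\<close>

lemma exponent_ineq:
  fixes h m :: nat
  assumes "4 \<le> h" "1 \<le> m"
  shows "m * (2 * h - 3) + (m + h - 4) \<le> m * (h * (h - 1) div 2)"
proof -
  obtain k where k: "h = k + 4" using assms(1) le_Suc_ex by (metis add.commute)
  obtain l where l: "m = l + 1" using assms(2) le_Suc_ex by (metis add.commute)
  have "2 * (h * (h - 1) div 2) = h * (h - 1)" by (simp add: k)
  then have "2 * (h * (h - 1) div 2) \<ge> 2 * (2 * h - 3 + (h - 3))" by (simp add: k algebra_simps)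
  then have "m * (2 * h - 3 + (h - 3)) \<le> m * (h * (h - 1) div 2)" by simp
  moreover have "m + h - 4 \<le> m * (h - 3)" by (simp add: k l algebra_simps)
  ultimately show ?thesis by (simp add: distrib_left)
qed

context codim3_setting
begin

lemma bad_iff:
  assumes B: "B \<in> A" and H: "subspace K H V" and h: "card H = q ^ h"
    and d: "card (image_span K W B H) = q ^ d"
  shows "bad K V W B H \<longleftrightarrow> H \<noteq> carrier V \<and> d + 3 \<le> h"
proof -
  have S: "subspace K (image_span K W B H) W" using image_span_subspace[OF B V.subspaceD(1)[OF H]] .
  have "q ^ (h + vectorspace.dim K (quotient_space V H)) = q ^ n"
    using V.quotient_dim[OF H] h card_V by (simp add: power_add)
  then have 1: "h + vectorspace.dim K (quotient_space V H) = n" using V.q_power_inject by blast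
  have "q ^ (d + vectorspace.dim K (quotient_space W (image_span K W B H))) = q ^ (n - 3)"
    using W.quotient_dim[OF S] d card_W by (simp add: power_add)
  then have 2: "d + vectorspace.dim K (quotient_space W (image_span K W B H)) = n - 3"
    using V.q_power_inject by blast
  show ?thesis unfolding bad_def using H 1 2 n_ge_3 by auto
qed

text \<open>A union bound over the subspaces of dimension exactly \<open>h - 3\<close>. Smaller
  images are enlarged to that dimension, so that all terms have the same probability.\<close>

lemma card_bad:
  assumes H: "subspace K H V" and h: "card H = q ^ h" "4 \<le> h" "h < n"
  shows "real (card {B \<in> A. bad K V W B H}) \<le> real (card A) * (euler_const q * real q ^ ((n - 3) * (h - 3)) / real q ^ ((h - 3) * (h - 3)))
    / real q ^ ((n - h) * (h * (h - 1) div 2))"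
proof -
  obtain xs where xs: "V.indep xs" "V.lspan xs = H" "set xs \<subseteq> H" "card H = q ^ length xs"
    using V.subspace_basis[OF H] by metis
  have len: "length xs = h" using xs(4) h(1) V.q_power_inject by simp
  let ?L = "h * (h - 1) div 2"
  let ?ps = "V.list_pairs xs"
  have lp: "length ?ps = ?L" using V.length_list_pairs[of xs] len by simp
  let ?S = "{W'. subspace K W' W \<and> W' \<subseteq> carrier W \<and> card W' = q ^ (h - 3)}"
  let ?N = "\<lambda>W'. {B \<in> A. \<forall>(x, y)\<in>set ?ps. B x y \<in> W'}"
  have fS: "finite ?S" by (rule finite_subset[OF _ W.finite_subspaces]) auto
  have sub: "{B \<in> A. bad K V W B H} \<subseteq> (\<Union>W'\<in>?S. ?N W')"
  proof
    fix B assume "B \<in> {B \<in> A. bad K V W B H}"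
    then have B: "B \<in> A" and bad: "bad K V W B H" by auto
    have S: "subspace K (image_span K W B H) W" using image_span_subspace[OF B V.subspaceD(1)[OF H]] .
    obtain ys where ys: "W.indep ys" "W.lspan ys = image_span K W B H" "set ys \<subseteq> image_span K W B H"
      "card (image_span K W B H) = q ^ length ys" using W.subspace_basis[OF S] by metis
    have d: "length ys + 3 \<le> h" using bad bad_iff[OF B H h(1) ys(4)] by simp
    obtain zs where zs: "W.indep (zs @ ys)" "W.lspan (zs @ ys) = carrier W"
      using W.indep_extend[OF W.subspace_carrier ys(1) W.indep_carrier[OF ys(1)]] by blast
    have "q ^ length (zs @ ys) = q ^ (n - 3)" using W.card_lspan[OF zs(1)] zs(2) card_W by simp
    then have lz: "length zs + length ys = n - 3" using V.q_power_inject by simp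
    \<comment> \<open>There are \<open>n - 3 - length ys\<close> vectors in \<open>zs\<close>;
      dropping \<open>n - h\<close> of them leaves \<open>h - 3\<close> vectors together with
      \<open>ys\<close>, and a tail of an independent list is independent.\<close>
    let ?ws = "drop (n - h) zs"
    have zV: "set (take (n - h) zs) \<subseteq> carrier W" "set (?ws @ ys) \<subseteq> carrier W"
      using W.indep_carrier[OF zs(1)] set_take_subset[of "n - h" zs] set_drop_subset[of "n - h" zs] by auto
    have "take (n - h) zs @ (?ws @ ys) = zs @ ys" by (metis append.assoc append_take_drop_id)
    then have "W.indep (take (n - h) zs @ (?ws @ ys))" using zs(1) by (simp only:)
    then have ind: "W.indep (?ws @ ys)" using W.indep_append[OF zV] by blast
    have lw: "length (?ws @ ys) = h - 3" using lz d h n_ge_3 by simp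
    let ?W' = "W.lspan (?ws @ ys)"
    have W': "subspace K ?W' W" using W.lspan_subspace[OF zV(2)] .
    have "?W' \<in> ?S" using W' W.subspaceD(1)[OF W'] W.card_lspan[OF ind] lw by simp
    moreover have "image_span K W B H \<subseteq> ?W'"
      unfolding ys(2)[symmetric] using W.lspan_superset[OF zV(2)] by (intro W.lspan_least[OF W']) auto
    then have "\<forall>x\<in>H. \<forall>y\<in>H. B x y \<in> ?W'"
      using image_span_subset_iff[OF B V.subspaceD(1)[OF H] W'] by simp
    then have "B \<in> ?N ?W'" using B V.set_list_pairs[of xs] xs(3) by blast
    ultimately show "B \<in> (\<Union>W'\<in>?S. ?N W')" by blast
  qed
  have cN: "real (card (?N W')) = real (card A) / real q ^ ((n - h) * ?L)" if W': "W' \<in> ?S" for W'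
  proof -
    have "card (?N W') * card (carrier W) ^ ?L = card A * card W' ^ ?L"
      using card_windep[OF V.windep_list_pairs[OF xs(1)], of W'] W' lp by auto
    then have "real (card (?N W')) * (real q ^ (n - 3)) ^ ?L = real (card A) * (real q ^ (h - 3)) ^ ?L"
      unfolding card_W using W' by (metis (mono_tags, lifting) mem_Collect_eq of_nat_mult of_nat_power)
    moreover have "real q ^ (n - 3) = real q ^ (n - h) * real q ^ (h - 3)"
      using h by (simp add: power_add[symmetric])
    ultimately have "real (card (?N W')) * (real q ^ (n - h)) ^ ?L = real (card A)"
      using q_gt_1 by (simp add: power_mult_distrib)
    then show ?thesis using q_gt_1 by (simp add: power_mult field_simps)
  qed
  have "card {B \<in> A. bad K V W B H} \<le> card (\<Union>W'\<in>?S. ?N W')"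
    using sub fS finite_A by (intro card_mono) auto
  also have "\<dots> \<le> (\<Sum>W'\<in>?S. card (?N W'))" by (rule card_UN_le[OF fS])
  finally have "real (card {B \<in> A. bad K V W B H}) \<le> real (\<Sum>W'\<in>?S. card (?N W'))"
    by (rule of_nat_mono)
  also have "\<dots> = (\<Sum>W'\<in>?S. real (card (?N W')))" by (rule of_nat_sum)
  also have "\<dots> = real (W.n_subspaces (carrier W) (h - 3)) * (real (card A) / real q ^ ((n - h) * ?L))"
    using cN by (simp add: W.n_subspaces_def)
  also have "\<dots> \<le> (euler_const q * real q ^ ((n - 3) * (h - 3)) / real q ^ ((h - 3) * (h - 3))) * (real (card A) / real q ^ ((n - h) * ?L))"
    by (intro mult_right_mono W.n_subspaces_le W.subspace_carrier card_W) auto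
  finally show ?thesis by (simp add: mult_ac)
qed

lemma euler_const_pos': "euler_const q > 0"
  using euler_const_pos[OF V.q_ge_2] by (simp add: euler_const_def)

lemma sum_card_bad:
  assumes "n \<ge> 5"
  shows "(\<Sum>B\<in>A. real (card {H. bad K V W B H \<and> card H \<ge> q ^ 4}))
    \<le> real (card A) * (euler_const q ^ 2 * real n / real q ^ (n - 4))"
proof -
  let ?S = "\<lambda>h. {H. subspace K H V \<and> H \<subseteq> carrier V \<and> card H = q ^ h}"
  let ?T = "{H. subspace K H V \<and> H \<noteq> carrier V \<and> card H \<ge> q ^ 4}"
  have fT: "finite ?T" by (rule finite_subset[OF _ V.finite_subspaces]) auto
  have fS: "finite (?S h)" for h by (rule finite_subset[OF _ V.finite_subspaces]) auto
  have "(\<Sum>B\<in>A. card {H. bad K V W B H \<and> card H \<ge> q ^ 4}) = (\<Sum>B\<in>A. card {H \<in> ?T. bad K V W B H})"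
    by (intro sum.cong arg_cong[where f = card]) (auto simp: bad_def)
  also have "\<dots> = (\<Sum>H\<in>?T. card {B \<in> A. bad K V W B H})"
    by (rule sum_multicount_gen) (use finite_A fT in auto)
  finally have "real (\<Sum>B\<in>A. card {H. bad K V W B H \<and> card H \<ge> q ^ 4})
      = real (\<Sum>H\<in>?T. card {B \<in> A. bad K V W B H})"
    by (rule arg_cong)
  then have "(\<Sum>B\<in>A. real (card {H. bad K V W B H \<and> card H \<ge> q ^ 4}))
      = (\<Sum>H\<in>?T. real (card {B \<in> A. bad K V W B H}))"
    by (simp only: of_nat_sum)
  also have "\<dots> \<le> (\<Sum>H\<in>(\<Union>h\<in>{4..<n}. ?S h). real (card {B \<in> A. bad K V W B H}))"
  proof (rule sum_mono2)
    show "?T \<subseteq> (\<Union>h\<in>{4..<n}. ?S h)"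
    proof
      fix H assume H: "H \<in> ?T"
      then have "subspace K H V" by simp
      then obtain xs :: "'b list" where xs: "card H = q ^ length xs" using V.subspace_basis by metis
      have HV: "H \<subseteq> carrier V" using H V.subspaceD(1) by blast
      have "card H < card (carrier V)" using H HV V.finite_V by (intro psubset_card_mono) auto
      then have "length xs < n" using xs card_V q_gt_1 by (simp add: power_strict_increasing_iff)
      moreover have "4 \<le> length xs" using H xs q_gt_1 by (simp add: power_increasing_iff)
      ultimately show "H \<in> (\<Union>h\<in>{4..<n}. ?S h)" using H HV xs by auto
    qed
  qed (use fS in auto)
  also have "\<dots> = (\<Sum>h\<in>{4..<n}. \<Sum>H\<in>?S h. real (card {B \<in> A. bad K V W B H}))"
    by (rule sum.UNION_disjoint) (use fS V.q_power_inject in auto)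
  also have "\<dots> \<le> (\<Sum>h\<in>{4..<n}. real (card A) * (euler_const q ^ 2 / real q ^ (n - 4)))"
  proof (rule sum_mono)
    fix h assume h: "h \<in> {4..<n}"
    let ?b = "real (card A) * (euler_const q * real q ^ ((n - 3) * (h - 3)) / real q ^ ((h - 3) * (h - 3)))
      / real q ^ ((n - h) * (h * (h - 1) div 2))"
    have b0: "?b \<ge> 0" using euler_const_pos' by simp
    have "(\<Sum>H\<in>?S h. real (card {B \<in> A. bad K V W B H})) \<le> real (card (?S h)) * ?b"
      using h by (intro sum_bounded_above card_bad) auto
    also have "\<dots> = real (V.n_subspaces (carrier V) h) * ?b" by (simp add: V.n_subspaces_def)
    also have "\<dots> \<le> (euler_const q * real q ^ (n * h) / real q ^ (h * h)) * ?b"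
      by (intro mult_right_mono V.n_subspaces_le V.subspace_carrier card_V b0)
    also have "\<dots> = real (card A) * euler_const q ^ 2 *
      (real q ^ (n * h) / real q ^ (h * h) * (real q ^ ((n - 3) * (h - 3)) / real q ^ ((h - 3) * (h - 3)))
        / real q ^ ((n - h) * (h * (h - 1) div 2)))"
      by (simp add: power2_eq_square mult_ac)
    also have "\<dots> \<le> real (card A) * euler_const q ^ 2 * (1 / real q ^ (n - 4))"
    proof (intro mult_left_mono)
      \<comment> \<open>In terms of the codimension \<open>m\<close>, the choices of
        \<open>H\<close> and of the subspace of \<open>W\<close> contribute exponents
        \<open>m * h\<close> and \<open>m * (h - 3)\<close>, free of truncated differences in
        \<open>n\<close>.\<close>
      obtain m where m: "n = h + m" "1 \<le> m" using h by (metis atLeastLessThan_iff less_imp_add_positive Suc_leI One_nat_def)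
      have e1: "real q ^ (n * h) / real q ^ (h * h) = real q ^ (m * h)"
        using q_gt_1 by (simp add: m(1) add_mult_distrib power_add)
      have "n - 3 = (h - 3) + m" using h m by simp
      then have e2: "real q ^ ((n - 3) * (h - 3)) / real q ^ ((h - 3) * (h - 3)) = real q ^ (m * (h - 3))"
        using q_gt_1 by (simp only: add_mult_distrib power_add) simp
      have "m * h + m * (h - 3) = m * (2 * h - 3)" using h by (simp add: add_mult_distrib2[symmetric] mult_2)
      then have e3: "real q ^ (m * h) * real q ^ (m * (h - 3)) = real q ^ (m * (2 * h - 3))"
        by (simp add: power_add[symmetric])
      have "m * (2 * h - 3) + (n - 4) \<le> m * (h * (h - 1) div 2)"
        using exponent_ineq[of h m] h m by (simp add: add.commute)
      then have "real q ^ (m * (2 * h - 3)) * real q ^ (n - 4) \<le> real q ^ (m * (h * (h - 1) div 2))"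
        using q_gt_1 by (simp add: power_add[symmetric] power_increasing)
      then show "real q ^ (n * h) / real q ^ (h * h) * (real q ^ ((n - 3) * (h - 3)) / real q ^ ((h - 3) * (h - 3)))
        / real q ^ ((n - h) * (h * (h - 1) div 2)) \<le> 1 / real q ^ (n - 4)"
        unfolding e1 e2 e3 using q_gt_1 by (simp add: m(1) field_simps)
    qed auto
    finally show "(\<Sum>H\<in>?S h. real (card {B \<in> A. bad K V W B H}))
      \<le> real (card A) * (euler_const q ^ 2 / real q ^ (n - 4))" by simp
  qed
  also have "\<dots> = real (n - 4) * (real (card A) * (euler_const q ^ 2 / real q ^ (n - 4)))" by simp
  also have "\<dots> \<le> real n * (real (card A) * (euler_const q ^ 2 / real q ^ (n - 4)))"
    by (intro mult_right_mono) auto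
  finally show ?thesis by (simp add: mult_ac)
qed

end

section \<open>Bonferroni inequalities and Poisson convergence\<close>

text \<open>Pascal's rule makes the alternating sum telescope.\<close>

lemma alternating_choose_sum:
  assumes "x > 0"
  shows "(\<Sum>i\<le>k. (- 1) ^ i * real (x choose i)) = (- 1) ^ k * real ((x - 1) choose k)"
proof (induction k)
  case 0
  show ?case by simp
next
  case (Suc k)
  obtain y where "x = Suc y" using assms gr0_implies_Suc by blast
  then show ?case using Suc by (simp add: algebra_simps)
qed

lemma bonferroni_lower:
  "(\<Sum>i\<le>2 * m + 1. (- 1) ^ i * real (x choose i)) \<le> (if x = 0 then 1 else 0)"
proof (cases "x = 0")
  case True
  have "(\<Sum>i\<le>2 * m + 1. (- 1) ^ i * real (0 choose i)) = (\<Sum>i\<in>{0}. (- 1) ^ i * real (0 choose i))"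
    by (intro sum.mono_neutral_right) (auto simp: binomial_eq_0)
  then show ?thesis using True by simp
next
  case False
  then show ?thesis using alternating_choose_sum[of x "2 * m + 1"] by simp
qed

text \<open>Since \<open>((k + i) choose k) * (x choose (k + i))\<close> is
  \<open>(x choose k) * ((x - k) choose i)\<close>, the sum is \<open>x choose k\<close> times a
  truncated alternating sum for \<open>x - k\<close>. For \<open>x > k\<close> that sum is
  \<open>(x - k - 1) choose m\<close> up to sign, and Pascal's rule bounds it by the first omitted
  term.\<close>

lemma bonferroni_point:
  "\<bar>(if x = k then 1 else 0) - (\<Sum>i\<le>m. (- 1) ^ i * real ((k + i) choose k) * real (x choose (k + i)))\<bar>
    \<le> real ((k + m + 1) choose k) * real (x choose (k + m + 1))"
proof (cases "k \<le> x")
  case False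
  then show ?thesis by (simp add: binomial_eq_0)
next
  case True
  have t: "real ((k + i) choose k) * real (x choose (k + i)) = real (x choose k) * real ((x - k) choose i)" for i
  proof (cases "k + i \<le> x")
    case True
    have "(x choose (k + i)) * ((k + i) choose k) = (x choose k) * ((x - k) choose (k + i - k))"
      by (rule choose_mult) (use True in auto)
    then have "real ((x choose (k + i)) * ((k + i) choose k)) = real ((x choose k) * ((x - k) choose i))"
      by simp
    then show ?thesis by (simp only: of_nat_mult mult.commute)
  next
    case False
    then show ?thesis using True by (simp add: binomial_eq_0)
  qed
  have s: "(\<Sum>i\<le>m. (- 1) ^ i * real ((k + i) choose k) * real (x choose (k + i)))
      = real (x choose k) * (\<Sum>i\<le>m. (- 1) ^ i * real ((x - k) choose i))"
    unfolding sum_distrib_left by (intro sum.cong) (auto simp: t mult.assoc mult.left_commute)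
  show ?thesis
  proof (cases "x = k")
    case True
    have "(\<Sum>i\<le>m. (- 1) ^ i * real (0 choose i)) = (\<Sum>i\<in>{0}. (- 1) ^ i * real (0 choose i))"
      by (intro sum.mono_neutral_right) (auto simp: binomial_eq_0)
    then show ?thesis unfolding s using True by simp
  next
    case False
    then have x: "x - k > 0" using \<open>k \<le> x\<close> by simp
    have "\<bar>0 - real (x choose k) * ((- 1) ^ m * real ((x - k - 1) choose m))\<bar>
        = real (x choose k) * real ((x - k - 1) choose m)"
      by (simp add: abs_mult power_abs)
    also have "\<dots> \<le> real (x choose k) * real ((x - k) choose (m + 1))"
    proof (intro mult_left_mono of_nat_mono)
      obtain y where "x - k = Suc y" using x gr0_implies_Suc by blast
      then show "(x - k - 1) choose m \<le> (x - k) choose (m + 1)" by simp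
    qed simp
    also have "\<dots> = real ((k + m + 1) choose k) * real (x choose (k + m + 1))"
      using t[of "m + 1"] by (simp add: add.assoc)
    finally show ?thesis unfolding s alternating_choose_sum[OF x] using False by simp
  qed
qed

lemma avg_bonferroni:
  fixes X :: "'a \<Rightarrow> nat"
  assumes S: "finite S"
  defines "M r \<equiv> (\<Sum>B\<in>S. real (X B choose r)) / real (card S)"
  shows "\<bar>real (card {B \<in> S. X B = k}) / real (card S) - (\<Sum>i\<le>m. (- 1) ^ i * real ((k + i) choose k) * M (k + i))\<bar>
    \<le> real ((k + m + 1) choose k) * M (k + m + 1)"
proof -
  let ?t = "\<lambda>B i. (- 1) ^ i * real ((k + i) choose k) * real (X B choose (k + i))"
  have c: "real (card {B \<in> S. X B = k}) = (\<Sum>B\<in>S. if X B = k then 1 else 0)"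
    using S by (simp add: sum.If_cases Int_def conj_commute)
  have e: "real (card {B \<in> S. X B = k}) / real (card S) - (\<Sum>i\<le>m. (- 1) ^ i * real ((k + i) choose k) * M (k + i))
      = (\<Sum>B\<in>S. (if X B = k then 1 else 0) - (\<Sum>i\<le>m. ?t B i)) / real (card S)"
  proof -
    have "(\<Sum>i\<le>m. (- 1) ^ i * real ((k + i) choose k) * M (k + i)) = (\<Sum>i\<le>m. \<Sum>B\<in>S. ?t B i) / real (card S)"
      by (simp add: M_def sum_divide_distrib sum_distrib_left)
    also have "(\<Sum>i\<le>m. \<Sum>B\<in>S. ?t B i) = (\<Sum>B\<in>S. \<Sum>i\<le>m. ?t B i)" by (rule sum.swap)
    finally show ?thesis unfolding c by (simp add: sum_subtractf diff_divide_distrib)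
  qed
  have "\<bar>\<Sum>B\<in>S. (if X B = k then 1 else 0) - (\<Sum>i\<le>m. ?t B i)\<bar>
      \<le> (\<Sum>B\<in>S. real ((k + m + 1) choose k) * real (X B choose (k + m + 1)))"
    by (rule order_trans[OF sum_abs]) (intro sum_mono bonferroni_point)
  then have "\<bar>\<Sum>B\<in>S. (if X B = k then 1 else 0) - (\<Sum>i\<le>m. ?t B i)\<bar> / real (card S)
      \<le> (\<Sum>B\<in>S. real ((k + m + 1) choose k) * real (X B choose (k + m + 1))) / real (card S)"
    by (intro divide_right_mono) auto
  also have "\<dots> = real ((k + m + 1) choose k) * M (k + m + 1)"
    by (simp add: M_def sum_distrib_left)
  finally show ?thesis unfolding e abs_divide by simp
qed

text \<open>The truncation index \<open>m\<close> is fixed before \<open>n\<close>: it makes the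
  first omitted term and the tail of the exponential series smaller than \<open>e / 4\<close>. Then
  finitely many moments are within \<open>e / 4\<close> of their limits for large \<open>n\<close>,
  and four such errors add up to less than \<open>e\<close>.\<close>

lemma poisson_limit:
  fixes X :: "nat \<Rightarrow> 'a \<Rightarrow> nat" and l :: real
  assumes S: "\<And>n. finite (S n)"
    and M: "\<And>r. (\<lambda>n. (\<Sum>B\<in>S n. real (X n B choose r)) / real (card (S n))) \<longlonglongrightarrow> l ^ r / fact r"
  shows "(\<lambda>n. real (card {B \<in> S n. X n B = k}) / real (card (S n))) \<longlonglongrightarrow> l ^ k / fact k * exp (- l)"
proof (rule LIMSEQ_I)
  fix e :: real assume e: "e > 0"
  define M where "M n r = (\<Sum>B\<in>S n. real (X n B choose r)) / real (card (S n))" for n r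
  define P where "P n = real (card {B \<in> S n. X n B = k}) / real (card (S n))" for n
  have lim: "(\<lambda>n. M n r) \<longlonglongrightarrow> l ^ r / fact r" for r using M unfolding M_def .
  have c: "real ((k + i) choose k) * (l ^ (k + i) / fact (k + i)) = l ^ k / fact k * (l ^ i / fact i)" for i
    by (subst binomial_fact) (auto simp: power_add)
  have "(\<lambda>i. l ^ i / fact i) \<longlonglongrightarrow> 0"
    using summable_LIMSEQ_zero[OF summable_exp[of l]] by (simp add: field_simps)
  then have R: "(\<lambda>m. l ^ k / fact k * (l ^ (m + 1) / fact (m + 1))) \<longlonglongrightarrow> l ^ k / fact k * 0"
    by (intro tendsto_mult tendsto_const LIMSEQ_ignore_initial_segment)
  have "(\<lambda>m. \<Sum>i\<le>m. (- l) ^ i / fact i) \<longlonglongrightarrow> exp (- l)"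
    using exp_converges[of "- l"] by (simp add: sums_def_le scaleR_conv_of_real field_simps)
  then have T: "(\<lambda>m. l ^ k / fact k * (\<Sum>i\<le>m. (- l) ^ i / fact i)) \<longlonglongrightarrow> l ^ k / fact k * exp (- l)"
    by (intro tendsto_mult tendsto_const)
  have "\<forall>\<^sub>F m in sequentially. \<bar>l ^ k / fact k * (l ^ (m + 1) / fact (m + 1))\<bar> < e / 4 \<and>
      \<bar>l ^ k / fact k * (\<Sum>i\<le>m. (- l) ^ i / fact i) - l ^ k / fact k * exp (- l)\<bar> < e / 4"
    using tendstoD[OF R, of "e / 4"] tendstoD[OF T, of "e / 4"] e
    unfolding dist_real_def by (simp add: eventually_conj)
  then obtain m where m: "\<bar>l ^ k / fact k * (l ^ (m + 1) / fact (m + 1))\<bar> < e / 4"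
      "\<bar>l ^ k / fact k * (\<Sum>i\<le>m. (- l) ^ i / fact i) - l ^ k / fact k * exp (- l)\<bar> < e / 4"
    unfolding eventually_sequentially by blast
  have A: "(\<lambda>n. \<Sum>i\<le>m. (- 1) ^ i * real ((k + i) choose k) * M n (k + i))
      \<longlonglongrightarrow> (\<Sum>i\<le>m. (- 1) ^ i * real ((k + i) choose k) * (l ^ (k + i) / fact (k + i)))"
    by (intro tendsto_sum tendsto_mult tendsto_const lim)
  have A': "(\<Sum>i\<le>m. (- 1) ^ i * real ((k + i) choose k) * (l ^ (k + i) / fact (k + i)))
      = l ^ k / fact k * (\<Sum>i\<le>m. (- l) ^ i / fact i)"
    unfolding sum_distrib_left
  proof (intro sum.cong refl)
    fix i
    have "(- l) ^ i = (- 1) ^ i * l ^ i" by (simp add: power_minus[of l])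
    then show "(- 1) ^ i * real ((k + i) choose k) * (l ^ (k + i) / fact (k + i)) = l ^ k / fact k * ((- l) ^ i / fact i)"
      using c[of i] by (simp only: mult.assoc) (simp add: mult_ac)
  qed
  have B: "(\<lambda>n. real ((k + m + 1) choose k) * M n (k + m + 1))
      \<longlonglongrightarrow> real ((k + m + 1) choose k) * (l ^ (k + m + 1) / fact (k + m + 1))"
    by (intro tendsto_mult tendsto_const lim)
  have B': "real ((k + m + 1) choose k) * (l ^ (k + m + 1) / fact (k + m + 1)) = l ^ k / fact k * (l ^ (m + 1) / fact (m + 1))"
    using c[of "m + 1"] by (simp only: add.assoc)
  have "\<forall>\<^sub>F n in sequentially.
      \<bar>(\<Sum>i\<le>m. (- 1) ^ i * real ((k + i) choose k) * M n (k + i)) - l ^ k / fact k * (\<Sum>i\<le>m. (- l) ^ i / fact i)\<bar> < e / 4 \<and>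
      \<bar>real ((k + m + 1) choose k) * M n (k + m + 1) - l ^ k / fact k * (l ^ (m + 1) / fact (m + 1))\<bar> < e / 4"
    using tendstoD[OF A[unfolded A'], of "e / 4"] tendstoD[OF B[unfolded B'], of "e / 4"] e
    unfolding dist_real_def by (auto intro: eventually_conj)
  then have "\<forall>\<^sub>F n in sequentially. \<bar>P n - l ^ k / fact k * exp (- l)\<bar> < e"
  proof eventually_elim
    case (elim n)
    have "\<bar>P n - (\<Sum>i\<le>m. (- 1) ^ i * real ((k + i) choose k) * M n (k + i))\<bar>
        \<le> real ((k + m + 1) choose k) * M n (k + m + 1)"
      using avg_bonferroni[OF S, of n "X n" k m] unfolding P_def M_def .
    then show ?case using elim m by linarith
  qed
  then show "\<exists>no. \<forall>n\<ge>no. norm (real (card {B \<in> S n. X n B = k}) / real (card (S n)) - l ^ k / fact k * exp (- l)) < e"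
    unfolding P_def by (simp add: eventually_sequentially)
qed

text \<open>The distribution function of a law on the naturals is, at each real, a finite sum of
  point masses. So convergence holds at every real and not only at continuity points.\<close>

lemma weak_conv_nat_pmf:
  fixes M :: "nat \<Rightarrow> nat pmf"
  assumes "\<And>k. (\<lambda>n. pmf (M n) k) \<longlonglongrightarrow> pmf L k"
  shows "weak_conv_m (\<lambda>n. distr (M n) borel real) (distr L borel real)"
proof -
  have c: "cdf (distr (measure_pmf p) borel real) x = (\<Sum>k\<in>{k. real k \<le> x}. pmf p k)" for p :: "nat pmf" and x
  proof -
    have "finite {k. real k \<le> x}"
    proof (rule finite_subset)
      show "{k. real k \<le> x} \<subseteq> {..nat \<lfloor>x\<rfloor>}" by (auto simp: le_nat_floor)
    qed simp
    then have "measure (measure_pmf p) {k. real k \<le> x} = (\<Sum>k\<in>{k. real k \<le> x}. pmf p k)"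
      by (rule measure_measure_pmf_finite)
    moreover have "real -` {..x} = {k. real k \<le> x}" by auto
    ultimately show ?thesis by (simp add: cdf_def measure_distr)
  qed
  show ?thesis
    unfolding weak_conv_m_def weak_conv_def c by (intro allI impI tendsto_sum assms)
qed

section \<open>Numerical estimates\<close>

lemma isotropic_rate_eq:
  assumes "q \<ge> 2"
  shows "isotropic_rate q = poisson_parameter q"
proof -
  have "(\<Prod>i<3. g i) = g 0 * g 1 * g 2" for g :: "nat \<Rightarrow> real"
    by (simp add: numeral_3_eq_3 numeral_2_eq_2)
  then have "real (gl_order q 3) = real q ^ 9 * ((1 - 1 / real q) * (1 - 1 / real q ^ 2) * (1 - 1 / real q ^ 3))"
    unfolding gl_order_eq[OF assms] by (simp add: power_one_over power2_eq_square power3_eq_cube mult.assoc)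
  then show ?thesis
    using assms by (simp add: isotropic_rate_def poisson_parameter_def inverse_eq_divide)
qed

lemma poisson_parameter_mono:
  assumes "2 \<le> a" "a \<le> q"
  shows "poisson_parameter q \<le> poisson_parameter a"
proof -
  have f: "inverse (1 - 1 / real q ^ i) \<le> inverse (1 - 1 / real a ^ i)"
    and p: "0 \<le> inverse (1 - 1 / real q ^ i)" "0 \<le> inverse (1 - 1 / real a ^ i)" if "i > 0" for i
  proof -
    have "real a ^ i \<le> real q ^ i" using assms by (intro power_mono) auto
    moreover have a1: "real a ^ i > 1" using assms that by (intro one_less_power) auto
    ultimately have "1 / real q ^ i \<le> 1 / real a ^ i" using assms(1) by (intro frac_le) auto
    moreover have "1 / real a ^ i < 1" using a1 assms(1) by (subst divide_less_eq_1_pos) auto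
    ultimately show "inverse (1 - 1 / real q ^ i) \<le> inverse (1 - 1 / real a ^ i)"
      "0 \<le> inverse (1 - 1 / real q ^ i)" "0 \<le> inverse (1 - 1 / real a ^ i)"
      by (auto intro!: le_imp_inverse_le)
  qed
  show ?thesis
    unfolding poisson_parameter_def
    using f[of 1] f[of 2] f[of 3] p[of 1] p[of 2] p[of 3]
    by (intro mult_mono mult_nonneg_nonneg) auto
qed

lemma poisson_parameter_pos: "2 \<le> q \<Longrightarrow> poisson_parameter q > 0"
  unfolding poisson_parameter_def
  by (intro mult_pos_pos) (auto intro!: power_less_one_iff[THEN iffD2] simp: field_simps one_less_power)

lemma euler_const_le:
  assumes "2 \<le> a" "a \<le> q"
  shows "euler_const q \<le> euler_const a"
proof -
  have "1 / real q \<le> 1 / real a" "1 / real q ^ 2 \<le> 1 / real a ^ 2"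
    using assms by (auto intro!: divide_left_mono power_mono)
  then show ?thesis
    unfolding euler_const_def using euler_const_pos[of a] assms by (intro divide_left_mono) auto
qed

lemma euler_const_nonneg: "2 \<le> q \<Longrightarrow> euler_const q \<ge> 0"
  using euler_const_pos[of q] by (simp add: euler_const_def)

lemma main_factor_tendsto:
  assumes "q \<ge> 2"
  shows "(\<lambda>n. main_factor q n r) \<longlonglongrightarrow> 1"
proof -
  have "(\<lambda>n. real q ^ j / real q ^ n) \<longlonglongrightarrow> 0" for j
    using assms LIMSEQ_divide_realpow_zero[of "real q" "real q ^ j"] by simp
  then have "(\<lambda>n. \<Prod>j<3 * r. 1 - real q ^ j / real q ^ n) \<longlonglongrightarrow> (\<Prod>j<3 * r. 1 - 0)"
    by (intro tendsto_prod tendsto_diff tendsto_const)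
  then show ?thesis by (simp add: main_factor_def)
qed

lemma error_term_tendsto:
  assumes "q \<ge> 2"
  shows "(\<lambda>n. error_term q n r) \<longlonglongrightarrow> 0"
proof -
  have "(\<lambda>n. real q ^ a / real q ^ (b + n)) \<longlonglongrightarrow> 0" for a b :: nat
  proof -
    have "(\<lambda>n. (real q ^ a / real q ^ b) / real q ^ n) \<longlonglongrightarrow> 0"
      using assms by (intro LIMSEQ_divide_realpow_zero) auto
    then show ?thesis by (simp add: power_add)
  qed
  then have "(\<lambda>n. error_term q n r) \<longlonglongrightarrow> euler_const q * isotropic_rate q ^ r * (\<Sum>s\<le>3 * r. 0)"
    unfolding error_term_def by (intro tendsto_mult tendsto_const tendsto_sum)
  then show ?thesis by simp
qed

lemma main_factor_bounds:
  assumes q: "q \<ge> 2" and n: "3 * r \<le> n"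
  shows "main_factor q n r \<le> 1" "main_factor q n r \<ge> 1 - real (3 * r) * (real q ^ (3 * r) / real q ^ n)"
proof -
  have le1: "real q ^ j / real q ^ n \<le> 1" if "j \<le> n" for j
    using q that by (simp add: power_increasing)
  show "main_factor q n r \<le> 1"
    unfolding main_factor_def using n le1 by (intro prod_le_1) auto
  \<comment> \<open>\<open>e\<close> dominates the term subtracted in each factor, so the product is
    at least \<open>(1 - e) ^ (3 * r)\<close> and Bernoulli's inequality applies.\<close>
  define e where "e = real q ^ (3 * r) / real q ^ n"
  have e: "0 \<le> e" "e \<le> 1" using le1[OF n] by (auto simp: e_def)
  have "1 - real (3 * r) * e \<le> (1 - e) ^ (3 * r)"
    using Bernoulli_inequality[of "- e" "3 * r"] e by simp
  also have "\<dots> = (\<Prod>j<3 * r. 1 - e)" by simp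
  also have "\<dots> \<le> main_factor q n r"
    unfolding main_factor_def e_def using q e
    by (intro prod_mono) (auto simp: e_def intro!: divide_right_mono power_increasing)
  finally show "main_factor q n r \<ge> 1 - real (3 * r) * (real q ^ (3 * r) / real q ^ n)"
    by (simp add: e_def)
qed

text \<open>Replaces the unknown \<open>q\<close> by a fixed base \<open>x\<close>, 13 or 2 below,
  so that only the margin \<open>c\<close> between the exponents matters.\<close>

lemma power_quotient_le:
  fixes x :: real
  assumes "1 \<le> x" "x \<le> real q" "a + c \<le> b"
  shows "real q ^ a / real q ^ b \<le> 1 / x ^ c"
proof -
  have "real q ^ a * x ^ c \<le> real q ^ a * real q ^ c" using assms by (intro mult_left_mono power_mono) auto
  also have "\<dots> \<le> real q ^ b" using assms by (simp add: power_add[symmetric] power_increasing)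
  finally show ?thesis using assms by (simp add: field_simps)
qed

lemma error_term_le:
  fixes x :: real
  assumes q: "q \<ge> 2" and x: "1 \<le> x" "x \<le> real q"
    and c: "\<And>s. s \<le> 3 * r \<Longrightarrow> 3 * s * r + 3 * s + 3 + c s \<le> s * s + 9 * r + n"
  shows "error_term q n r \<le> euler_const q * poisson_parameter q ^ r * (\<Sum>s\<le>3 * r. 1 / x ^ c s)"
  unfolding error_term_def isotropic_rate_eq[OF q]
  using euler_const_nonneg[OF q] poisson_parameter_pos[OF q] c
  by (intro mult_left_mono sum_mono power_quotient_le x) auto

lemma upper_moment_le:
  assumes "m \<le> (isotropic_rate q ^ r * main_factor q n r + error_term q n r) / fact r"
    and "q \<ge> 2" "3 * r \<le> n" "error_term q n r \<le> E"
  shows "m \<le> (poisson_parameter q ^ r + E) / fact r"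
proof -
  have "isotropic_rate q ^ r * main_factor q n r \<le> poisson_parameter q ^ r * 1"
    unfolding isotropic_rate_eq[OF assms(2)]
    using main_factor_bounds(1)[OF assms(2,3)] poisson_parameter_pos[OF assms(2)]
    by (intro mult_left_mono) auto
  then have "(isotropic_rate q ^ r * main_factor q n r + error_term q n r) / fact r
      \<le> (poisson_parameter q ^ r + E) / fact r"
    using assms(4) by (intro divide_right_mono) auto
  then show ?thesis using assms(1) by linarith
qed

lemma lower_moment_ge:
  fixes x :: real
  assumes "isotropic_rate q ^ r * main_factor q n r / fact r \<le> m"
    and "q \<ge> 2" "1 \<le> x" "x \<le> real q" "3 * r + c \<le> n"
  shows "m \<ge> poisson_parameter q ^ r * (1 - real (3 * r) / x ^ c) / fact r"
proof -
  have "1 - real (3 * r) / x ^ c \<le> 1 - real (3 * r) * (real q ^ (3 * r) / real q ^ n)"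
    using mult_left_mono[OF power_quotient_le[OF assms(3,4,5)], of "real (3 * r)"] by simp
  then have "1 - real (3 * r) / x ^ c \<le> main_factor q n r"
    using main_factor_bounds(2)[of q r n] assms by simp
  then have "poisson_parameter q ^ r * (1 - real (3 * r) / x ^ c) \<le> poisson_parameter q ^ r * main_factor q n r"
    using poisson_parameter_pos[OF assms(2)] by (intro mult_left_mono) auto
  then have "poisson_parameter q ^ r * (1 - real (3 * r) / x ^ c) / fact r \<le> poisson_parameter q ^ r * main_factor q n r / fact r"
    by (intro divide_right_mono) auto
  then show ?thesis using assms(1) unfolding isotropic_rate_eq[OF assms(2)] by linarith
qed

text \<open>The remainder of order 10 is \<open>exp (- t) * x ^ 10 / fact 10\<close> for some
  positive \<open>t\<close>, hence at most \<open>x ^ 10 / fact 10\<close>.\<close>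

lemma exp_lower_taylor:
  assumes "x > (0 :: real)"
  shows "exp (- x) - x ^ 10 / fact 10 \<le> (\<Sum>i\<le>9. (- 1) ^ i * x ^ i / fact i)"
proof -
  have "\<exists>t>0. t < x \<and> exp (- x) = (\<Sum>m<10. (- 1) ^ m * exp (- 0) / fact m * x ^ m) + (- 1) ^ 10 * exp (- t) / fact 10 * x ^ 10"
  proof (rule Maclaurin[where diff = "\<lambda>m x. (- 1) ^ m * exp (- x)" and f = "\<lambda>x. exp (- x)"])
    show "\<forall>m t. m < 10 \<and> 0 \<le> t \<and> t \<le> x \<longrightarrow>
      ((\<lambda>x. (- 1) ^ m * exp (- x)) has_real_derivative (- 1) ^ Suc m * exp (- t)) (at t)"
      by (auto intro!: derivative_eq_intros)
  qed (use assms in auto)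
  then obtain t where t: "t > 0"
    "exp (- x) = (\<Sum>m<10. (- 1) ^ m / fact m * x ^ m) + exp (- t) / fact 10 * x ^ 10" by auto
  have "exp (- t) / fact 10 * x ^ 10 \<le> 1 / fact 10 * x ^ 10"
    using t(1) assms by (intro mult_right_mono divide_right_mono) auto
  moreover have "(\<Sum>m<10. (- 1) ^ m / fact m * x ^ m) = (\<Sum>i\<le>9. (- 1) ^ i * x ^ i / fact i)"
    by (intro sum.cong) auto
  ultimately show ?thesis using t(2) by simp
qed

text \<open>All that the numerical part takes from the algebra: \<open>M\<close> stands for the
  binomial moments of the number of isotropic three-dimensional subspaces, \<open>Y\<close> for the
  expected number of larger bad ones.\<close>

locale moment_bounds =
  fixes M :: "nat \<Rightarrow> real" and q n :: nat and Y :: real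
  assumes lower: "isotropic_rate q ^ r * main_factor q n r / fact r \<le> M r"
    and upper: "M r \<le> (isotropic_rate q ^ r * main_factor q n r + error_term q n r) / fact r"
    and Y: "Y \<le> euler_const q ^ 2 * real n / real q ^ (n - 4)"
    and q2: "q \<ge> 2"
begin

text \<open>
  Bonferroni's inequality with three terms: with \<open>l\<close> the Poisson parameter,
  \<open>1 - l + l ^ 2 / 2 \<ge> 1 / 2\<close>, while the third moment is at most 0.488. The summand \<open>s = 6\<close> of its
  error term has exponent \<open>12 - n\<close>, which is where \<open>n \<ge> 12\<close> comes from.
\<close>

lemma positive_large_q:
  assumes q: "q \<ge> 13" and n: "n \<ge> 12"
  shows "(\<Sum>i\<le>2 * 1 + 1. (- 1) ^ i * M i) - Y > 0"
proof -
  define l where "l = poisson_parameter q"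
  have l0: "l > 0" using poisson_parameter_pos[OF q2] by (simp add: l_def)
  \<comment> \<open>The value at 13 is about 1.09028.\<close>
  have "poisson_parameter 13 \<le> 10903 / 10000" by (simp add: poisson_parameter_def)
  then have l1: "l \<le> 10903 / 10000" using poisson_parameter_mono[of 13 q] q by (simp add: l_def)
  have "euler_const 13 = 169 / 155" by (simp add: euler_const_def)
  then have C: "0 \<le> euler_const q" "euler_const q \<le> 169 / 155"
    using euler_const_le[of 13 q] q euler_const_nonneg[OF q2] by auto
  have l2: "l ^ 2 \<le> (10903 / 10000) ^ 2" and l3: "l ^ 3 \<le> (10903 / 10000) ^ 3"
    using l0 l1 by (auto intro!: power_mono)
  have x: "1 \<le> (13 :: real)" "13 \<le> real q" using q by auto
  \<comment> \<open>For \<open>r = 3\<close> and \<open>n = 12\<close> the available margin is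
    exactly \<open>(s - 6) ^ 2\<close>; it is kept up to the value 4.\<close>
  define c :: "nat \<Rightarrow> nat" where "c s = (if s = 6 then 0 else if s = 5 \<or> s = 7 then 1 else 4)" for s
  have "3 * s * 3 + 3 * s + 3 + c s \<le> s * s + 9 * 3 + n" if "s \<le> 3 * 3" for s
  proof -
    have "s = 0 \<or> s = 1 \<or> s = 2 \<or> s = 3 \<or> s = 4 \<or> s = 5 \<or> s = 6 \<or> s = 7 \<or> s = 8 \<or> s = 9"
      using that by presburger
    then show ?thesis using n by (elim disjE) (simp_all add: c_def)
  qed
  then have "error_term q n 3 \<le> euler_const q * poisson_parameter q ^ 3 * (\<Sum>s\<le>3 * 3. 1 / 13 ^ c s)"
    by (rule error_term_le[OF q2 x])
  also have "(\<Sum>s\<le>3 * 3. 1 / 13 ^ c s) = 1 + 2 / 13 + 7 / (13 :: real) ^ 4"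
  proof -
    have "{..3 * 3} = {0, 1, 2, 3, 4, 5, 6, 7, 8, 9 :: nat}" by auto
    then show ?thesis by (simp add: c_def)
  qed
  also have "euler_const q * poisson_parameter q ^ 3 * (1 + 2 / 13 + 7 / 13 ^ 4)
      \<le> (169 / 155) * (10903 / 10000) ^ 3 * (1 + 2 / 13 + 7 / 13 ^ 4)"
    using C l0 l3 by (intro mult_right_mono mult_mono) (auto simp: l_def)
  finally have "M 3 \<le> (poisson_parameter q ^ 3 + (169 / 155) * (10903 / 10000) ^ 3 * (1 + 2 / 13 + 7 / 13 ^ 4)) / fact 3"
    using n by (intro upper_moment_le[OF upper q2]) auto
  also have "\<dots> \<le> ((10903 / 10000) ^ 3 + (169 / 155) * (10903 / 10000) ^ 3 * (1 + 2 / 13 + 7 / 13 ^ 4)) / fact 3"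
    using l3 by (intro divide_right_mono add_right_mono) (auto simp: l_def)
  also have "\<dots> \<le> 488 / 1000" by (simp add: fact_numeral power_divide)
  finally have M3: "M 3 \<le> 488 / 1000" .
  \<comment> \<open>For \<open>r = 1\<close> the margin is \<open>(s - 3) ^ 2 + n - 3\<close>, which
    is at least 9.\<close>
  have "3 * s * 1 + 3 * s + 3 + 9 \<le> s * s + 9 * 1 + n" if "s \<le> 3 * 1" for s
  proof -
    have "s = 0 \<or> s = 1 \<or> s = 2 \<or> s = 3" using that by presburger
    then show ?thesis using n by (elim disjE) simp_all
  qed
  then have "error_term q n 1 \<le> euler_const q * poisson_parameter q ^ 1 * (\<Sum>s\<le>3 * (1 :: nat). 1 / 13 ^ 9)"
    by (rule error_term_le[OF q2 x])
  also have "\<dots> \<le> (169 / 155) * (10903 / 10000) * (4 / 13 ^ 9)"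
    using C l0 l1 by (intro mult_mono) (auto simp: l_def)
  finally have "M 1 \<le> (l ^ 1 + (169 / 155) * (10903 / 10000) * (4 / 13 ^ 9)) / fact 1"
    unfolding l_def using n by (intro upper_moment_le[OF upper q2]) auto
  then have M1: "M 1 \<le> l + 1 / 1000" by simp
  have "M 2 \<ge> l ^ 2 * (1 - real (3 * 2) / 13 ^ 6) / fact 2"
    unfolding l_def using n by (intro lower_moment_ge[OF lower q2 x]) auto
  then have M2: "M 2 \<ge> l ^ 2 / 2 - 1 / 1000" using l2 by (simp add: fact_numeral field_simps)
  have "M 0 \<ge> l ^ 0 * (1 - real (3 * 0) / 13 ^ 0) / fact 0"
    unfolding l_def using n by (intro lower_moment_ge[OF lower q2 x]) auto
  then have M0: "M 0 \<ge> 1" by simp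
  have "real (12 + j) \<le> 13 ^ (j + 1)" for j by (induction j) auto
  moreover have "12 + (n - 12) = n" "n - 11 = n - 12 + 1" using n by auto
  ultimately have n13: "real n \<le> 13 ^ (n - 11)" by metis
  have "real n / real q ^ (n - 4) \<le> 13 ^ (n - 11) / 13 ^ (n - 4)"
    using n13 x by (intro frac_le power_mono) auto
  also have "(13 :: real) ^ (n - 4) = 13 ^ (n - 11) * 13 ^ 7"
    using n by (simp add: power_add[symmetric] del: power_numeral)
  finally have "real n / real q ^ (n - 4) \<le> 1 / 13 ^ 7" by simp
  then have "euler_const q ^ 2 * (real n / real q ^ (n - 4)) \<le> (169 / 155) ^ 2 * (1 / 13 ^ 7)"
    using C by (intro mult_mono power_mono) auto
  also have "\<dots> \<le> 1 / 1000" by (simp add: power_divide)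
  finally have "euler_const q ^ 2 * (real n / real q ^ (n - 4)) \<le> 1 / 1000" .
  moreover have "Y \<le> euler_const q ^ 2 * (real n / real q ^ (n - 4))" using Y by simp
  ultimately have Y': "Y \<le> 1 / 1000" by linarith
  \<comment> \<open>This is \<open>(l - 1) ^ 2 \<ge> 0\<close>. The gap between 1/2 and 488/1000
    absorbs the three errors of 1/1000 in \<open>M 1\<close>, \<open>M 2\<close> and
    \<open>Y\<close>.\<close>
  have "l ^ 2 / 2 - l \<ge> - 1 / 2"
    using zero_le_power2[of "l - 1"] by (simp add: power2_diff)
  moreover have "(\<Sum>i\<le>2 * 1 + 1. (- 1) ^ i * M i) = M 0 - M 1 + M 2 - M 3"
    by (simp add: numeral_3_eq_3 numeral_2_eq_2)
  ultimately show ?thesis using M0 M1 M2 M3 Y' by simp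
qed

text \<open>
  For \<open>q = 2\<close> the parameter is \<open>64 / 21\<close>, and nine terms are needed for the truncated series of
  \<open>exp (- l)\<close> to be positive. The summand \<open>s = 15\<close> of the ninth error term has exponent \<open>147 - n\<close>.
\<close>

lemma positive_large_n:
  assumes n: "n \<ge> 160"
  shows "(\<Sum>i\<le>2 * 4 + 1. (- 1) ^ i * M i) - Y > 0"
proof -
  define l where "l = poisson_parameter q"
  have l0: "l > 0" using poisson_parameter_pos[OF q2] by (simp add: l_def)
  \<comment> \<open>The value 64/21 rounded up.\<close>
  have "poisson_parameter 2 \<le> 61 / 20" by (simp add: poisson_parameter_def)
  then have l1: "l \<le> 61 / 20" using poisson_parameter_mono[of 2 q] q2 by (simp add: l_def)
  have "euler_const 2 = 4" by (simp add: euler_const_def)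
  then have C: "0 \<le> euler_const q" "euler_const q \<le> 4"
    using euler_const_le[of 2 q] q2 euler_const_nonneg[OF q2] by auto
  have x: "1 \<le> (2 :: real)" "2 \<le> real q" using q2 by auto
  have err: "error_term q n r \<le> 4 * (61 / 20) ^ r * ((3 * real r + 1) / 2 ^ c)"
    if "\<And>s. s \<le> 3 * r \<Longrightarrow> 3 * s * r + 3 * s + 3 + c \<le> s * s + 9 * r + n" for r c
  proof -
    have "error_term q n r \<le> euler_const q * poisson_parameter q ^ r * (\<Sum>s\<le>3 * r. 1 / 2 ^ c)"
      using that by (intro error_term_le[OF q2 x])
    also have "\<dots> = euler_const q * poisson_parameter q ^ r * ((3 * real r + 1) / 2 ^ c)" by simp
    also have "\<dots> \<le> 4 * (61 / 20) ^ r * ((3 * real r + 1) / 2 ^ c)"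
      using C l0 l1 by (intro mult_right_mono mult_mono power_mono) (auto simp: l_def)
    finally show ?thesis .
  qed
  \<comment> \<open>Completing the square without subtraction. The margin in the \<open>s\<close>-th
    summand is least at \<open>s = 3 * (r + 1) / 2\<close>, so \<open>a\<close> is 15 for
    \<open>r = 9\<close>, 12 for \<open>r \<le> 7\<close>, and 5 for
    \<open>r \<le> 2\<close>.\<close>
  have sq: "2 * a * s \<le> s * s + a * a" for a s :: nat
  proof -
    have "0 \<le> (int s - int a) * (int s - int a)" by simp
    then have "int (2 * a * s) \<le> int (s * s + a * a)" by (simp add: algebra_simps)
    then show ?thesis by (simp only: of_nat_le_iff)
  qed
  have ub: "M r \<le> l ^ r / fact r + 4 * (61 / 20) ^ r * ((3 * real r + 1) / 2 ^ c) / fact r"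
    if "\<And>s. s \<le> 3 * r \<Longrightarrow> 3 * s * r + 3 * s + 3 + c \<le> s * s + 9 * r + n" "3 * r \<le> n" for r c
  proof -
    have "error_term q n r \<le> 4 * (61 / 20) ^ r * ((3 * real r + 1) / 2 ^ c)" by (rule err) (rule that(1))
    then show ?thesis using upper_moment_le[OF upper[of r] q2 that(2)] by (simp add: l_def add_divide_distrib)
  qed
  have M9: "M 9 \<le> l ^ 9 / fact 9 + 1 / 1000"
  proof -
    \<comment> \<open>For \<open>r = 9\<close> the margin is \<open>(s - 15) ^ 2 + n - 147\<close>,
      hence at least 13 for \<open>n \<ge> 160\<close>.\<close>
    have "M 9 \<le> l ^ 9 / fact 9 + 4 * (61 / 20) ^ 9 * ((3 * real 9 + 1) / 2 ^ 13) / fact 9"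
    proof (rule ub)
      fix s show "3 * s * 9 + 3 * s + 3 + 13 \<le> s * s + 9 * 9 + n" using sq[of 15 s] n by linarith
    qed (use n in simp)
    then show ?thesis by (simp add: fact_numeral power_divide)
  qed
  have odd: "M r \<le> l ^ r / fact r + 1 / 1000" if "r \<le> 7" for r
  proof -
    have "M r \<le> l ^ r / fact r + 4 * (61 / 20) ^ r * ((3 * real r + 1) / 2 ^ 40) / fact r"
    proof (rule ub)
      fix s
      show "3 * s * r + 3 * s + 3 + 40 \<le> s * s + 9 * r + n"
      \<comment> \<open>After \<open>24 * s \<le> s * s + 144\<close> the claim needs
        \<open>187 \<le> 9 * r + n\<close>, which \<open>r \<ge> 3\<close> provides. Smaller
        \<open>r\<close> have a smaller coefficient of \<open>s\<close> instead.\<close>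
      proof (cases "r \<ge> 3")
        case True
        have "3 * s * r \<le> 21 * s" using that mult_le_mono2[of r 7 "3 * s"] by simp
        then show ?thesis using sq[of 12 s] n True by linarith
      next
        case False
        then have "3 * s * r \<le> 6 * s" using mult_le_mono2[of r 2 "3 * s"] by simp
        then show ?thesis using sq[of 5 s] n by linarith
      qed
    qed (use n that in simp)
    also have "4 * (61 / 20) ^ r * ((3 * real r + 1) / 2 ^ 40) / fact r \<le> 4 * 4 ^ 7 * ((3 * 7 + 1) / 2 ^ 40) / (1 :: real)"
    proof (intro frac_le mult_mono)
      have "(61 / 20 :: real) ^ r \<le> 4 ^ r" by (intro power_mono) auto
      also have "\<dots> \<le> 4 ^ 7" using that by (intro power_increasing) auto
      finally show "(61 / 20 :: real) ^ r \<le> 4 ^ 7" .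
    qed (use that in \<open>auto simp: fact_ge_1\<close>)
    finally show ?thesis by simp
  qed
  have even: "M r \<ge> l ^ r / fact r - 1 / 1000" if "r \<le> 8" for r
  proof -
    have "M r \<ge> l ^ r * (1 - real (3 * r) / 2 ^ 100) / fact r"
      unfolding l_def using n that by (intro lower_moment_ge[OF lower q2 x]) auto
    moreover have "l ^ r * (real (3 * r) / 2 ^ 100) / fact r \<le> 4 ^ 8 * (24 / 2 ^ 100) / (1 :: real)"
    proof (intro frac_le mult_mono)
      have "l ^ r \<le> 4 ^ r" using l0 l1 by (intro power_mono) auto
      also have "\<dots> \<le> 4 ^ 8" using that by (intro power_increasing) auto
      finally show "l ^ r \<le> 4 ^ 8" .
    qed (use that l0 in \<open>auto simp: fact_ge_1\<close>)
    moreover have "l ^ r * (1 - real (3 * r) / 2 ^ 100) / fact r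
        = l ^ r / fact r - l ^ r * (real (3 * r) / 2 ^ 100) / fact r"
      by (simp only: right_diff_distrib diff_divide_distrib mult_1_right)
    moreover have "4 ^ 8 * (24 / 2 ^ 100) / (1 :: real) \<le> 1 / 1000" by simp
    ultimately show ?thesis by linarith
  qed
  have "real (160 + j) \<le> 2 ^ 60 * 2 ^ j" for j by (induction j) auto
  moreover have "160 + (n - 160) = n" "n - 100 = 60 + (n - 160)" using n by auto
  ultimately have n2: "real n \<le> 2 ^ (n - 100)" by (metis power_add)
  have "real n / real q ^ (n - 4) \<le> 2 ^ (n - 100) / 2 ^ (n - 4)"
    using n2 x by (intro frac_le power_mono) auto
  also have "(2 :: real) ^ (n - 4) = 2 ^ (n - 100) * 2 ^ 96"
    using n by (simp add: power_add[symmetric] del: power_numeral)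
  finally have "real n / real q ^ (n - 4) \<le> 1 / 2 ^ 96" by simp
  then have "euler_const q ^ 2 * (real n / real q ^ (n - 4)) \<le> 4 ^ 2 * (1 / 2 ^ 96)"
    using C by (intro mult_mono power_mono) auto
  moreover have "Y \<le> euler_const q ^ 2 * (real n / real q ^ (n - 4))" using Y by simp
  moreover have "4 ^ 2 * (1 / 2 ^ 96) \<le> 1 / (1000 :: real)" by simp
  ultimately have Y': "Y \<le> 1 / 1000" by linarith
  have "exp (61 / 20) = exp 1 ^ 3 * exp (1 / 20 :: real)"
    by (simp add: exp_of_nat_mult[symmetric] exp_add[symmetric])
  also have "\<dots> \<le> (272 / 100) ^ 3 * (1 + 1 / 20 + (1 / 20) ^ 2)"
    using e_less_272 exp_bound[of "1 / 20"] by (intro mult_mono power_mono) auto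
  also have "\<dots> \<le> 2120 / 100" by (simp add: power2_eq_square power_divide)
  finally have "exp (- (61 / 20 :: real)) \<ge> 1 / (2120 / 100)"
    unfolding exp_minus by (simp add: field_simps)
  moreover have "exp (- (61 / 20)) \<le> exp (- l)" using l1 by simp
  moreover have "471 / 10000 \<le> 1 / (2120 / 100 :: real)" by simp
  ultimately have exp_ge: "exp (- l) \<ge> 471 / 10000" by (meson order_trans)
  have "l ^ 10 / fact 10 \<le> (61 / 20) ^ 10 / fact 10"
    using l0 l1 by (intro divide_right_mono power_mono) auto
  then have "l ^ 10 / fact 10 \<le> 193 / 10000" by (simp add: fact_numeral power_divide)
  with exp_ge have T: "(\<Sum>i\<le>9. (- 1) ^ i * l ^ i / fact i) \<ge> 27 / 1000"
    using exp_lower_taylor[OF l0] by linarith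
  have e: "(\<Sum>i\<le>9. f i) = f 0 + f 1 + f 2 + f 3 + f 4 + f 5 + f 6 + f 7 + f 8 + f 9" for f :: "nat \<Rightarrow> real"
  proof -
    have "{..9} = {0, 1, 2, 3, 4, 5, 6, 7, 8, 9 :: nat}" by auto
    then show ?thesis by simp
  qed
  \<comment> \<open>Ten moments, each with an error of at most 1/1000, and \<open>Y\<close> together
    cost 11/1000 of the available 27/1000.\<close>
  have "(\<Sum>i\<le>9. (- 1) ^ i * M i) \<ge> (\<Sum>i\<le>9. (- 1) ^ i * l ^ i / fact i) - 10 / 1000"
    unfolding e using M9 odd[of 1] odd[of 3] odd[of 5] odd[of 7]
      even[of 0] even[of 2] even[of 4] even[of 6] even[of 8] by simp
  then show ?thesis using T Y' by simp
qed

end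

section \<open>Coordinate spaces over prime fields\<close>

lemma card_prime_field: "prime p \<Longrightarrow> card (carrier (prime_field p)) = p"
  by (simp add: residue_ring_def)

lemma finite_vectorspace_coord_space:
  assumes "prime p"
  shows "finite_vectorspace (prime_field p) (coord_space p n)"
proof -
  interpret vectorspace "prime_field p" "coord_space p n" by (rule coord_space_vectorspace[OF assms])
  show ?thesis
    by unfold_locales (simp_all add: carrier_coord_space[OF assms] finite_PiE residue_ring_def)
qed

lemma card_coord_space: "prime p \<Longrightarrow> card (carrier (coord_space p n)) = p ^ n"
  by (simp add: carrier_coord_space card_PiE)

lemma codim3_setting_coord_space:
  assumes "prime p" "n \<ge> 3"
  shows "codim3_setting (prime_field p) (coord_space p n) (coord_space p (n - 3)) n"
  using assms by (intro codim3_setting.intro codim3_setting_axioms.intro alternating_setting.intro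
      finite_vectorspace_coord_space) (simp_all add: card_coord_space card_prime_field)

definition n_bad3 :: "nat \<Rightarrow> nat \<Rightarrow> ((nat \<Rightarrow> int) \<Rightarrow> (nat \<Rightarrow> int) \<Rightarrow> nat \<Rightarrow> int) \<Rightarrow> nat" where
  "n_bad3 p n B = card {H \<in> bad_subspaces p n B. subspace_dim p n H = 3}"

definition n_bad4 :: "nat \<Rightarrow> nat \<Rightarrow> ((nat \<Rightarrow> int) \<Rightarrow> (nat \<Rightarrow> int) \<Rightarrow> nat \<Rightarrow> int) \<Rightarrow> nat" where
  "n_bad4 p n B = card {H \<in> bad_subspaces p n B. subspace_dim p n H \<ge> 4}"

definition moment3 :: "nat \<Rightarrow> nat \<Rightarrow> nat \<Rightarrow> real" where
  "moment3 p n r = (\<Sum>B\<in>Alt p n. real (n_bad3 p n B choose r)) / real (card (Alt p n))"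

definition mean4 :: "nat \<Rightarrow> nat \<Rightarrow> real" where
  "mean4 p n = (\<Sum>B\<in>Alt p n. real (n_bad4 p n B)) / real (card (Alt p n))"

lemma bad_subspaces_subspace: "H \<in> bad_subspaces p n B \<Longrightarrow> VectorSpace.subspace (prime_field p) H (coord_space p n)"
  by (simp add: bad_subspaces_def bad_def)

lemma card_subspace_dim:
  assumes p: "prime p" and H: "VectorSpace.subspace (prime_field p) H (coord_space p n)"
  shows "card H = p ^ subspace_dim p n H"
proof -
  interpret V: finite_vectorspace "prime_field p" "coord_space p n"
    by (rule finite_vectorspace_coord_space[OF p])
  interpret S: vectorspace "prime_field p" "(coord_space p n)\<lparr>carrier := H\<rparr>"
    by (rule V.subspace_is_vs[OF H])
  interpret S: finite_vectorspace "prime_field p" "(coord_space p n)\<lparr>carrier := H\<rparr>"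
    by unfold_locales (use V.finite_K V.finite_subspace[OF H] in simp_all)
  show ?thesis using S.card_carrier card_prime_field[OF p] by (simp add: subspace_dim_def)
qed

lemma finite_bad_subspaces:
  assumes p: "prime p"
  shows "finite (bad_subspaces p n B)"
proof -
  interpret V: finite_vectorspace "prime_field p" "coord_space p n"
    by (rule finite_vectorspace_coord_space[OF p])
  show ?thesis
    by (rule finite_subset[OF _ V.finite_subspaces]) (auto intro: bad_subspaces_subspace)
qed

lemma bad_subspace_dim_iff:
  assumes p: "prime p" and n: "n \<ge> 5" and B: "B \<in> Alt p n"
    and H: "VectorSpace.subspace (prime_field p) H (coord_space p n)"
  shows "H \<in> bad_subspaces p n B \<Longrightarrow> subspace_dim p n H \<ge> 3"
    and "subspace_dim p n H = 3 \<Longrightarrow> H \<in> bad_subspaces p n B \<longleftrightarrow>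
      totally_isotropic (prime_field p) (coord_space p (n - 3)) B H"
proof -
  let ?K = "prime_field p" let ?V = "coord_space p n" let ?W = "coord_space p (n - 3)"
  interpret C: codim3_setting ?K ?V ?W n using codim3_setting_coord_space[OF p, of n] n by simp
  have A: "B \<in> C.A" using B by (simp add: Alt_def)
  note q = card_prime_field[OF p]
  have S: "VectorSpace.subspace ?K (image_span ?K ?W B H) ?W"
    using C.image_span_subspace[OF A C.V.subspaceD(1)[OF H]] .
  obtain ys :: "(nat \<Rightarrow> int) list" where ys: "card (image_span ?K ?W B H) = p ^ length ys"
    using C.W.subspace_basis[OF S] q by metis
  have h: "card H = p ^ subspace_dim p n H" by (rule card_subspace_dim[OF p H])
  have bad: "H \<in> bad_subspaces p n B \<longleftrightarrow> H \<noteq> carrier ?V \<and> length ys + 3 \<le> subspace_dim p n H"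
    using C.bad_iff[OF A H] h ys q by (simp add: bad_subspaces_def)
  show "H \<in> bad_subspaces p n B \<Longrightarrow> subspace_dim p n H \<ge> 3" using bad by simp
  assume 3: "subspace_dim p n H = 3"
  have "H \<noteq> carrier ?V"
  proof
    assume "H = carrier ?V"
    then have "p ^ 3 = p ^ n" using h 3 card_coord_space[OF p] by simp
    then have "3 = n" using C.V.q_power_inject[of 3 n] q by simp
    then show False using n by simp
  qed
  then have "H \<in> bad_subspaces p n B \<longleftrightarrow> length ys = 0" using bad 3 by simp
  also have "\<dots> \<longleftrightarrow> card (image_span ?K ?W B H) = 1"
    using ys C.V.q_power_inject[of "length ys" 0] q by simp
  also have "\<dots> \<longleftrightarrow> totally_isotropic ?K ?W B H"
    unfolding totally_isotropic_def by (rule C.W.card_zero_subspace_iff[OF S])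
  finally show "H \<in> bad_subspaces p n B \<longleftrightarrow> totally_isotropic ?K ?W B H" .
qed

lemma bad_subspaces_empty_iff:
  assumes p: "prime p" and n: "n \<ge> 5" and B: "B \<in> Alt p n"
  shows "bad_subspaces p n B = {} \<longleftrightarrow> n_bad3 p n B = 0 \<and> n_bad4 p n B = 0"
proof -
  have "subspace_dim p n H = 3 \<or> subspace_dim p n H \<ge> 4" if "H \<in> bad_subspaces p n B" for H
    using bad_subspace_dim_iff(1)[OF p n B bad_subspaces_subspace[OF that] that] by linarith
  then show ?thesis
    using finite_bad_subspaces[OF p, of n B] by (auto simp: n_bad3_def n_bad4_def)
qed

text \<open>Transfer to coordinate spaces: \<open>subspace_dim\<close> is read off from
  cardinalities, and three-dimensional bad subspaces are the isotropic ones.\<close>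

lemma moment_bounds_coord_space:
  assumes p: "prime p" and n: "n \<ge> 5"
  shows "moment_bounds (moment3 p n) p n (mean4 p n)"
proof -
  let ?K = "prime_field p" let ?V = "coord_space p n" let ?W = "coord_space p (n - 3)"
  interpret C: codim3_setting ?K ?V ?W n using codim3_setting_coord_space[OF p, of n] n by simp
  note q = card_prime_field[OF p]
  have A: "C.A = Alt p n" by (simp add: Alt_def)
  have p3: "card H = p ^ 3 \<longleftrightarrow> subspace_dim p n H = 3" "p ^ 4 \<le> card H \<longleftrightarrow> 4 \<le> subspace_dim p n H"
    if "VectorSpace.subspace ?K H ?V" for H
    using card_subspace_dim[OF p that] C.V.q_power_inject[of _ 3] C.q_gt_1 q
    by (simp_all add: power_increasing_iff)
  have "C.n_isotropic B = n_bad3 p n B" if B: "B \<in> Alt p n" for B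
  proof -
    have "H \<in> C.V.sub3 \<and> (\<forall>x\<in>H. \<forall>y\<in>H. B x y = \<zero>\<^bsub>?W\<^esub>) \<longleftrightarrow> H \<in> bad_subspaces p n B \<and> subspace_dim p n H = 3" for H
    proof (cases "VectorSpace.subspace ?K H ?V")
      case True
      have "totally_isotropic ?K ?W B H \<longleftrightarrow> (\<forall>x\<in>H. \<forall>y\<in>H. B x y = \<zero>\<^bsub>?W\<^esub>)"
        using C.totally_isotropic_iff[of B H] B A C.V.subspaceD(1)[OF True] by blast
      moreover have "H \<in> C.V.sub3 \<longleftrightarrow> subspace_dim p n H = 3"
        using True p3(1)[OF True] q by (simp add: C.V.sub3_def)
      ultimately show ?thesis using bad_subspace_dim_iff(2)[OF p n B True] by blast
    next
      case False
      then show ?thesis using bad_subspaces_subspace by (auto simp: C.V.sub3_def)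
    qed
    then show ?thesis by (simp add: C.n_isotropic_def n_bad3_def)
  qed
  then have M: "C.binomial_moment r = moment3 p n r" for r
    unfolding C.binomial_moment_def moment3_def A by simp
  have Y: "card {H. bad ?K ?V ?W B H \<and> card H \<ge> p ^ 4} = n_bad4 p n B" for B
    unfolding n_bad4_def bad_subspaces_def
    by (intro arg_cong[where f = card] Collect_cong) (use p3(2) in \<open>auto simp: bad_def\<close>)
  show ?thesis
  proof
    fix r
    show "isotropic_rate p ^ r * main_factor p n r / fact r \<le> moment3 p n r"
      "moment3 p n r \<le> (isotropic_rate p ^ r * main_factor p n r + error_term p n r) / fact r"
      using C.binomial_moment_bounds[of r] M q by simp_all
  next
    have "(\<Sum>B\<in>Alt p n. real (n_bad4 p n B)) \<le> real (card (Alt p n)) * (euler_const p ^ 2 * real n / real p ^ (n - 4))"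
      using C.sum_card_bad[OF n] unfolding A q Y .
    then show "mean4 p n \<le> euler_const p ^ 2 * real n / real p ^ (n - 4)"
      using C.card_A_pos unfolding A mean4_def by (simp add: pos_divide_le_eq mult.commute)
    show "p \<ge> 2" using prime_ge_2_nat[OF p] .
  qed
qed

text \<open>The constant is \<open>4 ^ 2 * 13\<close>: 4 bounds \<open>euler_const\<close>, and 13
  is the least integer with \<open>n ^ 2 \<le> 13 * 2 ^ (n - 4)\<close> at \<open>n = 5\<close>. For
  \<open>p > n\<close> one factor \<open>p\<close> is set aside to match the maximum, and
  \<open>n \<le> 13 * 2 ^ (n - 5)\<close> suffices for the rest.\<close>

lemma mean4_le:
  assumes p: "prime p" and n: "n \<ge> 5"
  shows "mean4 p n \<le> 208 / real (max n p)"
proof -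
  interpret moment_bounds "moment3 p n" p n "mean4 p n" by (rule moment_bounds_coord_space[OF assms])
  have p2: "real p \<ge> 2" using q2 by simp
  have "(real k + 5) ^ 2 \<le> 13 * 2 ^ (k + 1)" for k
  proof (induction k)
    case (Suc k)
    have "(real (Suc k) + 5) ^ 2 \<le> 2 * (real k + 5) ^ 2" by (simp add: power2_eq_square algebra_simps)
    then show ?case using Suc by simp
  qed simp
  moreover have "n - 5 + 1 = n - 4" "real (n - 5) + 5 = real n" using n by auto
  ultimately have n2: "real n ^ 2 \<le> 13 * 2 ^ (n - 4)" by metis
  have "real k + 5 \<le> 13 * 2 ^ k" for k :: nat by (induction k) auto
  from this[of "n - 5"] have n1: "real n \<le> 13 * 2 ^ (n - 5)" using n by (simp add: of_nat_diff)
  have "real n * real (max n p) \<le> 13 * real p ^ (n - 4)"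
  proof (cases "p \<le> n")
    case True
    have "real n * real n \<le> 13 * real p ^ (n - 4)"
      using n2 power_mono[of 2 "real p" "n - 4"] p2 by (simp add: power2_eq_square)
    then show ?thesis using True by (simp add: max_def)
  next
    case False
    have "real n * real p \<le> 13 * real p ^ (n - 5) * real p"
      using n1 power_mono[of 2 "real p" "n - 5"] p2 by (intro mult_right_mono) auto
    also have "\<dots> = 13 * real p ^ (n - 4)"
    proof -
      have "n - 4 = Suc (n - 5)" using n by simp
      then show ?thesis by simp
    qed
    finally show ?thesis using False by (simp add: max_def)
  qed
  then have r: "real n / real p ^ (n - 4) \<le> 13 / real (max n p)"
    using n p2 by (simp add: field_simps)
  have "euler_const 2 = 4" by (simp add: euler_const_def)
  then have "euler_const p ^ 2 \<le> 4 ^ 2"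
    using euler_const_le[of 2 p] euler_const_nonneg[OF q2] q2 by (intro power_mono) auto
  then have "euler_const p ^ 2 * (real n / real p ^ (n - 4)) \<le> 4 ^ 2 * (13 / real (max n p))"
    using r by (intro mult_mono) auto
  then show ?thesis using Y by simp
qed

lemma mean4_nonneg: "mean4 p n \<ge> 0"
  unfolding mean4_def by (intro divide_nonneg_nonneg sum_nonneg) auto

lemma expectation_random_Alt:
  fixes f :: "_ \<Rightarrow> real"
  assumes "prime p"
  shows "measure_pmf.expectation (random_Alt p n) f = (\<Sum>B\<in>Alt p n. f B) / real (card (Alt p n))"
  unfolding random_Alt_def by (rule integral_pmf_of_set[OF Alt_nonempty[OF assms] finite_Alt[OF assms]])

lemma prob_random_Alt:
  assumes "prime p"
  shows "measure_pmf.prob (random_Alt p n) {B. P B} = real (card {B \<in> Alt p n. P B}) / real (card (Alt p n))"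
  by (simp add: random_Alt_def measure_pmf_of_set[OF Alt_nonempty[OF assms] finite_Alt[OF assms]] Int_def)

text \<open>No subspace is bad iff none of dimension 3 and none of larger dimension is, and by
  Markov's inequality the latter kind occurs with probability at most
  \<open>mean4 p n\<close>.\<close>

lemma prob_no_bad:
  assumes p: "prime p" and n: "n \<ge> 5"
  defines "P0 \<equiv> real (card {B \<in> Alt p n. n_bad3 p n B = 0}) / real (card (Alt p n))"
  shows "measure_pmf.prob (random_Alt p n) {B. bad_subspaces p n B = {}} \<le> P0"
    "measure_pmf.prob (random_Alt p n) {B. bad_subspaces p n B = {}} \<ge> P0 - mean4 p n"
proof -
  let ?E = "{B \<in> Alt p n. bad_subspaces p n B = {}}" and ?X = "{B \<in> Alt p n. n_bad3 p n B = 0}"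
  let ?Y = "{B \<in> Alt p n. n_bad4 p n B \<noteq> 0}"
  note fin = finite_Alt[OF p, of n]
  have E: "?E = ?X - ?Y"
  proof (rule Set.set_eqI)
    fix B
    show "B \<in> ?E \<longleftrightarrow> B \<in> ?X - ?Y"
      by (cases "B \<in> Alt p n") (simp_all add: bad_subspaces_empty_iff[OF p n])
  qed
  show "measure_pmf.prob (random_Alt p n) {B. bad_subspaces p n B = {}} \<le> P0"
    unfolding prob_random_Alt[OF p] P0_def E using fin
    by (intro divide_right_mono of_nat_mono card_mono) auto
  have "card ?X \<le> card (?E \<union> ?Y)" unfolding E using fin by (intro card_mono) auto
  then have "card ?X \<le> card ?E + card ?Y" using card_Un_le[of ?E ?Y] by linarith
  moreover have "real (card ?Y) \<le> (\<Sum>B\<in>Alt p n. real (n_bad4 p n B))"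
  proof -
    have "real (card ?Y) = (\<Sum>B\<in>?Y. 1)" by simp
    also have "\<dots> \<le> (\<Sum>B\<in>?Y. real (n_bad4 p n B))" by (intro sum_mono) auto
    also have "\<dots> \<le> (\<Sum>B\<in>Alt p n. real (n_bad4 p n B))" using fin by (intro sum_mono2) auto
    finally show ?thesis .
  qed
  ultimately have "real (card ?X) - (\<Sum>B\<in>Alt p n. real (n_bad4 p n B)) \<le> real (card ?E)" by linarith
  then show "measure_pmf.prob (random_Alt p n) {B. bad_subspaces p n B = {}} \<ge> P0 - mean4 p n"
    unfolding prob_random_Alt[OF p] P0_def mean4_def diff_divide_distrib[symmetric]
    by (rule divide_right_mono) simp
qed

lemma prob_no_bad_pos:
  assumes p: "prime p" and n: "n \<ge> 5" and pos: "(\<Sum>i\<le>2 * m + 1. (- 1) ^ i * moment3 p n i) - mean4 p n > 0"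
  shows "measure_pmf.prob (random_Alt p n) {B. bad_subspaces p n B = {}} > 0"
proof -
  let ?A = "Alt p n"
  have "(\<Sum>i\<le>2 * m + 1. (- 1) ^ i * moment3 p n i)
      = (\<Sum>i\<le>2 * m + 1. \<Sum>B\<in>?A. (- 1) ^ i * real (n_bad3 p n B choose i)) / real (card ?A)"
    by (simp only: moment3_def sum_divide_distrib sum_distrib_left times_divide_eq_right)
  also have "\<dots> = (\<Sum>B\<in>?A. \<Sum>i\<le>2 * m + 1. (- 1) ^ i * real (n_bad3 p n B choose i)) / real (card ?A)"
    by (subst sum.swap) (rule refl)
  also have "\<dots> \<le> (\<Sum>B\<in>?A. if n_bad3 p n B = 0 then 1 else 0) / real (card ?A)"
    by (intro divide_right_mono sum_mono bonferroni_lower) auto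
  also have "(\<Sum>B\<in>?A. if n_bad3 p n B = 0 then 1 else 0 :: real) = real (card {B \<in> ?A. n_bad3 p n B = 0})"
    using finite_Alt[OF p] by (simp add: sum.If_cases Int_def)
  finally show ?thesis using pos prob_no_bad(2)[OF p n] by linarith
qed

lemma moment3_tendsto:
  assumes p: "prime p"
  shows "(\<lambda>n. moment3 p n r) \<longlonglongrightarrow> poisson_parameter p ^ r / fact r"
proof -
  have p2: "p \<ge> 2" using prime_ge_2_nat[OF p] .
  let ?l = "isotropic_rate p"
  have ev: "\<forall>\<^sub>F n in sequentially. n \<ge> 5" by (rule eventually_ge_at_top)
  have "(\<lambda>n. ?l ^ r * main_factor p n r / fact r) \<longlonglongrightarrow> ?l ^ r * 1 / fact r"
    by (intro tendsto_intros main_factor_tendsto[OF p2]) auto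
  moreover have "(\<lambda>n. (?l ^ r * main_factor p n r + error_term p n r) / fact r) \<longlonglongrightarrow> (?l ^ r * 1 + 0) / fact r"
    by (intro tendsto_intros main_factor_tendsto[OF p2] error_term_tendsto[OF p2]) auto
  ultimately show ?thesis
    unfolding isotropic_rate_eq[OF p2, symmetric] add_0_right mult_1_right
  proof (rule tendsto_sandwich[rotated 2])
    show "\<forall>\<^sub>F n in sequentially. ?l ^ r * main_factor p n r / fact r \<le> moment3 p n r"
      using ev by eventually_elim (rule moment_bounds.lower[OF moment_bounds_coord_space[OF p]])
    show "\<forall>\<^sub>F n in sequentially. moment3 p n r \<le> (?l ^ r * main_factor p n r + error_term p n r) / fact r"
      using ev by eventually_elim (rule moment_bounds.upper[OF moment_bounds_coord_space[OF p]])
  qed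
qed

lemma n_bad3_poisson:
  assumes p: "prime p"
  shows "(\<lambda>n. real (card {B \<in> Alt p n. n_bad3 p n B = k}) / real (card (Alt p n)))
    \<longlonglongrightarrow> poisson_parameter p ^ k / fact k * exp (- poisson_parameter p)"
  by (rule poisson_limit[OF finite_Alt[OF p]]) (rule moment3_tendsto[OF p, unfolded moment3_def])

lemma mean4_tendsto:
  assumes p: "prime p"
  shows "(\<lambda>n. mean4 p n) \<longlonglongrightarrow> 0"
proof (rule tendsto_sandwich[of "\<lambda>_. 0"])
  show "\<forall>\<^sub>F n in sequentially. mean4 p n \<le> 208 / real n"
    using eventually_ge_at_top[of 5]
  proof eventually_elim
    case (elim n)
    have "208 / real (max n p) \<le> 208 / real n" using elim by (intro divide_left_mono) auto
    then show ?case using mean4_le[OF p elim] by linarith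
  qed
  show "(\<lambda>n. 208 / real n) \<longlonglongrightarrow> 0" by (rule lim_const_over_n)
qed (auto simp: mean4_nonneg)

lemma weak_conv_n_bad3:
  assumes p: "prime p"
  shows "weak_conv_m (\<lambda>n. distr (random_Alt p n) borel (\<lambda>B. real (n_bad3 p n B)))
    (distr (poisson_pmf (poisson_parameter p)) borel real)"
proof -
  have "distr (random_Alt p n) borel (\<lambda>B. real (n_bad3 p n B))
      = distr (map_pmf (n_bad3 p n) (random_Alt p n)) borel real" for n
    by (simp add: map_pmf_rep_eq distr_distr comp_def)
  moreover have "pmf (map_pmf (n_bad3 p n) (random_Alt p n)) k
      = real (card {B \<in> Alt p n. n_bad3 p n B = k}) / real (card (Alt p n))" for n k
    using prob_random_Alt[OF p, of n "\<lambda>B. n_bad3 p n B = k"] by (simp add: pmf_map vimage_def)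
  moreover have "pmf (poisson_pmf (poisson_parameter p)) k
      = poisson_parameter p ^ k / fact k * exp (- poisson_parameter p)" for k
    using poisson_parameter_pos[OF prime_ge_2_nat[OF p]] by simp
  ultimately show ?thesis using weak_conv_nat_pmf[of "\<lambda>n. map_pmf (n_bad3 p n) (random_Alt p n)"
      "poisson_pmf (poisson_parameter p)"] n_bad3_poisson[OF p] by simp
qed

theorem proposition4p1:
  shows
    "((\<lambda>(n, p). measure_pmf.expectation (random_Alt p n)
          (\<lambda>B. real (card {H \<in> bad_subspaces p n B. subspace_dim p n H \<ge> 4})))
        \<longlongrightarrow> 0)
       (filtercomap (\<lambda>(n, p). max n p) at_top \<sqinter> principal {(n, p). n \<ge> 5 \<and> prime p})
     \<and>
     (\<forall>p n. prime p \<and> n \<ge> 5 \<longrightarrow>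
        (\<forall>B\<in>Alt p n. \<forall>H.
           VectorSpace.subspace (prime_field p) H (coord_space p n) \<and> subspace_dim p n H = 3 \<longrightarrow>
           (H \<in> bad_subspaces p n B \<longleftrightarrow>
            totally_isotropic (prime_field p) (coord_space p (n - 3)) B H)))
     \<and>
     (\<forall>p. prime p \<longrightarrow>
        weak_conv_m
          (\<lambda>n. distr (random_Alt p n) borel
                 (\<lambda>B. real (card {H \<in> bad_subspaces p n B. subspace_dim p n H = 3})))
          (distr (poisson_pmf (poisson_parameter p)) borel real))
     \<and>
     (\<forall>p n. prime p \<and> n \<ge> 5 \<and> (min p n \<ge> 12 \<or> n \<ge> 160) \<longrightarrow>
        measure_pmf.prob (random_Alt p n) {B. bad_subspaces p n B = {}} > 0)
     \<and>
     (\<forall>p. prime p \<longrightarrow>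
        (\<lambda>n. measure_pmf.prob (random_Alt p n) {B. bad_subspaces p n B = {}})
          \<longlonglongrightarrow> exp (- poisson_parameter p))"
proof (intro conjI allI impI ballI)
  let ?F = "filtercomap (\<lambda>(n, p). max n p) at_top \<sqinter> principal {(n :: nat, p :: nat). n \<ge> 5 \<and> prime p}"
  have e: "measure_pmf.expectation (random_Alt p n)
      (\<lambda>B. real (card {H \<in> bad_subspaces p n B. subspace_dim p n H \<ge> 4})) = mean4 p n" if "prime p" for p n
    using expectation_random_Alt[OF that] by (simp add: mean4_def n_bad4_def)
  have ev: "\<forall>\<^sub>F x in ?F. fst x \<ge> 5 \<and> prime (snd x)"
    unfolding eventually_inf_principal by (auto intro: always_eventually)
  \<comment> \<open>The bound of \<open>mean4_le\<close> depends on the pair only through the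
    maximum, which is exactly what the comapped filter controls.\<close>
  have "filterlim (\<lambda>(n, p). max n p) at_top ?F"
    by (rule filterlim_mono[OF filterlim_filtercomap order_refl]) simp
  then have "filterlim (\<lambda>x. real (case x of (n, p) \<Rightarrow> max n p)) at_top ?F"
    by (rule filterlim_compose[OF filterlim_real_sequentially])
  then have lim: "((\<lambda>x. 208 / real (case x of (n, p) \<Rightarrow> max n p)) \<longlongrightarrow> 0) ?F"
    by (rule tendsto_divide_0[OF tendsto_const filterlim_at_top_imp_at_infinity])
  show "((\<lambda>(n, p). measure_pmf.expectation (random_Alt p n)
      (\<lambda>B. real (card {H \<in> bad_subspaces p n B. subspace_dim p n H \<ge> 4}))) \<longlongrightarrow> 0) ?F"
  proof (rule tendsto_sandwich[OF _ _ tendsto_const lim])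
    show "\<forall>\<^sub>F x in ?F. 0 \<le> (case x of (n, p) \<Rightarrow> measure_pmf.expectation (random_Alt p n)
      (\<lambda>B. real (card {H \<in> bad_subspaces p n B. subspace_dim p n H \<ge> 4})))"
      using ev by eventually_elim (auto simp: e mean4_nonneg)
    show "\<forall>\<^sub>F x in ?F. (case x of (n, p) \<Rightarrow> measure_pmf.expectation (random_Alt p n)
      (\<lambda>B. real (card {H \<in> bad_subspaces p n B. subspace_dim p n H \<ge> 4}))) \<le> 208 / real (case x of (n, p) \<Rightarrow> max n p)"
      using ev
    proof eventually_elim
      case (elim x)
      obtain n p where x: "x = (n, p)" by (cases x)
      show ?case using elim mean4_le[of p n] unfolding x by (simp add: e)
    qed
  qed
next
  fix p n B H
  assume "prime p \<and> n \<ge> 5" "B \<in> Alt p n"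
    "VectorSpace.subspace (prime_field p) H (coord_space p n) \<and> subspace_dim p n H = 3"
  then show "H \<in> bad_subspaces p n B \<longleftrightarrow> totally_isotropic (prime_field p) (coord_space p (n - 3)) B H"
    using bad_subspace_dim_iff(2) by blast
next
  fix p :: nat assume "prime p"
  then show "weak_conv_m (\<lambda>n. distr (random_Alt p n) borel
       (\<lambda>B. real (card {H \<in> bad_subspaces p n B. subspace_dim p n H = 3})))
     (distr (poisson_pmf (poisson_parameter p)) borel real)"
    using weak_conv_n_bad3 by (simp add: n_bad3_def)
next
  fix p n :: nat assume h: "prime p \<and> n \<ge> 5 \<and> (min p n \<ge> 12 \<or> n \<ge> 160)"
  then have p: "prime p" and n: "n \<ge> 5" by auto
  interpret moment_bounds "moment3 p n" p n "mean4 p n" by (rule moment_bounds_coord_space[OF p n])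
  show "measure_pmf.prob (random_Alt p n) {B. bad_subspaces p n B = {}} > 0"
  proof (cases "n \<ge> 160")
    case True
    show ?thesis by (rule prob_no_bad_pos[OF p n positive_large_n[OF True]])
  next
    case False
    then have pn: "p \<ge> 12" "n \<ge> 12" using h by auto
    \<comment> \<open>Since 12 is composite, the hypothesis on \<open>p\<close> already gives 13,
      the base used in \<open>positive_large_q\<close>.\<close>
    have "\<not> prime (12 :: nat)" by (simp add: prime_nat_iff) (rule exI[of _ 2], simp)
    then have "p \<noteq> 12" using p by auto
    then have "p \<ge> 13" using pn by simp
    then show ?thesis by (rule prob_no_bad_pos[OF p n positive_large_q[OF _ pn(2)]])
  qed
next
  fix p :: nat assume p: "prime p"
  let ?P = "\<lambda>n. measure_pmf.prob (random_Alt p n) {B. bad_subspaces p n B = {}}"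
  let ?X = "\<lambda>n. real (card {B \<in> Alt p n. n_bad3 p n B = 0}) / real (card (Alt p n))"
  have X: "?X \<longlonglongrightarrow> exp (- poisson_parameter p)" using n_bad3_poisson[OF p, of 0] by simp
  then have XY: "(\<lambda>n. ?X n - mean4 p n) \<longlonglongrightarrow> exp (- poisson_parameter p)"
    using tendsto_diff[OF X mean4_tendsto[OF p]] by simp
  show "?P \<longlonglongrightarrow> exp (- poisson_parameter p)"
  proof (rule tendsto_sandwich[OF _ _ XY X])
    show "\<forall>\<^sub>F n in sequentially. ?X n - mean4 p n \<le> ?P n"
      using eventually_ge_at_top[of 5] by eventually_elim (rule prob_no_bad(2)[OF p])
    show "\<forall>\<^sub>F n in sequentially. ?P n \<le> ?X n"
      using eventually_ge_at_top[of 5] by eventually_elim (rule prob_no_bad(1)[OF p])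
  qed
qed

end
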